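(* Let $X$ be an orbifold of dimension $2n$ with a symplectic form $\omega\in\Omega^2(X)$. Then the following conditions are equivalent: (1) every cohomology class in $H^*(X)$ has a harmonic representative; (2) for each $k\in\{0,1,\ldots,n\}$ the mapping $L^k:H^{n-k}(X)\to H^{n+k}(X)$ is surjective, where $L[\xi]=[\omega\wedge\xi]$.
   Context: Orbifolds. An $m$-dimensional local uniformizing system over an open set $U$ of a topological space $X$ is a triple $(V,G,\pi)$ with $V\subset\mathbb{R}^m$ open, $G$ a finite group acting smoothly and effectively on $V$, and $\pi:V\to U$ a continuous $G$-invariant map inducing a homeomorphism $V/G\cong U$. An $m$-dimensional orbifold is a Hausdorff, second-countable space $X$ with an open covering $\{U_i\}$ and local uniformizing systems $(V_i,G_i,\pi_i)$ over the $U_i$ satisfying the usual (Satake, Chen–Ruan) compatibility conditions, expressed by injections $(V_i,G_i,\pi_i)\to(V_j,G_j,\pi_j)$: smooth open embeddings $\varphi:V_i\to V_j$, equivariant with respect to an injective homomorphism $G_i\to G_j$, with $\pi_j\circ\varphi=\pi_i$. Forms. A $k$-form on $X$ (a section of the orbifold bundle $\bigwedge^kT^*X$) is given by $G_i$-invariant smooth $k$-forms on the $V_i$, compatible with all injections; $\Omega^k(X)$ is the space of such forms. Wedge product and exterior derivative $d$ are defined on the $V_i$, and $H^*(X)$ is the cohomology of $(\Omega^*(X),d)$. Multivector fields on $X$ are defined in the same way. A symplectic form on $X$ is a closed nondegenerate $\omega\in\Omega^2(X)$. Symplectic star and harmonicity. On each $V_i$ the map $Z\mapsto\iota_Z\omega$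 from vector fields to $1$-forms extends multiplicatively to an algebra isomorphism $\flat$ from multivector fields to forms. Define $\star\xi=\iota_{\flat^{-1}(\xi)}\omega^n$, where $\iota_{Z_1\wedge\dots\wedge Z_k}\eta=\eta(Z_1,\dots,Z_k,\cdot)$. This is compatible with the $G_i$-actions and the injections and gives $\star:\Omega^k(X)\to\Omega^{2n-k}(X)$. Put $\delta\xi=(-1)^k\star d\star\xi$ for $\xi\in\Omega^k(X)$. A form $\xi$ is harmonic if $d\xi=0$ and $\delta\xi=0$. *)

theory Defs
  imports "HOL-Analysis.Analysis" "HOL-Algebra.Group_Action"
begin

section \<open>Alternating multilinear functions\<close>

text \<open>
  An element of degree \<open>k\<close> of an exterior algebra is a function on lists of arguments that
  vanishes on lists of length other than \<open>k\<close> and is alternating multilinear on lists of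
  length \<open>k\<close>.  The argument type is the space of tangent vectors \<open>'a\<close> for forms, and the space
  of covectors \<open>'a \<Rightarrow>\<^sub>L real\<close> for multivectors (\<open>\<Lambda>\<^sup>k V\<close> is the space of
  alternating forms on the dual of \<open>V\<close>).
\<close>

definition alternating :: "nat \<Rightarrow> ('v::real_vector list \<Rightarrow> real) \<Rightarrow> bool" where
  "alternating k \<eta> \<longleftrightarrow>
     (\<forall>vs. length vs \<noteq> k \<longrightarrow> \<eta> vs = 0) \<and>
     (\<forall>vs i. length vs = k \<longrightarrow> i < k \<longrightarrow> linear (\<lambda>v. \<eta> (vs[i := v]))) \<and>
     (\<forall>vs i j. length vs = k \<longrightarrow> i < j \<longrightarrow> j < k \<longrightarrow> vs ! i = vs ! j \<longrightarrow> \<eta> vs = 0)"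

text \<open>
  Wedge product in the normalisation
  \<open>(\<alpha>\<^sub>1 \<and> \<dots> \<and> \<alpha>\<^sub>k)(v\<^sub>1, \<dots>, v\<^sub>k) = det (\<alpha>\<^sub>i(v\<^sub>j))\<close>, as a sum over shuffles: \<open>S\<close> is the set of
  positions whose arguments are fed to the first factor.
\<close>

definition shuffle_sign :: "nat \<Rightarrow> nat set \<Rightarrow> real" where
  "shuffle_sign m S = (-1) ^ card {(i, j). i < m \<and> j < i \<and> i \<in> S \<and> j \<notin> S}"

definition wedge :: "('v list \<Rightarrow> real) \<Rightarrow> ('v list \<Rightarrow> real) \<Rightarrow> 'v list \<Rightarrow> real" where
  "wedge \<alpha> \<beta> vs =
     (\<Sum>S \<in> Pow {..<length vs}.
        shuffle_sign (length vs) S * \<alpha> (nths vs S) * \<beta> (nths vs (- S)))"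

definition wedge_unit :: "'v list \<Rightarrow> real" where
  "wedge_unit vs = (if vs = [] then 1 else 0)"

primrec wedge_power :: "('v list \<Rightarrow> real) \<Rightarrow> nat \<Rightarrow> 'v list \<Rightarrow> real" where
  "wedge_power \<alpha> 0 = wedge_unit"
| "wedge_power \<alpha> (Suc m) = wedge \<alpha> (wedge_power \<alpha> m)"

definition vec_multivector :: "'a::real_normed_vector \<Rightarrow> ('a \<Rightarrow>\<^sub>L real) list \<Rightarrow> real" where
  "vec_multivector z \<alpha>s = (case \<alpha>s of [\<alpha>] \<Rightarrow> blinfun_apply \<alpha> z | _ \<Rightarrow> 0)"

definition decomposable :: "'a::real_normed_vector list \<Rightarrow> ('a \<Rightarrow>\<^sub>L real) list \<Rightarrow> real" where
  "decomposable zs = foldr (\<lambda>z W. wedge (vec_multivector z) W) zs wedge_unit"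

text \<open>
  The contraction \<open>\<iota>\<^sub>Z \<eta>\<close> of a form with a \<open>k\<close>-vector is the linear extension in \<open>Z\<close> of
  \<open>\<iota>\<^bsub>Z\<^sub>1 \<and> \<dots> \<and> Z\<^sub>k\<^esub> \<eta> = \<eta>(Z\<^sub>1, \<dots>, Z\<^sub>k, \<cdot>)\<close>; below, it is applied to the expansion
  \<open>Z = 1/k! \<Sum> Z(e\<^sup>*\<^bsub>i\<^sub>1\<^esub>, \<dots>, e\<^sup>*\<^bsub>i\<^sub>k\<^esub>) e\<^bsub>i\<^sub>1\<^esub> \<and> \<dots> \<and> e\<^bsub>i\<^sub>k\<^esub>\<close>
  (the lemma \<open>contract_decomposable\<close> recovers the formula).
\<close>

definition contract ::
    "nat \<Rightarrow> (('a::euclidean_space \<Rightarrow>\<^sub>L real) list \<Rightarrow> real) \<Rightarrow> ('a list \<Rightarrow> real) \<Rightarrow> 'a list \<Rightarrow> real" where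
  "contract k Z \<eta> vs =
     (\<Sum>es | set es \<subseteq> Basis \<and> length es = k. Z (map blinfun_inner_left es) * \<eta> (es @ vs)) / fact k"

text \<open>
  For \<open>Z = Z\<^sub>1 \<and> \<dots> \<and> Z\<^sub>k\<close> the following is
  \<open>\<iota>\<^bsub>Z\<^sub>1\<^esub>\<beta> \<and> \<dots> \<and> \<iota>\<^bsub>Z\<^sub>k\<^esub>\<beta>\<close>, evaluated at \<open>vs\<close>; the lemmas \<open>flat_vec\<close>, \<open>flat_unit\<close> and \<open>flat_wedge\<close>
  say that it is the multiplicative extension of \<open>Z \<mapsto> \<iota>\<^sub>Z \<beta>\<close>.
\<close>

definition flat ::
    "('a::real_normed_vector list \<Rightarrow> real) \<Rightarrow> (('a \<Rightarrow>\<^sub>L real) list \<Rightarrow> real) \<Rightarrow> 'a list \<Rightarrow> real" where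
  "flat \<beta> Z vs = Z (map (\<lambda>v. Blinfun (\<lambda>z. \<beta> [z, v])) vs)"

lemma flat_unit: "flat \<beta> wedge_unit = wedge_unit"
  by (auto simp: flat_def wedge_unit_def)

lemma flat_wedge: "flat \<beta> (wedge Z W) = wedge (flat \<beta> Z) (flat \<beta> W)"
  by (rule ext) (simp add: flat_def wedge_def nths_map)

lemma flat_vec:
  fixes \<beta> :: "'a::euclidean_space list \<Rightarrow> real"
  assumes "alternating 2 \<beta>"
  shows "flat \<beta> (vec_multivector z) [v] = \<beta> [z, v]"
proof -
  have "linear (\<lambda>u. \<beta> ([0, v][0 := u]))"
    using assms unfolding alternating_def by (metis length_Cons list.size(3) numeral_2_eq_2 zero_less_numeral)
  then have "bounded_linear (\<lambda>u. \<beta> [u, v])"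
    by (simp add: linear_conv_bounded_linear)
  then show ?thesis
    by (simp add: flat_def vec_multivector_def bounded_linear_Blinfun_apply)
qed

lemma wedge_vec:
  "wedge (vec_multivector z) W \<alpha>s =
     (\<Sum>i<length \<alpha>s. (-1) ^ i * blinfun_apply (\<alpha>s ! i) z * W (take i \<alpha>s @ drop (Suc i) \<alpha>s))"
proof -
  let ?m = "length \<alpha>s"
  let ?f = "\<lambda>S. shuffle_sign ?m S * vec_multivector z (nths \<alpha>s S) * W (nths \<alpha>s (- S))"
  have "wedge (vec_multivector z) W \<alpha>s = sum ?f ((\<lambda>i. {i}) ` {..<?m})"
    unfolding wedge_def
  proof (rule sum.mono_neutral_right)
    show "\<forall>S \<in> Pow {..<?m} - (\<lambda>i. {i}) ` {..<?m}. ?f S = 0"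
    proof
      fix S assume S: "S \<in> Pow {..<?m} - (\<lambda>i. {i}) ` {..<?m}"
      have "length (nths \<alpha>s S) = card S"
        using S by (auto simp: length_nths intro!: arg_cong[where f = card])
      moreover have "card S \<noteq> 1"
        using S by (auto simp: card_1_singleton_iff)
      ultimately have "vec_multivector z (nths \<alpha>s S) = 0"
        by (auto simp: vec_multivector_def split: list.splits)
      then show "?f S = 0" by simp
    qed
  qed auto
  also have "\<dots> = (\<Sum>i<?m. ?f {i})"
    by (subst sum.reindex) auto
  also have "\<dots> = (\<Sum>i<?m. (-1) ^ i * blinfun_apply (\<alpha>s ! i) z * W (take i \<alpha>s @ drop (Suc i) \<alpha>s))"
  proof (rule sum.cong)
    fix i assume "i \<in> {..<?m}"
    then have i: "i < ?m" by simp
    then have \<alpha>s: "\<alpha>s = take i \<alpha>s @ \<alpha>s ! i # drop (Suc i) \<alpha>s"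
      by (simp add: id_take_nth_drop)
    have "{(a, j). a < ?m \<and> j < a \<and> a \<in> {i} \<and> j \<notin> {i}} = (\<lambda>j. (i, j)) ` {..<i}"
      using i by auto
    then have "shuffle_sign ?m {i} = (-1) ^ i"
      by (simp add: shuffle_sign_def card_image inj_on_def)
    moreover have "nths \<alpha>s {i} = [\<alpha>s ! i]"
    proof -
      have "length (nths (take i \<alpha>s) {i}) = 0"
        by (simp add: length_nths)
      moreover have "nths (drop (Suc i) \<alpha>s) {j. Suc j + i \<in> {i}} = []"
        by simp
      ultimately show ?thesis
        using i by (subst \<alpha>s) (simp add: nths_append nths_Cons min_def)
    qed
    moreover have "nths \<alpha>s (- {i}) = take i \<alpha>s @ drop (Suc i) \<alpha>s"
    proof -
      have "nths (take i \<alpha>s) (- {i}) = take i \<alpha>s"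
        by (rule nths_all) auto
      moreover have "nths (drop (Suc i) \<alpha>s) {j. Suc j + i \<in> - {i}} = drop (Suc i) \<alpha>s"
        by (rule nths_all) auto
      ultimately show ?thesis
        using i by (subst \<alpha>s) (simp add: nths_append nths_Cons min_def)
    qed
    ultimately show "?f {i} =
        (-1) ^ i * blinfun_apply (\<alpha>s ! i) z * W (take i \<alpha>s @ drop (Suc i) \<alpha>s)"
      by (simp add: vec_multivector_def)
  qed simp
  finally show ?thesis .
qed

lemma alternating_swap:
  assumes "alternating n \<eta>"
  shows "\<eta> (as @ x # y # bs) = - \<eta> (as @ y # x # bs)"
proof (cases "length as + 2 + length bs = n")
  case False
  then show ?thesis using assms by (simp add: alternating_def)
next
  case True
  have z: "\<eta> (as @ u # u # bs) = 0" for u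
    using assms True unfolding alternating_def
    by (elim conjE allE[where x = "as @ u # u # bs"] allE[where x = "length as"]
        allE[where x = "Suc (length as)"]) (auto simp: nth_append)
  have lin: "linear (\<lambda>v. \<eta> ((as @ a # b # bs)[i := v]))" if "i < n" for a b i
    using assms True that unfolding alternating_def by (metis add.assoc add.commute
        add_2_eq_Suc length_Cons length_append)
  have l1: "\<eta> (as @ (u + v) # b # bs) = \<eta> (as @ u # b # bs) + \<eta> (as @ v # b # bs)" for u v b
    using linear_add[OF lin[of "length as" u b], of u v] True by simp
  have l2: "\<eta> (as @ b # (u + v) # bs) = \<eta> (as @ b # u # bs) + \<eta> (as @ b # v # bs)" for u v b
    using linear_add[OF lin[of "Suc (length as)" b u], of u v] True by (simp add: list_update_append)
  have "0 = \<eta> (as @ (x + y) # (x + y) # bs)" by (simp add: z)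
  also have "\<dots> = \<eta> (as @ x # y # bs) + \<eta> (as @ y # x # bs)"
    by (simp only: l1 l2) (simp add: z)
  finally show ?thesis by linarith
qed

lemma alternating_move:
  assumes "alternating n \<eta>"
  shows "\<eta> (as @ x # bs) = (-1) ^ length as * \<eta> (x # as @ bs)"
proof (induction as arbitrary: bs rule: rev_induct)
  case (snoc a as)
  have "\<eta> ((as @ [a]) @ x # bs) = - \<eta> (as @ x # a # bs)"
    using alternating_swap[OF assms, of as a x bs] by simp
  then show ?case using snoc[of "a # bs"] by simp
qed simp

lemma alternating_Cons:
  assumes "alternating (Suc n) \<eta>"
  shows "alternating n (\<lambda>us. \<eta> (z # us))"
  unfolding alternating_def
proof (intro conjI allI impI)
  fix vs :: "'a list" and i assume "length vs = n" "i < n"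
  then have "linear (\<lambda>v. \<eta> ((z # vs)[Suc i := v]))"
    using assms unfolding alternating_def by (metis Suc_less_eq length_Cons)
  then show "linear (\<lambda>v. \<eta> (z # vs[i := v]))" by simp
next
  fix vs :: "'a list" and i j assume "length vs = n" "i < j" "j < n" "vs ! i = vs ! j"
  then show "\<eta> (z # vs) = 0"
    using assms unfolding alternating_def
    by (metis Suc_less_eq length_Cons nth_Cons_Suc)
next
  fix vs :: "'a list" assume "length vs \<noteq> n"
  then show "\<eta> (z # vs) = 0"
    using assms unfolding alternating_def by simp
qed

lemma contract_wedge_vec:
  fixes \<eta> :: "'a::euclidean_space list \<Rightarrow> real"
  assumes "alternating n \<eta>"
  shows "contract (Suc k) (wedge (vec_multivector z) W) \<eta> vs = contract k W (\<lambda>us. \<eta> (z # us)) vs"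
proof (cases "Suc k + length vs = n")
  case False
  then show ?thesis using assms by (auto simp: contract_def alternating_def intro!: sum.neutral)
next
  case True
  let ?L = "\<lambda>k. {es :: 'a list. set es \<subseteq> Basis \<and> length es = k}"
  let ?\<phi> = "map (blinfun_inner_left :: 'a \<Rightarrow> _)"
  let ?R = "\<Sum>es \<in> ?L k. W (?\<phi> es) * \<eta> (z # es @ vs)"
  have lin: "linear (\<lambda>v. \<eta> (v # es @ vs))" if "length es = k" for es
  proof -
    have "linear (\<lambda>v. \<eta> ((0 # es @ vs)[0 := v]))"
      using assms True that unfolding alternating_def
      by (elim conjE allE[where x = "0 # es @ vs"] allE[where x = 0]) auto
    then show ?thesis by simp
  qed
  have step: "(\<Sum>es \<in> ?L (Suc k). (-1) ^ i * (z \<bullet> es ! i) *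
        W (?\<phi> (take i es @ drop (Suc i) es)) * \<eta> (es @ vs)) = ?R" if i: "i < Suc k" for i
  proof -
    let ?ins = "\<lambda>(e :: 'a, es). take i es @ e # drop i es"
    have "(\<Sum>es \<in> ?L (Suc k). (-1) ^ i * (z \<bullet> es ! i) *
        W (?\<phi> (take i es @ drop (Suc i) es)) * \<eta> (es @ vs)) =
      (\<Sum>(e, es) \<in> Basis \<times> ?L k. (z \<bullet> e) * W (?\<phi> es) * \<eta> (e # es @ vs))"
    proof (rule sum.reindex_bij_witness[where i = ?ins
          and j = "\<lambda>es. (es ! i, take i es @ drop (Suc i) es)"])
      fix es assume es: "es \<in> ?L (Suc k)"
      then have split: "es = take i es @ es ! i # drop (Suc i) es"
        using i by (simp add: id_take_nth_drop)
      show "?ins (es ! i, take i es @ drop (Suc i) es) = es"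
        using split i es by simp
      show "(es ! i, take i es @ drop (Suc i) es) \<in> Basis \<times> ?L k"
        using es i by (auto dest: in_set_takeD in_set_dropD)
      have "\<eta> (es @ vs) = (-1) ^ i * \<eta> (es ! i # take i es @ drop (Suc i) es @ vs)"
      proof -
        have "es @ vs = take i es @ es ! i # (drop (Suc i) es @ vs)"
          by (subst (1) split) simp
        moreover have "length (take i es) = i"
          using es i by simp
        ultimately show ?thesis
          using alternating_move[OF assms, of "take i es" "es ! i" "drop (Suc i) es @ vs"] by metis
      qed
      moreover have "(-1 :: real) ^ i * (-1) ^ i = 1"
        by (simp flip: power_mult_distrib)
      ultimately have "\<eta> (es ! i # take i es @ drop (Suc i) es @ vs) = (-1) ^ i * \<eta> (es @ vs)"
        by simp
      then show "(case (es ! i, take i es @ drop (Suc i) es) of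
          (e, es) \<Rightarrow> (z \<bullet> e) * W (?\<phi> es) * \<eta> (e # es @ vs)) =
        (-1) ^ i * (z \<bullet> es ! i) * W (?\<phi> (take i es @ drop (Suc i) es)) * \<eta> (es @ vs)"
        by (simp add: ac_simps)
    next
      fix p :: "'a \<times> 'a list" assume p: "p \<in> Basis \<times> ?L k"
      obtain e es where [simp]: "p = (e, es)" by (cases p)
      have len: "length (take i es) = i" using p i by simp
      show "(?ins p ! i, take i (?ins p) @ drop (Suc i) (?ins p)) = p"
        using len by (simp add: nth_append)
      show "?ins p \<in> ?L (Suc k)"
        using p i by (auto dest: in_set_takeD in_set_dropD)
    qed
    also have "\<dots> = (\<Sum>es \<in> ?L k. \<Sum>e \<in> Basis. (z \<bullet> e) * W (?\<phi> es) * \<eta> (e # es @ vs))"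
      by (subst sum.cartesian_product[symmetric]) (rule sum.swap)
    also have "\<dots> = ?R"
    proof (rule sum.cong)
      fix es assume "es \<in> ?L k"
      then have l: "linear (\<lambda>v. \<eta> (v # es @ vs))" using lin by simp
      have "\<eta> (z # es @ vs) = \<eta> ((\<Sum>e\<in>Basis. (z \<bullet> e) *\<^sub>R e) # es @ vs)"
        by (simp add: euclidean_representation)
      also have "\<dots> = (\<Sum>e\<in>Basis. (z \<bullet> e) * \<eta> (e # es @ vs))"
        using linear_sum[OF l, of "\<lambda>e. (z \<bullet> e) *\<^sub>R e" Basis] linear_cmul[OF l] by simp
      finally show "(\<Sum>e \<in> Basis. (z \<bullet> e) * W (?\<phi> es) * \<eta> (e # es @ vs)) =
          W (?\<phi> es) * \<eta> (z # es @ vs)"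
        by (simp add: sum_distrib_left algebra_simps)
    qed simp
    finally show ?thesis .
  qed
  have "(\<Sum>es \<in> ?L (Suc k). wedge (vec_multivector z) W (?\<phi> es) * \<eta> (es @ vs)) =
      (\<Sum>es \<in> ?L (Suc k). \<Sum>i<Suc k. (-1) ^ i * (z \<bullet> es ! i) *
        W (?\<phi> (take i es @ drop (Suc i) es)) * \<eta> (es @ vs))"
    by (rule sum.cong) (auto simp: wedge_vec sum_distrib_right take_map drop_map simp del: sum.lessThan_Suc)
  also have "\<dots> = (\<Sum>i<Suc k. ?R)"
    by (subst sum.swap) (rule sum.cong, simp, rule step, simp)
  also have "\<dots> = (1 + real k) * ?R" by simp
  finally show ?thesis
    unfolding contract_def fact_Suc of_nat_Suc
    by (simp only:) (rule mult_divide_mult_cancel_left, simp)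
qed

lemma contract_decomposable:
  fixes \<eta> :: "'a::euclidean_space list \<Rightarrow> real"
  assumes "alternating n \<eta>"
  shows "contract (length zs) (decomposable zs) \<eta> vs = \<eta> (zs @ vs)"
  using assms
proof (induction zs arbitrary: n \<eta>)
  case Nil
  have "{es :: 'a list. set es \<subseteq> Basis \<and> length es = 0} = {[]}" by auto
  then show ?case by (simp add: contract_def decomposable_def wedge_unit_def)
next
  case (Cons z zs)
  have *: "contract (length (z # zs)) (decomposable (z # zs)) \<eta> vs =
      contract (length zs) (decomposable zs) (\<lambda>us. \<eta> (z # us)) vs"
    using contract_wedge_vec[OF Cons.prems] by (simp add: decomposable_def)
  show ?case
  proof (cases n)
    case 0
    then have "\<eta> (u # us) = 0" for u us
      using Cons.prems by (simp add: alternating_def)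
    then show ?thesis unfolding * by (simp add: contract_def)
  next
    case (Suc m)
    then show ?thesis
      unfolding * using Cons.IH[OF alternating_Cons, of m \<eta> z] Cons.prems by simp
  qed
qed

section \<open>Smooth maps and differential forms on open subsets\<close>

text \<open>For open \<open>S\<close> in a finite-dimensional space this is the usual class \<open>C\<^sup>k\<close>.\<close>

primrec Ck_on :: "nat \<Rightarrow> 'a::euclidean_space set \<Rightarrow> ('a \<Rightarrow> 'b::real_normed_vector) \<Rightarrow> bool" where
  "Ck_on 0 S f \<longleftrightarrow> continuous_on S f"
| "Ck_on (Suc k) S f \<longleftrightarrow>
     (\<forall>x\<in>S. f differentiable (at x)) \<and> (\<forall>v. Ck_on k S (\<lambda>x. frechet_derivative f (at x) v))"

definition smooth_on :: "'a::euclidean_space set \<Rightarrow> ('a \<Rightarrow> 'b::real_normed_vector) \<Rightarrow> bool" where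
  "smooth_on S f \<longleftrightarrow> (\<forall>k. Ck_on k S f)"

definition smooth_form :: "'a::euclidean_space set \<Rightarrow> nat \<Rightarrow> ('a \<Rightarrow> 'a list \<Rightarrow> real) \<Rightarrow> bool" where
  "smooth_form V k \<eta> \<longleftrightarrow>
     (\<forall>x\<in>V. alternating k (\<eta> x)) \<and> (\<forall>vs. smooth_on V (\<lambda>x. \<eta> x vs))"

definition pullback ::
    "('a::euclidean_space \<Rightarrow> 'a) \<Rightarrow> ('a \<Rightarrow> 'a list \<Rightarrow> real) \<Rightarrow> 'a \<Rightarrow> 'a list \<Rightarrow> real" where
  "pullback f \<eta> x vs = \<eta> (f x) (map (frechet_derivative f (at x)) vs)"

text \<open>
  \<open>(d\<eta>)\<^sub>x(v\<^sub>0, \<dots>, v\<^sub>k) = \<Sum>\<^sub>i (-1)\<^sup>i D(y \<mapsto> \<eta>\<^sub>y(v\<^sub>0, \<dots>, v\<^sub>i\<^sub>-\<^sub>1, v\<^sub>i\<^sub>+\<^sub>1, \<dots>, v\<^sub>k))(x) v\<^sub>i\<close>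
\<close>

definition ext_deriv ::
    "('a::euclidean_space \<Rightarrow> 'a list \<Rightarrow> real) \<Rightarrow> 'a \<Rightarrow> 'a list \<Rightarrow> real" where
  "ext_deriv \<eta> x vs =
     (\<Sum>i<length vs.
        (-1) ^ i * frechet_derivative (\<lambda>y. \<eta> y (take i vs @ drop (Suc i) vs)) (at x) (vs ! i))"

section \<open>Orbifolds\<close>

record ('a, 'g, 'x) chart =
  chart_dom :: "'a set"
  chart_group :: "'g monoid"
  chart_act :: "'g \<Rightarrow> 'a \<Rightarrow> 'a"
  chart_proj :: "'a \<Rightarrow> 'x"

definition quotient_topology :: "'a topology \<Rightarrow> ('a \<Rightarrow> 'b) \<Rightarrow> 'b topology" where
  "quotient_topology T f =
     topology (\<lambda>W. W \<subseteq> f ` topspace T \<and> openin T {x \<in> topspace T. f x \<in> W})"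

lemma openin_quotient_topology:
  "openin (quotient_topology T f) W \<longleftrightarrow>
     W \<subseteq> f ` topspace T \<and> openin T {x \<in> topspace T. f x \<in> W}"
proof -
  let ?P = "\<lambda>W. W \<subseteq> f ` topspace T \<and> openin T {x \<in> topspace T. f x \<in> W}"
  have "istopology ?P"
    unfolding istopology_def
  proof (intro conjI allI impI)
    fix S S' assume "?P S" "?P S'"
    moreover have "{x \<in> topspace T. f x \<in> S \<inter> S'} =
        {x \<in> topspace T. f x \<in> S} \<inter> {x \<in> topspace T. f x \<in> S'}" by auto
    ultimately show "S \<inter> S' \<subseteq> f ` topspace T"
      and "openin T {x \<in> topspace T. f x \<in> S \<inter> S'}" by auto
  next
    fix \<K> assume K: "\<forall>K\<in>\<K>. ?P K"
    have "{x \<in> topspace T. f x \<in> \<Union>\<K>} = (\<Union>K\<in>\<K>. {x \<in> topspace T. f x \<in> K})" by auto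
    then show "\<Union>\<K> \<subseteq> f ` topspace T" and "openin T {x \<in> topspace T. f x \<in> \<Union>\<K>}"
      using K by auto
  qed
  then show ?thesis
    by (simp add: quotient_topology_def)
qed

definition orbit_space :: "('a::euclidean_space, 'g, 'x) chart \<Rightarrow> 'a set topology" where
  "orbit_space c =
     quotient_topology (top_of_set (chart_dom c)) (orbit (chart_group c) (chart_act c))"

text \<open>
  The dimension of the system is \<open>DIM('a)\<close>.  The library predicate \<open>faithful_action\<close> includes
  that \<open>chart_group c\<close> is a group acting on \<open>chart_dom c\<close>.
\<close>

definition uniformizing_system ::
    "'x topology \<Rightarrow> 'x set \<Rightarrow> ('a::euclidean_space, 'g, 'x) chart \<Rightarrow> bool" where
  "uniformizing_system X U c \<longleftrightarrow>
     openin X U \<and> open (chart_dom c) \<and>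
     finite (carrier (chart_group c)) \<and>
     faithful_action (chart_group c) (chart_dom c) (chart_act c) \<and>
     (\<forall>g \<in> carrier (chart_group c). smooth_on (chart_dom c) (chart_act c g)) \<and>
     continuous_map (top_of_set (chart_dom c)) (subtopology X U) (chart_proj c) \<and>
     (\<forall>g \<in> carrier (chart_group c). \<forall>x \<in> chart_dom c.
        chart_proj c (chart_act c g x) = chart_proj c x) \<and>
     homeomorphic_map (orbit_space c) (subtopology X U) (\<lambda>P. the_elem (chart_proj c ` P))"

definition smooth_open_embedding :: "'a::euclidean_space set \<Rightarrow> 'a set \<Rightarrow> ('a \<Rightarrow> 'a) \<Rightarrow> bool" where
  "smooth_open_embedding V V' \<phi> \<longleftrightarrow>
     smooth_on V \<phi> \<and> inj_on \<phi> V \<and> \<phi> ` V \<subseteq> V' \<and> open (\<phi> ` V) \<and>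
     smooth_on (\<phi> ` V) (the_inv_into V \<phi>)"

definition chart_injection ::
    "('a::euclidean_space, 'g, 'x) chart \<Rightarrow> ('a, 'g, 'x) chart \<Rightarrow> ('a \<Rightarrow> 'a) \<Rightarrow> bool" where
  "chart_injection c c' \<phi> \<longleftrightarrow>
     smooth_open_embedding (chart_dom c) (chart_dom c') \<phi> \<and>
     (\<exists>h \<in> hom (chart_group c) (chart_group c'). inj_on h (carrier (chart_group c)) \<and>
        (\<forall>g \<in> carrier (chart_group c). \<forall>x \<in> chart_dom c.
           \<phi> (chart_act c g x) = chart_act c' (h g) (\<phi> x))) \<and>
     (\<forall>x \<in> chart_dom c. chart_proj c' (\<phi> x) = chart_proj c x)"

text \<open>The last two conditions are the compatibility conditions of Satake.\<close>

definition orbifold ::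
    "'x topology \<Rightarrow> 'i set \<Rightarrow> ('i \<Rightarrow> 'x set) \<Rightarrow>
      ('i \<Rightarrow> ('a::euclidean_space, 'g, 'x) chart) \<Rightarrow> bool" where
  "orbifold X I U c \<longleftrightarrow>
     Hausdorff_space X \<and> second_countable X \<and>
     (\<Union>i\<in>I. U i) = topspace X \<and>
     (\<forall>i\<in>I. uniformizing_system X (U i) (c i)) \<and>
     (\<forall>i\<in>I. \<forall>j\<in>I. U i \<subseteq> U j \<longrightarrow> (\<exists>\<phi>. chart_injection (c i) (c j) \<phi>)) \<and>
     (\<forall>i\<in>I. \<forall>j\<in>I. \<forall>p \<in> U i \<inter> U j. \<exists>k\<in>I. p \<in> U k \<and> U k \<subseteq> U i \<inter> U j)"

section \<open>Forms and cohomology of an orbifold\<close>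

text \<open>
  A form is a family indexed by the charts.  It is set to zero outside the chart domains, so that
  two forms are equal as functions iff they are equal as sections.
\<close>

definition on_charts ::
    "'i set \<Rightarrow> ('i \<Rightarrow> ('a, 'g, 'x) chart) \<Rightarrow>
      ('i \<Rightarrow> 'a \<Rightarrow> 'a list \<Rightarrow> real) \<Rightarrow> 'i \<Rightarrow> 'a \<Rightarrow> 'a list \<Rightarrow> real" where
  "on_charts I c \<xi> i x vs = (if i \<in> I \<and> x \<in> chart_dom (c i) then \<xi> i x vs else 0)"

definition orbi_forms ::
    "'i set \<Rightarrow> ('i \<Rightarrow> ('a::euclidean_space, 'g, 'x) chart) \<Rightarrow> nat \<Rightarrow>
      ('i \<Rightarrow> 'a \<Rightarrow> 'a list \<Rightarrow> real) set" where
  "orbi_forms I c k = {\<xi>.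
     on_charts I c \<xi> = \<xi> \<and>
     (\<forall>i\<in>I. smooth_form (chart_dom (c i)) k (\<xi> i)) \<and>
     (\<forall>i\<in>I. \<forall>g \<in> carrier (chart_group (c i)). \<forall>x \<in> chart_dom (c i).
        pullback (chart_act (c i) g) (\<xi> i) x = \<xi> i x) \<and>
     (\<forall>i\<in>I. \<forall>j\<in>I. \<forall>\<phi>. chart_injection (c i) (c j) \<phi> \<longrightarrow>
        (\<forall>x \<in> chart_dom (c i). pullback \<phi> (\<xi> j) x = \<xi> i x))}"

definition orbi_d ::
    "'i set \<Rightarrow> ('i \<Rightarrow> ('a::euclidean_space, 'g, 'x) chart) \<Rightarrow>
      ('i \<Rightarrow> 'a \<Rightarrow> 'a list \<Rightarrow> real) \<Rightarrow> 'i \<Rightarrow> 'a \<Rightarrow> 'a list \<Rightarrow> real" where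
  "orbi_d I c \<xi> = on_charts I c (\<lambda>i. ext_deriv (\<xi> i))"

definition orbi_wedge ::
    "('i \<Rightarrow> 'a \<Rightarrow> 'a list \<Rightarrow> real) \<Rightarrow> ('i \<Rightarrow> 'a \<Rightarrow> 'a list \<Rightarrow> real) \<Rightarrow>
      'i \<Rightarrow> 'a \<Rightarrow> 'a list \<Rightarrow> real" where
  "orbi_wedge \<xi> \<zeta> i x = wedge (\<xi> i x) (\<zeta> i x)"

definition closed_forms ::
    "'i set \<Rightarrow> ('i \<Rightarrow> ('a::euclidean_space, 'g, 'x) chart) \<Rightarrow> nat \<Rightarrow>
      ('i \<Rightarrow> 'a \<Rightarrow> 'a list \<Rightarrow> real) set" where
  "closed_forms I c k = {\<xi> \<in> orbi_forms I c k. orbi_d I c \<xi> = (\<lambda>_ _ _. 0)}"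

definition exact_forms ::
    "'i set \<Rightarrow> ('i \<Rightarrow> ('a::euclidean_space, 'g, 'x) chart) \<Rightarrow> nat \<Rightarrow>
      ('i \<Rightarrow> 'a \<Rightarrow> 'a list \<Rightarrow> real) set" where
  "exact_forms I c k =
     (case k of 0 \<Rightarrow> {\<lambda>_ _ _. 0} | Suc m \<Rightarrow> orbi_d I c ` orbi_forms I c m)"

definition cohomology_class ::
    "'i set \<Rightarrow> ('i \<Rightarrow> ('a::euclidean_space, 'g, 'x) chart) \<Rightarrow> nat \<Rightarrow>
      ('i \<Rightarrow> 'a \<Rightarrow> 'a list \<Rightarrow> real) \<Rightarrow> ('i \<Rightarrow> 'a \<Rightarrow> 'a list \<Rightarrow> real) set" where
  "cohomology_class I c k \<xi> = (\<lambda>\<eta> i x vs. \<xi> i x vs + \<eta> i x vs) ` exact_forms I c k"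

definition cohomology ::
    "'i set \<Rightarrow> ('i \<Rightarrow> ('a::euclidean_space, 'g, 'x) chart) \<Rightarrow> nat \<Rightarrow>
      ('i \<Rightarrow> 'a \<Rightarrow> 'a list \<Rightarrow> real) set set" where
  "cohomology I c k = cohomology_class I c k ` closed_forms I c k"

section \<open>Symplectic forms, the symplectic star and the Lefschetz map\<close>

definition symplectic_form ::
    "'i set \<Rightarrow> ('i \<Rightarrow> ('a::euclidean_space, 'g, 'x) chart) \<Rightarrow>
      ('i \<Rightarrow> 'a \<Rightarrow> 'a list \<Rightarrow> real) \<Rightarrow> bool" where
  "symplectic_form I c \<omega> \<longleftrightarrow>
     \<omega> \<in> closed_forms I c 2 \<and>
     (\<forall>i\<in>I. \<forall>x \<in> chart_dom (c i). \<forall>v. (\<forall>w. \<omega> i x [v, w] = 0) \<longrightarrow> v = 0)"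

text \<open>\<open>symplectic_star \<beta> n k \<xi> = \<iota>\<^bsub>\<flat>\<^sup>-\<^sup>1(\<xi>)\<^esub> \<beta>\<^sup>n\<close> at a point, for \<open>\<xi>\<close> of degree \<open>k\<close>.\<close>

definition symplectic_star ::
    "('a::euclidean_space list \<Rightarrow> real) \<Rightarrow> nat \<Rightarrow> nat \<Rightarrow> ('a list \<Rightarrow> real) \<Rightarrow> 'a list \<Rightarrow> real" where
  "symplectic_star \<beta> n k \<xi> =
     contract k (the_inv_into {Z. alternating k Z} (flat \<beta>) \<xi>) (wedge_power \<beta> n)"

definition orbi_star ::
    "'i set \<Rightarrow> ('i \<Rightarrow> ('a::euclidean_space, 'g, 'x) chart) \<Rightarrow>
      ('i \<Rightarrow> 'a \<Rightarrow> 'a list \<Rightarrow> real) \<Rightarrow> nat \<Rightarrow> nat \<Rightarrow>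
      ('i \<Rightarrow> 'a \<Rightarrow> 'a list \<Rightarrow> real) \<Rightarrow> 'i \<Rightarrow> 'a \<Rightarrow> 'a list \<Rightarrow> real" where
  "orbi_star I c \<omega> n k \<xi> = on_charts I c (\<lambda>i x. symplectic_star (\<omega> i x) n k (\<xi> i x))"

text \<open>
  The outer star acts on \<open>d \<star> \<xi>\<close>, of degree \<open>2n - k + 1\<close>.  For \<open>k > 2n\<close>, where this is
  meaningless, \<open>\<xi> = 0\<close>, and the truncated subtraction gives the value \<open>0\<close>.
\<close>

definition orbi_delta ::
    "'i set \<Rightarrow> ('i \<Rightarrow> ('a::euclidean_space, 'g, 'x) chart) \<Rightarrow>
      ('i \<Rightarrow> 'a \<Rightarrow> 'a list \<Rightarrow> real) \<Rightarrow> nat \<Rightarrow> nat \<Rightarrow>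
      ('i \<Rightarrow> 'a \<Rightarrow> 'a list \<Rightarrow> real) \<Rightarrow> 'i \<Rightarrow> 'a \<Rightarrow> 'a list \<Rightarrow> real" where
  "orbi_delta I c \<omega> n k \<xi> = (\<lambda>i x vs.
     (-1) ^ k * orbi_star I c \<omega> n (2 * n - k + 1) (orbi_d I c (orbi_star I c \<omega> n k \<xi>)) i x vs)"

definition harmonic ::
    "'i set \<Rightarrow> ('i \<Rightarrow> ('a::euclidean_space, 'g, 'x) chart) \<Rightarrow>
      ('i \<Rightarrow> 'a \<Rightarrow> 'a list \<Rightarrow> real) \<Rightarrow> nat \<Rightarrow> nat \<Rightarrow>
      ('i \<Rightarrow> 'a \<Rightarrow> 'a list \<Rightarrow> real) \<Rightarrow> bool" where
  "harmonic I c \<omega> n k \<xi> \<longleftrightarrow>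
     \<xi> \<in> orbi_forms I c k \<and>
     orbi_d I c \<xi> = (\<lambda>_ _ _. 0) \<and> orbi_delta I c \<omega> n k \<xi> = (\<lambda>_ _ _. 0)"

text \<open>
  \<open>L : H\<^sup>m \<rightarrow> H\<^sup>m\<^sup>+\<^sup>2\<close>, \<open>L[\<xi>] = [\<omega> \<and> \<xi>]\<close>: the classes \<open>[\<omega> \<and> \<xi>]\<close> coincide for all representatives \<open>\<xi>\<close>,
  so their union is that class.
\<close>

definition lefschetz ::
    "'i set \<Rightarrow> ('i \<Rightarrow> ('a::euclidean_space, 'g, 'x) chart) \<Rightarrow>
      ('i \<Rightarrow> 'a \<Rightarrow> 'a list \<Rightarrow> real) \<Rightarrow> nat \<Rightarrow>
      ('i \<Rightarrow> 'a \<Rightarrow> 'a list \<Rightarrow> real) set \<Rightarrow> ('i \<Rightarrow> 'a \<Rightarrow> 'a list \<Rightarrow> real) set" where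
  "lefschetz I c \<omega> m a = (\<Union>\<xi>\<in>a. cohomology_class I c (m + 2) (orbi_wedge \<omega> \<xi>))"

primrec lefschetz_power ::
    "'i set \<Rightarrow> ('i \<Rightarrow> ('a::euclidean_space, 'g, 'x) chart) \<Rightarrow>
      ('i \<Rightarrow> 'a \<Rightarrow> 'a list \<Rightarrow> real) \<Rightarrow> nat \<Rightarrow> nat \<Rightarrow>
      ('i \<Rightarrow> 'a \<Rightarrow> 'a list \<Rightarrow> real) set \<Rightarrow> ('i \<Rightarrow> 'a \<Rightarrow> 'a list \<Rightarrow> real) set" where
  "lefschetz_power I c \<omega> m 0 a = a"
| "lefschetz_power I c \<omega> m (Suc k) a = lefschetz I c \<omega> (m + 2 * k) (lefschetz_power I c \<omega> m k a)"

end

theory Submission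
  imports Defs "HOL-Library.Function_Algebras"
begin

text \<open>
  Let \<open>L\<close> be the product with \<open>\<omega>\<close> and \<open>\<Lambda>\<close> the contraction with the Poisson bivector, the inverse of
  \<open>\<omega>\<close>.  On \<open>k\<close>-forms \<open>[\<Lambda>, L] = k - n\<close>, so the forms on the orbifold are a graded representation of
  sl(2) with finitely many weights.  The theorem becomes a statement about such representations,
  once harmonicity is expressed by \<open>\<Lambda>\<close> and \<open>d\<close>.

  Up to a nonzero constant that depends on the degree, the symplectic star of a \<open>k\<close>-form is
  \<open>\<Sum> L\<^sup>i \<Lambda>\<^sup>j / (i! j!)\<close>, summed over \<open>i - j = n - k\<close> (\<open>symplectic_star_eq_star_sum\<close>): both operators turn
  the product with the 1-form \<open>\<iota>\<^sub>Z\<omega>\<close> into contraction with \<open>Z\<close>, they agree on constants, and the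
  forms are generated by 1-forms.  In particular, \<open>\<star>\<close> is injective (\<open>star_sum_inj\<close>), so that the outer
  star in \<open>\<delta>\<close> can be dropped.  The operator \<open>[\<Lambda>, [\<Lambda>, d]]\<close> vanishes (\<open>serre_eq_zero\<close>), because it commutes
  with \<open>L\<close> and lowers the degree by three.  Since \<open>d\<close> commutes with \<open>L\<close>, it follows that
  \<open>d \<star> \<xi>\<close> is a nonzero multiple of \<open>\<star> [\<Lambda>, d] \<xi>\<close> for closed \<open>\<xi>\<close> (\<open>d_star_sum\<close>).  Hence a closed form \<open>\<xi>\<close> is
  harmonic iff \<open>d \<Lambda> \<xi> = 0\<close> (\<open>harmonic_iff\<close>), and the harmonic forms are stable under \<open>L\<close> and \<open>\<Lambda>\<close>
  (\<open>Harm_module\<close>).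

  In every graded representation of this kind, \<open>L\<^sup>j\<close> is bijective from degree \<open>n - j\<close> to degree \<open>n + j\<close>
  (\<open>L_pow_inj\<close>, \<open>L_pow_surj\<close>).  If all classes have harmonic representatives, apply this to the
  harmonic forms: a harmonic form of degree \<open>n + j\<close> is \<open>L\<^sup>j\<close> of a closed form.  Conversely, let \<open>x\<close> be
  closed of degree \<open>n - j\<close>.  By surjectivity on cohomology \<open>L\<^sup>j\<^sup>+\<^sup>1 x = L\<^sup>j\<^sup>+\<^sup>2 b + dz\<close> with \<open>b\<close> closed, and
  \<open>z = L\<^sup>j\<^sup>+\<^sup>1 w\<close> by the bijectivity on all forms.  The closed form \<open>x - L b - dw\<close> is killed by \<open>L\<^sup>j\<^sup>+\<^sup>1\<close>, hence
  by \<open>\<Lambda>\<close>, hence is harmonic, and the class of \<open>b\<close> has a harmonic representative by induction.  The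
  classes above the middle degree are images under \<open>L\<^sup>j\<close> of classes below it.

  To make this concrete, \<open>L\<close>, \<open>\<Lambda>\<close> and \<open>d\<close> must preserve the smooth forms on the orbifold.  The product
  and \<open>d\<close> are determined by how they interact with the insertion of one vector (\<open>wedge_Cons\<close>,
  \<open>ext_deriv_Cons\<close>), so that their identities are proved by induction on the list of arguments.
  Naturality of \<open>d\<close> and \<open>d\<^sup>2 = 0\<close> rest on the symmetry of second derivatives.  The
  Poisson bivector is smooth because its coefficients are quotients of coefficients of
  \<open>\<omega>\<^sup>n\<^sup>-\<^sup>1\<close> and \<open>\<omega>\<^sup>n\<close> (\<open>J_component\<close>).
\<close>

section \<open>Function spaces as vector spaces\<close>

text \<open>
  Forms on an orbifold are functions.  With the pointwise operations they become elements of a real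
  vector space, and the operators on them become linear maps.
\<close>

instantiation "fun" :: (type, real_vector) real_vector
begin

definition scaleR_fun :: "real \<Rightarrow> ('a \<Rightarrow> 'b) \<Rightarrow> 'a \<Rightarrow> 'b" where "scaleR_fun r f = (\<lambda>x. r *\<^sub>R f x)"

instance
  by standard (simp_all add: scaleR_fun_def fun_eq_iff scaleR_add_right scaleR_add_left)

end

section \<open>Graded representations of sl(2)\<close>

text \<open>
  With the value 0 at negative numbers, the recursion \<open>inv_fact_pred\<close> holds for all integers, and
  sums weighted by it need no boundary conditions.
\<close>

definition inv_fact :: "int \<Rightarrow> real" where
  "inv_fact m = (if m < 0 then 0 else 1 / fact (nat m))"

lemma inv_fact_pred: "real (nat m) * inv_fact m = inv_fact (m - 1)"
proof (cases "m \<le> 0")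
  case False
  then obtain i where "m = int (Suc i)" by (metis Suc_pred not_le zero_less_imp_eq_int)
  then have "nat m = Suc i" "nat (m - 1) = i" by simp_all
  then show ?thesis using False by (simp add: inv_fact_def del: of_nat_Suc)
qed (auto simp: inv_fact_def)

text \<open>
  The grading is by integers, with zero spaces outside \<open>{0..2n}\<close>, so that \<open>\<Lambda>\<close> can lower the degree
  without case distinctions.
\<close>

locale lefschetz_module =
  fixes A :: "int \<Rightarrow> 'v::real_vector set" and L \<Lambda> :: "'v \<Rightarrow> 'v" and n :: nat
  assumes subspace: "subspace (A k)"
    and bounded: "k < 0 \<or> 2 * int n < k \<Longrightarrow> A k = {0}"
    and linear_L: "linear L" and linear_\<Lambda>: "linear \<Lambda>"
    and L_mem: "x \<in> A k \<Longrightarrow> L x \<in> A (k + 2)"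
    and \<Lambda>_mem: "x \<in> A k \<Longrightarrow> \<Lambda> x \<in> A (k - 2)"
    and commutator: "x \<in> A k \<Longrightarrow> \<Lambda> (L x) = L (\<Lambda> x) + real_of_int (k - int n) *\<^sub>R x"
begin

lemmas L_simps = linear_add[OF linear_L] linear_diff[OF linear_L] linear_scale[OF linear_L] linear_0[OF linear_L]
lemmas \<Lambda>_simps = linear_add[OF linear_\<Lambda>] linear_diff[OF linear_\<Lambda>] linear_scale[OF linear_\<Lambda>] linear_0[OF linear_\<Lambda>]

lemma linear_L_pow: "linear (L ^^ j)"
proof (induction j)
  case 0
  show ?case by (simp add: linear_id[unfolded id_def] id_def)
next
  case (Suc j)
  then show ?case using linear_compose[OF Suc linear_L] by (simp add: o_def)
qed

lemma linear_\<Lambda>_pow: "linear (\<Lambda> ^^ j)"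
proof (induction j)
  case 0
  show ?case by (simp add: linear_id[unfolded id_def] id_def)
next
  case (Suc j)
  then show ?case using linear_compose[OF Suc linear_\<Lambda>] by (simp add: o_def)
qed

lemmas L_pow_simps = linear_add[OF linear_L_pow] linear_diff[OF linear_L_pow]
  linear_scale[OF linear_L_pow] linear_0[OF linear_L_pow]
lemmas \<Lambda>_pow_simps = linear_add[OF linear_\<Lambda>_pow] linear_diff[OF linear_\<Lambda>_pow]
  linear_scale[OF linear_\<Lambda>_pow] linear_0[OF linear_\<Lambda>_pow]

lemma L_pow_mem: "x \<in> A k \<Longrightarrow> (L ^^ j) x \<in> A (k + 2 * int j)"
proof (induction j)
  case (Suc j)
  then show ?case using L_mem[of "(L ^^ j) x" "k + 2 * int j"] by (simp add: algebra_simps)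
qed simp

lemma \<Lambda>_pow_mem: "x \<in> A k \<Longrightarrow> (\<Lambda> ^^ j) x \<in> A (k - 2 * int j)"
proof (induction j)
  case (Suc j)
  then show ?case using \<Lambda>_mem[of "(\<Lambda> ^^ j) x" "k - 2 * int j"] by (simp add: algebra_simps)
qed simp

lemma zero_mem: "0 \<in> A k"
  by (rule subspace_0[OF subspace])

lemma eq_zero: "x \<in> A k \<Longrightarrow> k < 0 \<or> 2 * int n < k \<Longrightarrow> x = 0"
  using bounded[of k] by auto

lemma \<Lambda>_L_pow:
  assumes "x \<in> A k"
  shows "\<Lambda> ((L ^^ Suc j) x) = (L ^^ Suc j) (\<Lambda> x) + (real (Suc j) * real_of_int (k - int n + int j)) *\<^sub>R (L ^^ j) x"
proof (induction j)
  case 0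
  show ?case using commutator[OF assms] by simp
next
  case (Suc j)
  have "\<Lambda> ((L ^^ Suc (Suc j)) x) = L (\<Lambda> ((L ^^ Suc j) x)) + real_of_int (k + 2 * int (Suc j) - int n) *\<^sub>R (L ^^ Suc j) x"
    using commutator[OF L_pow_mem[OF assms, of "Suc j"]] by simp
  also have "L (\<Lambda> ((L ^^ Suc j) x)) = (L ^^ Suc (Suc j)) (\<Lambda> x)
      + (real (Suc j) * real_of_int (k - int n + int j)) *\<^sub>R (L ^^ Suc j) x"
    unfolding Suc by (simp add: L_simps)
  finally show ?case
    unfolding add.assoc scaleR_add_left[symmetric]
    by (rule ssubst) (simp add: distrib_left distrib_right)
qed

lemma L_\<Lambda>_pow:
  assumes "x \<in> A k"
  shows "L ((\<Lambda> ^^ Suc j) x) = (\<Lambda> ^^ Suc j) (L x) - (real (Suc j) * real_of_int (k - int n - int j)) *\<^sub>R (\<Lambda> ^^ j) x"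
proof (induction j)
  case 0
  show ?case using commutator[OF assms] by simp
next
  case (Suc j)
  have "L ((\<Lambda> ^^ Suc (Suc j)) x) = \<Lambda> (L ((\<Lambda> ^^ Suc j) x)) - real_of_int (k - 2 * int (Suc j) - int n) *\<^sub>R (\<Lambda> ^^ Suc j) x"
    using commutator[OF \<Lambda>_pow_mem[OF assms, of "Suc j"]] by simp
  also have "\<Lambda> (L ((\<Lambda> ^^ Suc j) x)) = (\<Lambda> ^^ Suc (Suc j)) (L x)
      - (real (Suc j) * real_of_int (k - int n - int j)) *\<^sub>R (\<Lambda> ^^ Suc j) x"
    unfolding Suc by (simp add: \<Lambda>_simps)
  finally show ?case
    unfolding diff_diff_eq scaleR_add_left[symmetric]
    by (rule ssubst) (simp add: distrib_left distrib_right right_diff_distrib left_diff_distrib)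
qed

text \<open>
  On a vector killed by \<open>\<Lambda>\<close>, the operator \<open>\<Lambda> L\<^sup>i\<^sup>+\<^sup>1\<close> is the multiple \<open>(i + 1) (i - j)\<close> of \<open>L\<^sup>i\<close>, which is
  nonzero for \<open>i < j\<close>; so \<open>L\<close> cannot kill it before the power \<open>j + 1\<close>.
\<close>

lemma lowest_weight_inj:
  assumes x: "x \<in> A (int n - int j)" and "\<Lambda> x = 0" and "(L ^^ i) x = 0" and "i \<le> j"
  shows "x = 0"
  using assms(3,4)
proof (induction i)
  case (Suc i)
  have "\<Lambda> ((L ^^ Suc i) x) = (real (Suc i) * real_of_int (int i - int j)) *\<^sub>R (L ^^ i) x"
    using \<Lambda>_L_pow[OF x, of i] \<open>\<Lambda> x = 0\<close> by (simp add: L_simps L_pow_simps)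
  then have "(real (Suc i) * real_of_int (int i - int j)) *\<^sub>R (L ^^ i) x = 0"
    using Suc.prems by (simp add: \<Lambda>_simps)
  then have "(L ^^ i) x = 0" using Suc.prems by (auto simp del: of_nat_Suc)
  then show ?case using Suc by simp
qed simp

text \<open>
  If \<open>L\<^sup>j x = 0\<close>, then the commutator of \<open>\<Lambda>\<close> and \<open>L\<^sup>j\<^sup>+\<^sup>2\<close> shows \<open>L\<^sup>j\<^sup>+\<^sup>2 \<Lambda> x = 0\<close>.  By induction on the
  degree \<open>\<Lambda> x = 0\<close>, and the previous lemma applies.
\<close>

lemma L_pow_inj:
  assumes "x \<in> A (int n - int j)" and "(L ^^ j) x = 0"
  shows "x = 0"
  using assms
proof (induction "Suc n - j" arbitrary: j x rule: less_induct)
  case less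
  show ?case
  proof (cases "j \<le> n")
    case False
    then show ?thesis using eq_zero[OF less.prems(1)] by auto
  next
    case True
    have m: "\<Lambda> x \<in> A (int n - int (j + 2))"
      using \<Lambda>_mem[OF less.prems(1)] by (simp add: algebra_simps)
    have "\<Lambda> ((L ^^ Suc (Suc j)) x) = (L ^^ Suc (Suc j)) (\<Lambda> x)
        + (real (Suc (Suc j)) * real_of_int (int n - int j - int n + int (Suc j))) *\<^sub>R (L ^^ Suc j) x"
      by (rule \<Lambda>_L_pow[OF less.prems(1)])
    moreover have "(L ^^ Suc j) x = 0" "(L ^^ Suc (Suc j)) x = 0"
      using less.prems(2) by (simp_all add: L_simps)
    ultimately have "(L ^^ (j + 2)) (\<Lambda> x) = 0" by (simp add: \<Lambda>_simps)
    then have "\<Lambda> x = 0" using less.hyps[OF _ m] True by simp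
    then show ?thesis using lowest_weight_inj[OF less.prems(1)] less.prems(2) by blast
  qed
qed

text \<open>
  The vector \<open>[\<Lambda>, L\<^sup>j\<^sup>+\<^sup>2] x\<close> is a multiple of \<open>L\<^sup>j\<^sup>+\<^sup>1 x = 0\<close>.  Therefore \<open>L\<^sup>j\<^sup>+\<^sup>2 \<Lambda> x = 0\<close>, and \<open>L\<^sup>j\<^sup>+\<^sup>2\<close> is injective in
  the degree of \<open>\<Lambda> x\<close>.
\<close>

lemma primitive_imp_\<Lambda>_eq_zero:
  assumes x: "x \<in> A (int n - int j)" and "(L ^^ Suc j) x = 0"
  shows "\<Lambda> x = 0"
proof (rule L_pow_inj)
  show "\<Lambda> x \<in> A (int n - int (j + 2))"
    using \<Lambda>_mem[OF x] by (simp add: algebra_simps)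
  show "(L ^^ (j + 2)) (\<Lambda> x) = 0"
    using \<Lambda>_L_pow[OF x, of "Suc j"] assms(2) by (simp add: L_simps \<Lambda>_simps)
qed

lemma highest_weight_scalar:
  assumes x: "x \<in> A (int n + int j)" and "L x = 0" and "i \<le> j"
  shows "\<exists>r. r \<noteq> 0 \<and> (L ^^ i) ((\<Lambda> ^^ i) x) = r *\<^sub>R x"
  using assms(3)
proof (induction i)
  case 0
  show ?case by (intro exI[of _ 1]) simp
next
  case (Suc i)
  then obtain r where r: "r \<noteq> 0" "(L ^^ i) ((\<Lambda> ^^ i) x) = r *\<^sub>R x" by auto
  let ?s = "real (Suc i) * real_of_int (int j - int i)"
  have s: "L ((\<Lambda> ^^ Suc i) x) = - (?s *\<^sub>R (\<Lambda> ^^ i) x)"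
    using L_\<Lambda>_pow[OF x, of i] \<open>L x = 0\<close> by (simp add: \<Lambda>_simps \<Lambda>_pow_simps)
  have "(L ^^ Suc i) ((\<Lambda> ^^ Suc i) x) = (L ^^ i) (L ((\<Lambda> ^^ Suc i) x))"
    by (simp add: funpow_swap1)
  also have "\<dots> = (- ?s * r) *\<^sub>R x"
    unfolding s using r(2) linear_neg[OF linear_L_pow] by (simp add: L_pow_simps del: of_nat_Suc)
  finally show ?case
    using r Suc.prems by (intro exI[of _ "- ?s * r"]) (auto simp del: of_nat_Suc)
qed

text \<open>
  By induction from the top degree, \<open>L x = L\<^sup>j\<^sup>+\<^sup>2 u\<close>.  Subtracting \<open>L\<^sup>j\<^sup>+\<^sup>1 u\<close> leaves a vector killed by \<open>L\<close>,
  which is a multiple of \<open>L\<^sup>j\<close> applied to its image under \<open>\<Lambda>\<^sup>j\<close>.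
\<close>

lemma L_pow_surj:
  assumes "x \<in> A (int n + int j)"
  shows "\<exists>y \<in> A (int n - int j). (L ^^ j) y = x"
  using assms
proof (induction "Suc n - j" arbitrary: j x rule: less_induct)
  case less
  show ?case
  proof (cases "j \<le> n")
    case False
    then show ?thesis
      using eq_zero[OF less.prems(1)] zero_mem by (intro bexI[of _ 0]) (auto simp: L_pow_simps)
  next
    case True
    have "L x \<in> A (int n + int (j + 2))"
      using L_mem[OF less.prems] by (simp add: algebra_simps)
    then obtain u where u: "u \<in> A (int n - int (j + 2))" "(L ^^ (j + 2)) u = L x"
      using less.hyps[of "j + 2" "L x"] True by (metis diff_less_mono2 less_Suc_eq_le less_add_same_cancel1 pos2 le_imp_less_Suc)
    have Lu: "L u \<in> A (int n - int j)"
      using L_mem[OF u(1)] by (simp add: algebra_simps)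
    define v where "v = x - (L ^^ j) (L u)"
    have v: "v \<in> A (int n + int j)"
      unfolding v_def using L_pow_mem[OF Lu, of j] less.prems subspace_diff[OF subspace]
      by (simp add: algebra_simps)
    have "L v = 0" unfolding v_def using u(2) by (simp add: L_simps funpow_swap1)
    then obtain r where r: "r \<noteq> 0" "(L ^^ j) ((\<Lambda> ^^ j) v) = r *\<^sub>R v"
      using highest_weight_scalar[OF v] by blast
    have "(\<Lambda> ^^ j) v \<in> A (int n - int j)"
      using \<Lambda>_pow_mem[OF v, of j] by simp
    then have "L u + (1 / r) *\<^sub>R (\<Lambda> ^^ j) v \<in> A (int n - int j)"
      using Lu subspace by (simp add: subspace_add subspace_scale)
    moreover have "(L ^^ j) (L u + (1 / r) *\<^sub>R (\<Lambda> ^^ j) v) = x"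
      using r by (simp add: L_pow_simps v_def)
    ultimately show ?thesis by blast
  qed
qed

text \<open>
  The sum of \<open>L\<^sup>i \<Lambda>\<^sup>j / (i! j!)\<close> over \<open>i - j = N - k\<close>, to be applied in degree \<open>k\<close>.  For \<open>N = n\<close> this is the
  symplectic star up to a constant.  A second value of \<open>N\<close> is used in the proof that the star is
  injective.  For \<open>k < 2 K\<close> all nonzero summands are below the cutoff \<open>K\<close> (\<open>star_sum_cong\<close>).
\<close>

definition star_sum :: "nat \<Rightarrow> int \<Rightarrow> int \<Rightarrow> 'v \<Rightarrow> 'v" where
  "star_sum K N k x =
     (\<Sum>j<K. (inv_fact (N - k + int j) / fact j) *\<^sub>R (L ^^ nat (N - k + int j)) ((\<Lambda> ^^ j) x))"

lemma \<Lambda>_pow_eq_zero: "x \<in> A k \<Longrightarrow> k < 2 * int j \<Longrightarrow> (\<Lambda> ^^ j) x = 0"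
  using eq_zero[OF \<Lambda>_pow_mem] by simp

lemma linear_star_sum: "linear (star_sum K N k)"
  unfolding star_sum_def
  by (intro linear_compose_sum ballI linear_compose_scale_right
      linear_compose[OF linear_\<Lambda>_pow linear_L_pow, unfolded o_def])

lemma star_sum_cong:
  assumes "x \<in> A k" "k < 2 * int K" "K \<le> K'"
  shows "star_sum K' N k x = star_sum K N k x"
  unfolding star_sum_def
proof (rule sum.mono_neutral_right)
  show "\<forall>j \<in> {..<K'} - {..<K}. (inv_fact (N - k + int j) / fact j) *\<^sub>R (L ^^ nat (N - k + int j)) ((\<Lambda> ^^ j) x) = 0"
    using \<Lambda>_pow_eq_zero[OF assms(1)] assms(2) by (auto simp: L_pow_simps)
qed (use assms(3) in auto)

lemma star_summand_mem:
  assumes "x \<in> A k"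
  shows "(inv_fact (N - k + int j) / fact j) *\<^sub>R (L ^^ nat (N - k + int j)) ((\<Lambda> ^^ j) x) \<in> A (2 * N - k)"
proof -
  have "(L ^^ nat (N - k + int j)) ((\<Lambda> ^^ j) x) \<in> A (2 * N - k)" if "0 \<le> N - k + int j"
    using L_pow_mem[OF \<Lambda>_pow_mem[OF assms, of j], of "nat (N - k + int j)"] that by (simp add: algebra_simps)
  then show ?thesis
    using zero_mem subspace_scale[OF subspace] by (cases "0 \<le> N - k + int j") (auto simp: inv_fact_def)
qed

lemma star_sum_mem: "x \<in> A k \<Longrightarrow> star_sum K N k x \<in> A (2 * N - k)"
  unfolding star_sum_def by (intro subspace_sum subspace star_summand_mem)

end

section \<open>Harmonicity and the Lefschetz property, abstractly\<close>

locale lefschetz_complex = lefschetz_module A L \<Lambda> n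
  for A :: "int \<Rightarrow> 'v::real_vector set" and L \<Lambda> :: "'v \<Rightarrow> 'v" and n :: nat +
  fixes d :: "'v \<Rightarrow> 'v"
  assumes d_mem: "x \<in> A k \<Longrightarrow> d x \<in> A (k + 1)"
    and d_add: "x \<in> A k \<Longrightarrow> y \<in> A k \<Longrightarrow> d (x + y) = d x + d y"
    and d_scale: "x \<in> A k \<Longrightarrow> d (r *\<^sub>R x) = r *\<^sub>R d x"
    and d_d: "x \<in> A k \<Longrightarrow> d (d x) = 0"
    and d_L: "x \<in> A k \<Longrightarrow> d (L x) = L (d x)"
begin

lemma d_zero: "d 0 = 0"
  using d_scale[OF zero_mem, of 0] by simp

lemma d_diff: "x \<in> A k \<Longrightarrow> y \<in> A k \<Longrightarrow> d (x - y) = d x - d y"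
  using d_add[of x k "- 1 *\<^sub>R y"] d_scale[of y k "-1"] subspace_scale[OF subspace, of y k "-1"] by simp

lemma d_L_pow: "x \<in> A k \<Longrightarrow> d ((L ^^ j) x) = (L ^^ j) (d x)"
proof (induction j)
  case (Suc j)
  then show ?case using d_L[OF L_pow_mem[OF Suc.prems, of j]] by simp
qed simp

text \<open>The double commutator \<open>[\<Lambda>, [\<Lambda>, d]]\<close>; its vanishing is a Serre relation.\<close>

definition serre :: "'v \<Rightarrow> 'v" where
  "serre x = \<Lambda> (\<Lambda> (d x)) - 2 *\<^sub>R \<Lambda> (d (\<Lambda> x)) + d (\<Lambda> (\<Lambda> x))"

lemma serre_mem:
  assumes "x \<in> A k" shows "serre x \<in> A (k - 3)"
proof -
  have "\<Lambda> (\<Lambda> (d x)) \<in> A (k - 3)"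
    using \<Lambda>_mem[OF \<Lambda>_mem[OF d_mem[OF assms]]] by simp
  moreover have "\<Lambda> (d (\<Lambda> x)) \<in> A (k - 3)"
    using \<Lambda>_mem[OF d_mem[OF \<Lambda>_mem[OF assms]]] by simp
  moreover have "d (\<Lambda> (\<Lambda> x)) \<in> A (k - 3)"
    using d_mem[OF \<Lambda>_mem[OF \<Lambda>_mem[OF assms]]] by simp
  ultimately show ?thesis
    unfolding serre_def by (intro subspace_add subspace_diff subspace_scale subspace)
qed

lemma serre_add:
  assumes "x \<in> A k" "y \<in> A k" shows "serre (x + y) = serre x + serre y"
  unfolding serre_def using assms d_add[OF assms]
    d_add[OF \<Lambda>_mem[OF assms(1)] \<Lambda>_mem[OF assms(2)]]
    d_add[OF \<Lambda>_mem[OF \<Lambda>_mem[OF assms(1)]] \<Lambda>_mem[OF \<Lambda>_mem[OF assms(2)]]]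
  by (simp add: \<Lambda>_simps scaleR_add_right)

text \<open>
  Under the adjoint action, \<open>d\<close> is killed by \<open>L\<close> and has weight 1.  In the representation generated
  by such a highest weight vector, the third vector is again killed by \<open>L\<close>.
\<close>

lemma serre_L:
  assumes x: "x \<in> A k" shows "serre (L x) = L (serre x)"
proof -
  let ?h = "real_of_int (k - int n)"
  have 1: "\<Lambda> (\<Lambda> (d (L x))) = L (\<Lambda> (\<Lambda> (d x))) + (2 * ?h) *\<^sub>R \<Lambda> (d x)"
  proof -
    have "\<Lambda> (L (d x)) = L (\<Lambda> (d x)) + (?h + 1) *\<^sub>R d x"
      using commutator[OF d_mem[OF x]] by (simp add: algebra_simps)
    moreover have "\<Lambda> (L (\<Lambda> (d x))) = L (\<Lambda> (\<Lambda> (d x))) + (?h - 1) *\<^sub>R \<Lambda> (d x)"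
      using commutator[OF \<Lambda>_mem[OF d_mem[OF x]]] by (simp add: algebra_simps)
    ultimately have "\<Lambda> (\<Lambda> (d (L x))) = L (\<Lambda> (\<Lambda> (d x))) + ((?h - 1) *\<^sub>R \<Lambda> (d x) + (?h + 1) *\<^sub>R \<Lambda> (d x))"
      by (simp add: d_L[OF x] \<Lambda>_simps)
    then show ?thesis unfolding scaleR_add_left[symmetric] by simp
  qed
  have 2: "d (\<Lambda> (L x)) = L (d (\<Lambda> x)) + ?h *\<^sub>R d x"
    using commutator[OF x] d_add[OF L_mem[OF \<Lambda>_mem[OF x]], of "?h *\<^sub>R x"] x
      subspace_scale[OF subspace, of x k] d_L[OF \<Lambda>_mem[OF x]] d_scale[OF x]
    by simp
  have 3: "\<Lambda> (d (\<Lambda> (L x))) = L (\<Lambda> (d (\<Lambda> x))) + (?h - 1) *\<^sub>R d (\<Lambda> x) + ?h *\<^sub>R \<Lambda> (d x)"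
  proof -
    have "\<Lambda> (L (d (\<Lambda> x))) = L (\<Lambda> (d (\<Lambda> x))) + (?h - 1) *\<^sub>R d (\<Lambda> x)"
      using commutator[OF d_mem[OF \<Lambda>_mem[OF x]]] by (simp add: algebra_simps)
    then show ?thesis unfolding 2 by (simp add: \<Lambda>_simps)
  qed
  have "\<Lambda> (\<Lambda> (L x)) = L (\<Lambda> (\<Lambda> x)) + (2 * ?h - 2) *\<^sub>R \<Lambda> x"
  proof -
    have "\<Lambda> (L (\<Lambda> x)) = L (\<Lambda> (\<Lambda> x)) + (?h - 2) *\<^sub>R \<Lambda> x"
      using commutator[OF \<Lambda>_mem[OF x]] by (simp add: algebra_simps)
    then have "\<Lambda> (\<Lambda> (L x)) = L (\<Lambda> (\<Lambda> x)) + ((?h - 2) *\<^sub>R \<Lambda> x + ?h *\<^sub>R \<Lambda> x)"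
      using commutator[OF x] by (simp add: \<Lambda>_simps)
    then show ?thesis unfolding scaleR_add_left[symmetric] by simp
  qed
  moreover have "L (\<Lambda> (\<Lambda> x)) \<in> A (k - 2)"
    using L_mem[OF \<Lambda>_mem[OF \<Lambda>_mem[OF x]]] by simp
  ultimately have 4: "d (\<Lambda> (\<Lambda> (L x))) = L (d (\<Lambda> (\<Lambda> x))) + (2 * ?h - 2) *\<^sub>R d (\<Lambda> x)"
    using d_add[of "L (\<Lambda> (\<Lambda> x))" "k - 2" "(2 * ?h - 2) *\<^sub>R \<Lambda> x"] \<Lambda>_mem[OF x]
      subspace_scale[OF subspace] d_L[OF \<Lambda>_mem[OF \<Lambda>_mem[OF x]]] d_scale[OF \<Lambda>_mem[OF x]]
    by metis
  show ?thesis
    unfolding serre_def 1 3 4 L_simps by (simp add: scaleR_add_right scaleR_diff_right scaleR_add_left scaleR_diff_left)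
qed

text \<open>
  Modulo the image of \<open>L\<close>, every vector of degree \<open>n - j\<close> is killed by \<open>L\<^sup>j\<^sup>+\<^sup>1\<close>.  The image of such a vector
  under an operator of degree \<open>-3\<close> that commutes with \<open>L\<close> lies in degree \<open>n - (j + 3)\<close>, where \<open>L\<^sup>j\<^sup>+\<^sup>3\<close>
  is injective.
\<close>

lemma serre_eq_zero_low:
  "x \<in> A (int n - int j) \<Longrightarrow> serre x = 0"
proof (induction "Suc n - j" arbitrary: j x rule: less_induct)
  case less
  note x = less.prems
  show ?case
  proof (cases "j \<le> n")
    case False
    then have "x = 0" using eq_zero[OF x] by auto
    then show ?thesis by (simp add: serre_def \<Lambda>_simps d_zero)
  next
    case True
    have "(L ^^ Suc j) x \<in> A (int n + int (j + 2))"
      using L_pow_mem[OF x, of "Suc j"] by (simp add: algebra_simps)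
    then obtain u where u: "u \<in> A (int n - int (j + 2))" "(L ^^ (j + 2)) u = (L ^^ Suc j) x"
      using L_pow_surj[of "(L ^^ Suc j) x" "j + 2"] by blast
    have Lu: "L u \<in> A (int n - int j)"
      using L_mem[OF u(1)] by (simp add: algebra_simps)
    define p where "p = x - L u"
    have p: "p \<in> A (int n - int j)"
      unfolding p_def using x Lu subspace_diff[OF subspace] by blast
    have Lp: "(L ^^ Suc j) p = 0"
      unfolding p_def using u(2) by (simp add: L_pow_simps L_simps funpow_swap1)
    have "serre p = 0"
    proof (rule L_pow_inj)
      show "serre p \<in> A (int n - int (j + 3))"
        using serre_mem[OF p] by (simp add: algebra_simps)
      have pw: "serre ((L ^^ i) p) = (L ^^ i) (serre p)" for i
      proof (induction i)
        case (Suc i)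
        then show ?case using serre_L[OF L_pow_mem[OF p, of i]] by simp
      qed simp
      have "(L ^^ (j + 3)) p = (L ^^ 2) ((L ^^ Suc j) p)"
        by (simp add: eval_nat_numeral)
      then have "(L ^^ (j + 3)) p = 0" unfolding Lp by (simp add: L_pow_simps)
      then show "(L ^^ (j + 3)) (serre p) = 0"
        using pw[of "j + 3"] by (simp add: serre_def \<Lambda>_simps d_zero)
    qed
    moreover have "serre u = 0" using less.hyps[OF _ u(1)] True by simp
    then have "serre (L u) = 0" using serre_L[OF u(1)] by (simp add: L_simps)
    moreover have "serre x = serre p + serre (L u)"
      using serre_add[OF p Lu] by (simp add: p_def)
    ultimately show ?thesis by simp
  qed
qed

lemma serre_eq_zero:
  assumes "x \<in> A k" shows "serre x = 0"
proof (cases "k \<le> int n")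
  case True
  then have k: "int n - int (nat (int n - k)) = k" by simp
  show ?thesis using serre_eq_zero_low[of x "nat (int n - k)"] assms unfolding k by blast
next
  case False
  then obtain j where j: "k = int n + int j" using zle_iff_zadd[of "int n" k] by auto
  then obtain y where y: "y \<in> A (int n - int j)" "(L ^^ j) y = x" using L_pow_surj assms by blast
  have "serre ((L ^^ i) y) = (L ^^ i) (serre y)" for i
  proof (induction i)
    case (Suc i)
    then show ?case using serre_L[OF L_pow_mem[OF y(1), of i]] by simp
  qed simp
  then show ?thesis using serre_eq_zero_low[OF y(1)] y(2) by (metis L_pow_simps(4))
qed

text \<open>
  The commutator \<open>[\<Lambda>, d]\<close>.  On closed forms, it differs from \<open>\<delta>\<close> by a nonzero constant that depends on
  the degree.
\<close>

definition codiff :: "'v \<Rightarrow> 'v" where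
  "codiff x = \<Lambda> (d x) - d (\<Lambda> x)"

lemma codiff_mem:
  assumes "x \<in> A k" shows "codiff x \<in> A (k - 1)"
proof -
  have "\<Lambda> (d x) \<in> A (k - 1)" using \<Lambda>_mem[OF d_mem[OF assms]] by simp
  moreover have "d (\<Lambda> x) \<in> A (k - 1)" using d_mem[OF \<Lambda>_mem[OF assms]] by simp
  ultimately show ?thesis unfolding codiff_def by (intro subspace_diff subspace)
qed

lemma codiff_\<Lambda>: 
  assumes "x \<in> A k" shows "codiff (\<Lambda> x) = \<Lambda> (codiff x)"
  using serre_eq_zero[OF assms] unfolding serre_def codiff_def
  by (simp add: \<Lambda>_simps scaleR_2 algebra_simps)

lemma d_\<Lambda>_pow:
  assumes x: "x \<in> A k"
  shows "d ((\<Lambda> ^^ Suc j) x) = (\<Lambda> ^^ Suc j) (d x) - real (Suc j) *\<^sub>R (\<Lambda> ^^ j) (codiff x)"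
proof (induction j)
  case 0
  show ?case by (simp add: codiff_def)
next
  case (Suc j)
  have cp: "codiff ((\<Lambda> ^^ i) x) = (\<Lambda> ^^ i) (codiff x)" for i
  proof (induction i)
    case (Suc i)
    then show ?case using codiff_\<Lambda>[OF \<Lambda>_pow_mem[OF x, of i]] by simp
  qed simp
  have "d ((\<Lambda> ^^ Suc (Suc j)) x) = \<Lambda> (d ((\<Lambda> ^^ Suc j) x)) - codiff ((\<Lambda> ^^ Suc j) x)"
    by (simp add: codiff_def)
  also have "\<dots> = (\<Lambda> ^^ Suc (Suc j)) (d x) - real (Suc (Suc j)) *\<^sub>R (\<Lambda> ^^ Suc j) (codiff x)"
    unfolding Suc cp[of "Suc j"] \<Lambda>_simps by (simp add: scaleR_add_left diff_diff_eq scaleR_2)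
  finally show ?case .
qed

lemma d_sum:
  assumes "\<And>i. i \<in> S \<Longrightarrow> f i \<in> A k"
  shows "d (sum f S) = (\<Sum>i\<in>S. d (f i))"
  using assms
proof (induction S rule: infinite_finite_induct)
  case (insert i S)
  then show ?case using d_add[of "f i" k "sum f S"] subspace_sum[OF subspace, of S f k] by simp
qed (simp_all add: d_zero)

text \<open>
  Moving \<open>d\<close> past \<open>\<Lambda>\<^sup>j\<close> costs \<open>j \<Lambda>\<^sup>j\<^sup>-\<^sup>1 [\<Lambda>, d]\<close>, and \<open>j\<close> cancels against \<open>j!\<close>; what remains is the same sum
  for the degree \<open>k - 1\<close>.
\<close>

lemma d_star_sum:
  assumes x: "x \<in> A k" and "d x = 0"
  shows "d (star_sum (Suc K) N k x) = - star_sum K N (k - 1) (codiff x)"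
proof -
  let ?m = "\<lambda>j. N - k + int j"
  let ?c = "\<lambda>j. inv_fact (?m j) / fact j"
  let ?t = "\<lambda>j. ?c j *\<^sub>R (L ^^ nat (?m j)) ((\<Lambda> ^^ j) x)"
  have mem: "?t j \<in> A (2 * N - k)" for j
    by (rule star_summand_mem[OF x])
  have dt: "d (?t j) = ?c j *\<^sub>R (L ^^ nat (?m j)) (d ((\<Lambda> ^^ j) x))" for j
    using d_scale[OF L_pow_mem[OF \<Lambda>_pow_mem[OF x, of j], of "nat (?m j)"]] d_L_pow[OF \<Lambda>_pow_mem[OF x, of j]]
    by simp
  have "d (star_sum (Suc K) N k x) = (\<Sum>j<Suc K. ?c j *\<^sub>R (L ^^ nat (?m j)) (d ((\<Lambda> ^^ j) x)))"
    unfolding star_sum_def using d_sum[of "{..<Suc K}" ?t "2 * N - k"] mem by (simp only: dt)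
  also have "\<dots> = (\<Sum>j<K. ?c (Suc j) *\<^sub>R (L ^^ nat (?m (Suc j))) (d ((\<Lambda> ^^ Suc j) x)))"
    by (subst sum.lessThan_Suc_shift) (simp add: \<open>d x = 0\<close> L_pow_simps)
  also have "\<dots> = (\<Sum>j<K. - ((inv_fact (N - (k - 1) + int j) / fact j) *\<^sub>R
      (L ^^ nat (N - (k - 1) + int j)) ((\<Lambda> ^^ j) (codiff x))))"
  proof (rule sum.cong[OF refl])
    fix j
    have m: "?m (Suc j) = N - (k - 1) + int j" by simp
    have "d ((\<Lambda> ^^ Suc j) x) = - real (Suc j) *\<^sub>R (\<Lambda> ^^ j) (codiff x)"
      using d_\<Lambda>_pow[OF x, of j] linear_0[OF linear_\<Lambda>_pow, of "Suc j"] \<open>d x = 0\<close>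
      by (simp del: of_nat_Suc funpow.simps)
    then have "?c (Suc j) *\<^sub>R (L ^^ nat (?m (Suc j))) (d ((\<Lambda> ^^ Suc j) x)) =
        (?c (Suc j) * - real (Suc j)) *\<^sub>R (L ^^ nat (?m (Suc j))) ((\<Lambda> ^^ j) (codiff x))"
      by (simp only: linear_scale[OF linear_L_pow] scaleR_scaleR)
    also have "?c (Suc j) * - real (Suc j) = - (inv_fact (?m (Suc j)) / fact j)"
      by (simp add: field_simps del: of_nat_Suc)
    finally show "?c (Suc j) *\<^sub>R (L ^^ nat (?m (Suc j))) (d ((\<Lambda> ^^ Suc j) x)) =
        - ((inv_fact (N - (k - 1) + int j) / fact j) *\<^sub>R (L ^^ nat (N - (k - 1) + int j)) ((\<Lambda> ^^ j) (codiff x)))"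
      unfolding m by simp
  qed
  also have "\<dots> = - star_sum K N (k - 1) (codiff x)"
    by (simp add: star_sum_def sum_negf)
  finally show ?thesis .
qed

definition Harm :: "int \<Rightarrow> 'v set" where
  "Harm k = {x \<in> A k. d x = 0 \<and> d (\<Lambda> x) = 0}"

lemma Harm_module: "lefschetz_module Harm L \<Lambda> n"
proof (rule lefschetz_module.intro)
  show "subspace (Harm k)" for k
    unfolding subspace_def
  proof (intro conjI ballI allI)
    show "0 \<in> Harm k" by (simp add: Harm_def zero_mem d_zero \<Lambda>_simps)
    fix x y assume "x \<in> Harm k" "y \<in> Harm k"
    then show "x + y \<in> Harm k"
      using d_add[of x k y] d_add[OF \<Lambda>_mem \<Lambda>_mem, of x k y] subspace_add[OF subspace, of x k y]
      by (auto simp: Harm_def \<Lambda>_simps)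
  next
    fix r x assume "x \<in> Harm k"
    then show "r *\<^sub>R x \<in> Harm k"
      using d_scale[of x k r] d_scale[OF \<Lambda>_mem, of x k r] subspace_scale[OF subspace, of x k r]
      by (auto simp: Harm_def \<Lambda>_simps)
  qed
  show "k < 0 \<or> 2 * int n < k \<Longrightarrow> Harm k = {0}" for k
    using bounded[of k] by (simp add: Harm_def set_eq_iff) (metis d_zero \<Lambda>_simps(4))
  show "linear L" "linear \<Lambda>" by (rule linear_L linear_\<Lambda>)+
  fix x k assume "x \<in> Harm k"
  then have x: "x \<in> A k" "d x = 0" "d (\<Lambda> x) = 0" by (auto simp: Harm_def)
  then show "\<Lambda> (L x) = L (\<Lambda> x) + real_of_int (k - int n) *\<^sub>R x" using commutator by blast
  have "d (\<Lambda> (L x)) = 0"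
    using commutator[OF x(1)] d_add[OF L_mem[OF \<Lambda>_mem[OF x(1)]]] x
      subspace_scale[OF subspace x(1)] d_L[OF \<Lambda>_mem[OF x(1)]] d_scale[OF x(1)]
    by (simp add: L_simps)
  then show "L x \<in> Harm (k + 2)"
    using L_mem[OF x(1)] x d_L[OF x(1)] by (simp add: Harm_def L_simps)
  have "d (\<Lambda> (\<Lambda> x)) = 0"
    using serre_eq_zero[OF x(1)] x by (simp add: serre_def \<Lambda>_simps)
  then show "\<Lambda> x \<in> Harm (k - 2)"
    using \<Lambda>_mem[OF x(1)] x by (simp add: Harm_def)
qed

text \<open>
  Surjectivity of \<open>L\<^sup>j\<close> on cohomology, for every \<open>j\<close>; for \<open>j > n\<close> both sides vanish.
\<close>

definition Lefschetz_property :: bool where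
  "Lefschetz_property \<longleftrightarrow> (\<forall>j. \<forall>x \<in> A (int n + int j). d x = 0 \<longrightarrow>
     (\<exists>y \<in> A (int n - int j). d y = 0 \<and> (\<exists>z \<in> A (int n + int j - 1). x = (L ^^ j) y + d z)))"

text \<open>
  Below the middle degree, a class is the sum of \<open>L\<close> applied to a class and a class represented by
  a closed primitive form.  The second is harmonic because \<open>\<Lambda>\<close> kills primitive forms, and the
  first is harmonic by induction.
\<close>

lemma harmonic_low:
  assumes LP: Lefschetz_property
  shows "x \<in> A (int n - int j) \<Longrightarrow> d x = 0 \<Longrightarrow> \<exists>z \<in> A (int n - int j - 1). x + d z \<in> Harm (int n - int j)"
proof (induction "Suc n - j" arbitrary: j x rule: less_induct)
  case less
  note x = less.prems
  show ?case
  proof (cases "j \<le> n")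
    case False
    then have "x = 0" using eq_zero[OF x(1)] by auto
    then show ?thesis
      using zero_mem by (intro bexI[of _ 0]) (auto simp: Harm_def d_zero \<Lambda>_simps)
  next
    case True
    have Lx: "(L ^^ Suc j) x \<in> A (int n + int (j + 2))"
      using L_pow_mem[OF x(1), of "Suc j"] by (simp add: algebra_simps)
    have "d ((L ^^ Suc j) x) = 0"
      using d_L_pow[OF x(1), of "Suc j"] x(2) by (simp add: L_simps L_pow_simps)
    then obtain b z where b: "b \<in> A (int n - int (j + 2))" "d b = 0"
        and z: "z \<in> A (int n + int (j + 2) - 1)" "(L ^^ Suc j) x = (L ^^ (j + 2)) b + d z"
      using LP Lx unfolding Lefschetz_property_def by blast
    \<comment> \<open>The form \<open>z\<close> can itself be divided by \<open>L\<^sup>j\<^sup>+\<^sup>1\<close>, so that the exact term is removed by changing \<open>x\<close>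
      within its class.\<close>
    have "z \<in> A (int n + int (Suc j))" using z(1) by (simp add: algebra_simps)
    then obtain w where w: "w \<in> A (int n - int (Suc j))" "(L ^^ Suc j) w = z"
      using L_pow_surj by blast
    have w': "w \<in> A (int n - int j - 1)" using w(1) by (simp add: algebra_simps)
    then have dw: "d w \<in> A (int n - int j)" using d_mem[OF w'] by simp
    have Lb: "L b \<in> A (int n - int j)" using L_mem[OF b(1)] by (simp add: algebra_simps)
    define p where "p = x - L b - d w"
    have p: "p \<in> A (int n - int j)"
      unfolding p_def using x(1) Lb dw by (intro subspace_diff subspace)
    have "(L ^^ Suc j) p = 0"
    proof -
      have "(L ^^ Suc j) (L b) = (L ^^ (j + 2)) b" by (simp add: funpow_swap1)
      moreover have "(L ^^ Suc j) (d w) = d z" using d_L_pow[OF w'] w(2) by metis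
      ultimately show ?thesis
        unfolding p_def linear_diff[OF linear_L_pow] using z(2) by simp
    qed
    then have "\<Lambda> p = 0" using primitive_imp_\<Lambda>_eq_zero[OF p] by blast
    moreover have "d p = 0"
      unfolding p_def using d_diff[OF subspace_diff[OF subspace x(1) Lb] dw] d_diff[OF x(1) Lb]
        d_d[OF w'] d_L[OF b(1)] b(2) x(2) by (simp add: L_simps)
    ultimately have pH: "p \<in> Harm (int n - int j)" using p by (simp add: Harm_def d_zero)
    obtain t where t: "t \<in> A (int n - int (j + 2) - 1)" "b + d t \<in> Harm (int n - int (j + 2))"
      using less.hyps[OF _ b] True by (metis diff_less_mono2 less_Suc_eq_le less_add_same_cancel1 pos2 le_imp_less_Suc)
    have "L (b + d t) \<in> Harm (int n - int (j + 2) + 2)"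
      using lefschetz_module.L_mem[OF Harm_module t(2)] .
    then have "p + L (b + d t) \<in> Harm (int n - int j)"
      using subspace_add[OF lefschetz_module.subspace[OF Harm_module] pH] by simp
    moreover have Lt: "L t \<in> A (int n - int j - 1)"
      using L_mem[OF t(1)] by (simp add: algebra_simps)
    have "p + L (b + d t) = x + d (L t - w)"
      unfolding p_def d_diff[OF Lt w'] d_L[OF t(1)] by (simp add: L_simps)
    ultimately show ?thesis
      using subspace_diff[OF subspace Lt w'] by auto
  qed
qed

theorem harmonic_representatives_iff_Lefschetz_property:
  "(\<forall>k. \<forall>x \<in> A k. d x = 0 \<longrightarrow> (\<exists>z \<in> A (k - 1). x + d z \<in> Harm k)) \<longleftrightarrow> Lefschetz_property"
proof
  assume LP: Lefschetz_property
  show "\<forall>k. \<forall>x \<in> A k. d x = 0 \<longrightarrow> (\<exists>z \<in> A (k - 1). x + d z \<in> Harm k)"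
  proof (intro allI ballI impI)
    fix k x assume x: "x \<in> A k" "d x = 0"
    show "\<exists>z \<in> A (k - 1). x + d z \<in> Harm k"
    proof (cases "k \<le> int n")
      case True
      then have k: "int n - int (nat (int n - k)) = k" by simp
      show ?thesis using harmonic_low[OF LP, of x "nat (int n - k)"] x unfolding k by blast
    next
      case False
      then obtain j where j: "k = int n + int j" using zle_iff_zadd[of "int n" k] by auto
      then obtain y z where y: "y \<in> A (int n - int j)" "d y = 0"
          and z: "z \<in> A (k - 1)" "x = (L ^^ j) y + d z"
        using LP x unfolding Lefschetz_property_def by blast
      obtain t where t: "t \<in> A (int n - int j - 1)" "y + d t \<in> Harm (int n - int j)"
        using harmonic_low[OF LP y] by blast
      have H: "(L ^^ j) (y + d t) \<in> Harm k"
        using lefschetz_module.L_pow_mem[OF Harm_module t(2), of j] by (simp add: j add.commute)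
      have Lt: "(L ^^ j) t \<in> A (k - 1)"
        using L_pow_mem[OF t(1), of j] by (simp add: j algebra_simps)
      have "(L ^^ j) (y + d t) = x + d ((L ^^ j) t - z)"
        using d_diff[OF Lt z(1)] d_L_pow[OF t(1), of j] z(2) by (simp add: L_pow_simps)
      then show ?thesis using H subspace_diff[OF subspace Lt z(1)] by auto
    qed
  qed
next
  assume harm: "\<forall>k. \<forall>x \<in> A k. d x = 0 \<longrightarrow> (\<exists>z \<in> A (k - 1). x + d z \<in> Harm k)"
  show Lefschetz_property
    unfolding Lefschetz_property_def
  proof (intro allI ballI impI)
    fix j x assume x: "x \<in> A (int n + int j)" "d x = 0"
    then obtain z where z: "z \<in> A (int n + int j - 1)" "x + d z \<in> Harm (int n + int j)"
      using harm by blast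
    obtain y where y: "y \<in> Harm (int n - int j)" "(L ^^ j) y = x + d z"
      using lefschetz_module.L_pow_surj[OF Harm_module z(2)] by blast
    have "x = (L ^^ j) y + d (0 - z)"
      using y(2) d_diff[OF zero_mem z(1)] by (simp add: d_zero)
    moreover have "0 - z \<in> A (int n + int j - 1)"
      by (rule subspace_diff[OF subspace zero_mem z(1)])
    ultimately show "\<exists>y \<in> A (int n - int j). d y = 0 \<and> (\<exists>z \<in> A (int n + int j - 1). x = (L ^^ j) y + d z)"
      using y(1) unfolding Harm_def by blast
  qed
qed

end

section \<open>Alternating functions and the wedge product\<close>

lemma scaleR_fun_apply [simp]: "(r *\<^sub>R f) x = r *\<^sub>R f x"
  by (simp add: scaleR_fun_def)

lemma sum_apply [simp]: "(sum f S) x = (\<Sum>i\<in>S. f i x)"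
  by (induction S rule: infinite_finite_induct) auto

lemma linear_apply: "linear (\<lambda>f. f x)"
  by (intro linearI) auto

lemma linear_fun:
  assumes "\<And>x. linear (\<lambda>v. f v x)"
  shows "linear f"
proof (intro linearI ext)
  show "f (u + v) x = (f u + f v) x" for u v x
    using linear_add[OF assms[of x], of u v] by simp
  show "f (r *\<^sub>R v) x = (r *\<^sub>R f v) x" for r v x
    using linear_scale[OF assms[of x], of r v] by simp
qed

text \<open>The interior product \<open>\<iota>\<^sub>v \<eta>\<close>.\<close>

definition iprod :: "'v \<Rightarrow> ('v list \<Rightarrow> real) \<Rightarrow> 'v list \<Rightarrow> real" where
  "iprod v \<eta> vs = \<eta> (v # vs)"

text \<open>
  The parity involution.  It takes care of the signs in \<open>\<iota>\<^sub>v(\<alpha> \<and> \<beta>) = \<iota>\<^sub>v\<alpha> \<and> \<beta> \<plusminus> \<alpha> \<and> \<iota>\<^sub>v\<beta>\<close> without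
  a homogeneity assumption on \<open>\<alpha>\<close>.
\<close>

definition twist :: "('v list \<Rightarrow> real) \<Rightarrow> 'v list \<Rightarrow> real" where
  "twist \<alpha> vs = (-1) ^ length vs * \<alpha> vs"

lemma wedge_Nil [simp]: "wedge \<alpha> \<beta> [] = \<alpha> [] * \<beta> []"
  by (simp add: wedge_def shuffle_sign_def)

text \<open>
  The first argument goes either to \<open>\<alpha>\<close> or to \<open>\<beta>\<close>; in the second case it has to pass all arguments of
  \<open>\<alpha>\<close>.  Together with \<open>wedge_Nil\<close> this determines the product, and the identities below follow by
  induction on the list of arguments.
\<close>

lemma wedge_Cons:
  "wedge \<alpha> \<beta> (v # vs) = wedge (iprod v \<alpha>) \<beta> vs + wedge (twist \<alpha>) (iprod v \<beta>) vs"
proof -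
  let ?m = "length vs"
  let ?P = "Pow {..<?m}"
  let ?f = "\<lambda>S. shuffle_sign (Suc ?m) S * \<alpha> (nths (v # vs) S) * \<beta> (nths (v # vs) (- S))"
  have "Pow {..<Suc ?m} = (image Suc) ` ?P \<union> (\<lambda>T. insert 0 (Suc ` T)) ` ?P"
    unfolding lessThan_Suc_eq_insert_0 Pow_insert image_Pow_surj[OF refl, symmetric] by (simp add: image_image)
  then have "wedge \<alpha> \<beta> (v # vs) = sum ?f ((image Suc) ` ?P \<union> (\<lambda>T. insert 0 (Suc ` T)) ` ?P)"
    by (simp add: wedge_def)
  also have "\<dots> = sum ?f ((image Suc) ` ?P) + sum ?f ((\<lambda>T. insert 0 (Suc ` T)) ` ?P)"
    by (rule sum.union_disjoint) auto
  also have "sum ?f ((image Suc) ` ?P) = (\<Sum>T\<in>?P. ?f (Suc ` T))"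
    by (subst sum.reindex) (auto simp: inj_on_def inj_image_eq_iff)
  also have "\<dots> = wedge (twist \<alpha>) (iprod v \<beta>) vs"
    unfolding wedge_def
  proof (rule sum.cong[OF refl])
    fix T assume T: "T \<in> ?P"
    then have fin: "finite T" by (auto intro: finite_subset)
    have len: "length (nths vs T) = card T"
      using T by (auto simp: length_nths intro!: arg_cong[where f = card])
    let ?I = "{(i, j). i < ?m \<and> j < i \<and> i \<in> T \<and> j \<notin> T}"
    have "{(i, j). i < Suc ?m \<and> j < i \<and> i \<in> Suc ` T \<and> j \<notin> Suc ` T} =
        (\<lambda>i. (Suc i, 0)) ` T \<union> map_prod Suc Suc ` ?I" (is "?I' = _")
    proof (rule equalityI; rule subsetI)
      fix p assume "p \<in> ?I'"
      then show "p \<in> (\<lambda>i. (Suc i, 0)) ` T \<union> map_prod Suc Suc ` ?I"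
        by (cases p; cases "snd p") (auto simp: image_iff)
    qed (use T in auto)
    moreover have "finite ?I" by (rule finite_subset[of _ "{..<?m} \<times> {..<?m}"]) auto
    ultimately have "card ?I' = card T + card ?I"
      using fin by (simp, subst card_Un_disjoint) (auto simp: card_image inj_on_def)
    then have "shuffle_sign (Suc ?m) (Suc ` T) = (-1) ^ card T * shuffle_sign ?m T"
      by (simp add: shuffle_sign_def power_add)
    moreover have "nths (v # vs) (Suc ` T) = nths vs T" "nths (v # vs) (- Suc ` T) = v # nths vs (- T)"
      by (auto simp: nths_Cons intro!: arg_cong[where f = "nths vs"])
    ultimately show "?f (Suc ` T) = shuffle_sign ?m T * twist \<alpha> (nths vs T) * iprod v \<beta> (nths vs (- T))"
      by (simp add: twist_def iprod_def len)
  qed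
  also have "sum ?f ((\<lambda>T. insert 0 (Suc ` T)) ` ?P) = (\<Sum>T\<in>?P. ?f (insert 0 (Suc ` T)))"
  proof (subst sum.reindex)
    have "T = T'" if "insert 0 (Suc ` T) = insert 0 (Suc ` T')" for T T'
    proof -
      have "Suc ` T = Suc ` T'" using that by (metis Diff_insert_absorb image_iff nat.distinct(1))
      then show ?thesis by (simp add: inj_image_eq_iff)
    qed
    then show "inj_on (\<lambda>T. insert 0 (Suc ` T)) ?P" unfolding inj_on_def by blast
  qed simp
  also have "\<dots> = wedge (iprod v \<alpha>) \<beta> vs"
    unfolding wedge_def
  proof (rule sum.cong[OF refl])
    fix T assume T: "T \<in> ?P"
    let ?I = "{(i, j). i < ?m \<and> j < i \<and> i \<in> T \<and> j \<notin> T}"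
    have "{(i, j). i < Suc ?m \<and> j < i \<and> i \<in> insert 0 (Suc ` T) \<and> j \<notin> insert 0 (Suc ` T)} =
        map_prod Suc Suc ` ?I" (is "?I' = _")
    proof (rule equalityI; rule subsetI)
      fix p assume "p \<in> ?I'"
      then show "p \<in> map_prod Suc Suc ` ?I"
        by (cases p; cases "snd p") (auto simp: image_iff)
    qed (use T in auto)
    then have "shuffle_sign (Suc ?m) (insert 0 (Suc ` T)) = shuffle_sign ?m T"
      by (simp add: shuffle_sign_def card_image inj_on_def)
    moreover have "nths (v # vs) (insert 0 (Suc ` T)) = v # nths vs T"
        "nths (v # vs) (- insert 0 (Suc ` T)) = nths vs (- T)"
      by (auto simp: nths_Cons intro!: arg_cong[where f = "nths vs"])
    ultimately show "?f (insert 0 (Suc ` T)) = shuffle_sign ?m T * iprod v \<alpha> (nths vs T) * \<beta> (nths vs (- T))"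
      by (simp add: iprod_def)
  qed
  finally show ?thesis by simp
qed

lemma iprod_wedge:
  "iprod v (wedge \<alpha> \<beta>) = wedge (iprod v \<alpha>) \<beta> + wedge (twist \<alpha>) (iprod v \<beta>)"
  by (rule ext) (simp add: iprod_def[of v "wedge \<alpha> \<beta>"] wedge_Cons)

lemma linear_wedge_left: "linear (\<lambda>\<alpha>. wedge \<alpha> \<beta>)"
  by (intro linearI ext) (simp_all add: wedge_def algebra_simps sum.distrib sum_distrib_left)

lemma linear_wedge_right: "linear (wedge \<alpha>)"
  by (intro linearI ext) (simp_all add: wedge_def algebra_simps sum.distrib sum_distrib_left)

lemmas wedge_linear [simp] =
  linear_add[OF linear_wedge_left] linear_diff[OF linear_wedge_left] linear_scale[OF linear_wedge_left]
  linear_0[OF linear_wedge_left] linear_neg[OF linear_wedge_left] linear_sum[OF linear_wedge_left]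
  linear_add[OF linear_wedge_right] linear_diff[OF linear_wedge_right] linear_scale[OF linear_wedge_right]
  linear_0[OF linear_wedge_right] linear_neg[OF linear_wedge_right] linear_sum[OF linear_wedge_right]

lemma linear_iprod: "linear (iprod v)"
  by (intro linearI ext) (simp_all add: iprod_def)

lemmas iprod_linear [simp] =
  linear_add[OF linear_iprod] linear_diff[OF linear_iprod] linear_scale[OF linear_iprod]
  linear_0[OF linear_iprod] linear_neg[OF linear_iprod] linear_sum[OF linear_iprod]

lemma iprod_twist: "iprod v (twist \<alpha>) = - twist (iprod v \<alpha>)"
  by (rule ext) (simp add: iprod_def twist_def)

lemma twist_twist [simp]: "twist (twist \<alpha>) = \<alpha>"
  by (rule ext) (simp add: twist_def flip: power_mult_distrib)

lemma twist_linear [simp]: "twist (\<alpha> + \<beta>) = twist \<alpha> + twist \<beta>" "twist 0 = 0" "twist (- \<alpha>) = - twist \<alpha>"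
  by (auto simp: twist_def fun_eq_iff algebra_simps)

lemma twist_alternating: "alternating k \<alpha> \<Longrightarrow> twist \<alpha> = (-1) ^ k *\<^sub>R \<alpha>"
  by (rule ext) (auto simp: twist_def alternating_def)

subsection \<open>Alternating functions\<close>

lemma alternating_subspace: "subspace {\<eta>. alternating k \<eta>}"
proof -
  have "alternating k (0 :: 'a list \<Rightarrow> real)" by (simp add: alternating_def linear_zero)
  moreover have "alternating k (\<eta> + \<zeta>)" if "alternating k \<eta>" "alternating k \<zeta>" for \<eta> \<zeta> :: "'a list \<Rightarrow> real"
    using that unfolding alternating_def by (auto intro!: linear_compose_add)
  moreover have "alternating k (r *\<^sub>R \<eta>)" if "alternating k \<eta>" for r and \<eta> :: "'a list \<Rightarrow> real"
    using that unfolding alternating_def scaleR_fun_apply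
    by (auto intro!: linear_compose_scale_right simp del: real_scaleR_def simp: scaleR_zero_right)
  ultimately show ?thesis by (auto simp: subspace_def)
qed

lemma alternating_zero: "alternating k 0"
  using subspace_0[OF alternating_subspace] by auto

lemma alternating_add: "alternating k \<eta> \<Longrightarrow> alternating k \<zeta> \<Longrightarrow> alternating k (\<eta> + \<zeta>)"
  using subspace_add[OF alternating_subspace] by auto

lemma alternating_diff: "alternating k \<eta> \<Longrightarrow> alternating k \<zeta> \<Longrightarrow> alternating k (\<eta> - \<zeta>)"
  using subspace_diff[OF alternating_subspace] by auto

lemma alternating_scale: "alternating k \<eta> \<Longrightarrow> alternating k (r *\<^sub>R \<eta>)"
  using subspace_scale[OF alternating_subspace] by auto

lemma alternating_sum: "(\<And>i. i \<in> S \<Longrightarrow> alternating k (f i)) \<Longrightarrow> alternating k (sum f S)"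
  using subspace_sum[OF alternating_subspace, of S f k] by auto

lemma alternating_length: "alternating k \<eta> \<Longrightarrow> length vs \<noteq> k \<Longrightarrow> \<eta> vs = 0"
  by (simp add: alternating_def)

lemma iprod_degree_0: "alternating 0 \<eta> \<Longrightarrow> iprod v \<eta> = 0"
  by (rule ext) (simp add: iprod_def alternating_def)

lemma alternating_iprod: "alternating (Suc k) \<eta> \<Longrightarrow> alternating k (iprod v \<eta>)"
  using alternating_Cons[of k \<eta> v] by (simp add: iprod_def[abs_def])

lemma alternating_linear_Cons: "alternating k \<eta> \<Longrightarrow> linear (\<lambda>v. \<eta> (v # vs))"
proof (cases "length vs + 1 = k")
  case True
  assume "alternating k \<eta>"
  then have "linear (\<lambda>v. \<eta> ((undefined # vs)[0 := v]))"
    unfolding alternating_def using True by (auto simp del: list_update.simps)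
  then show ?thesis by simp
next
  case False
  assume "alternating k \<eta>"
  then have "(\<lambda>v. \<eta> (v # vs)) = (\<lambda>_. 0)" using False by (auto simp: alternating_def)
  then show ?thesis by (simp add: linear_zero)
qed

lemma alternating_linear_iprod: "alternating k \<eta> \<Longrightarrow> linear (\<lambda>v. iprod v \<eta>)"
  by (rule linear_fun) (simp add: iprod_def alternating_linear_Cons)

lemma iprod_iprod_same: "alternating k \<eta> \<Longrightarrow> iprod v (iprod v \<eta>) = 0"
proof (rule ext)
  fix vs assume "alternating k \<eta>"
  then have "\<eta> ([] @ v # v # vs) = - \<eta> ([] @ v # v # vs)" by (rule alternating_swap)
  then show "iprod v (iprod v \<eta>) vs = 0 vs" by (simp add: iprod_def)
qed

lemma iprod_iprod_swap: "alternating k \<eta> \<Longrightarrow> iprod v (iprod w \<eta>) = - iprod w (iprod v \<eta>)"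
proof (rule ext)
  fix vs assume "alternating k \<eta>"
  then have "\<eta> ([] @ w # v # vs) = - \<eta> ([] @ v # w # vs)" by (rule alternating_swap)
  then show "iprod v (iprod w \<eta>) vs = (- iprod w (iprod v \<eta>)) vs" by (simp add: iprod_def)
qed

text \<open>
  It suffices to look at the first argument: a repetition of it further down the list can be moved
  next to it, because \<open>\<iota>\<^sub>v\<eta>\<close> is alternating.
\<close>

lemma alternatingI:
  assumes zero: "\<And>vs. length vs \<noteq> k \<Longrightarrow> \<eta> vs = 0"
    and alt: "\<And>v l. k = Suc l \<Longrightarrow> alternating l (iprod v \<eta>)"
    and lin: "\<And>vs. linear (\<lambda>v. \<eta> (v # vs))"
    and same: "\<And>v vs. \<eta> (v # v # vs) = 0"
  shows "alternating k \<eta>"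
proof (cases k)
  case 0
  then show ?thesis using zero by (simp add: alternating_def)
next
  case (Suc l)
  note altl = alt[OF Suc]
  show ?thesis
    unfolding alternating_def
  proof (intro conjI allI impI)
    fix vs :: "'a list" and i assume len: "length vs = k" and i: "i < k"
    obtain u us where vs: "vs = u # us" using len Suc by (cases vs) auto
    show "linear (\<lambda>v. \<eta> (vs[i := v]))"
    proof (cases i)
      case 0
      then show ?thesis using lin vs by simp
    next
      case (Suc i')
      have "linear (\<lambda>v. iprod u \<eta> (us[i' := v]))"
        using altl[of u] len i Suc \<open>k = Suc l\<close> vs by (simp add: alternating_def)
      then show ?thesis using Suc vs by (simp add: iprod_def)
    qed
  next
    fix vs :: "'a list" and i j
    assume len: "length vs = k" and ij: "i < j" "j < k" "vs ! i = vs ! j"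
    obtain u us where vs: "vs = u # us" using len Suc by (cases vs) auto
    obtain j' where j: "j = Suc j'" using ij by (cases j) auto
    show "\<eta> vs = 0"
    proof (cases i)
      case 0
      have us: "us = take j' us @ u # drop (Suc j') us"
        using id_take_nth_drop[of j' us] ij 0 j vs len by simp
      have "iprod u \<eta> us = (-1) ^ length (take j' us) * iprod u \<eta> (u # take j' us @ drop (Suc j') us)"
        by (subst us) (rule alternating_move[OF altl])
      then show ?thesis using same by (simp add: iprod_def vs)
    next
      case (Suc i')
      have "iprod u \<eta> us = 0"
        using altl[of u] len ij Suc j \<open>k = Suc l\<close> vs unfolding alternating_def
        by (metis Suc_less_eq length_Cons nat.inject nth_Cons_Suc)
      then show ?thesis by (simp add: iprod_def vs)
    qed
  qed (use zero in simp)
qed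

lemma alternating_wedge:
  "alternating k \<alpha> \<Longrightarrow> alternating l \<beta> \<Longrightarrow> alternating (k + l) (wedge \<alpha> \<beta>)"
proof (induction "k + l" arbitrary: k l \<alpha> \<beta>)
  case 0
  show ?case
  proof (rule alternatingI)
    have "wedge \<alpha> \<beta> (v # vs) = 0" for v vs
      using 0 iprod_degree_0[of \<alpha>] iprod_degree_0[of \<beta>] by (simp add: wedge_Cons)
    then show "length vs \<noteq> k + l \<Longrightarrow> wedge \<alpha> \<beta> vs = 0"
      "linear (\<lambda>v. wedge \<alpha> \<beta> (v # vs))" "wedge \<alpha> \<beta> (v # v # vs) = 0" for v vs
      using 0 by (cases vs; simp add: linear_zero)+
  qed (use 0 in simp)
next
  case (Suc m)
  have alt: "alternating m (iprod v (wedge \<alpha> \<beta>))" for v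
    unfolding iprod_wedge
  proof (rule alternating_add)
    show "alternating m (wedge (iprod v \<alpha>) \<beta>)"
    proof (cases k)
      case 0
      then have "iprod v \<alpha> = 0" using Suc.prems iprod_degree_0 by blast
      then show ?thesis by (simp add: alternating_zero)
    next
      case (Suc k')
      then have "alternating k' (iprod v \<alpha>)" using Suc.prems alternating_iprod by blast
      then show ?thesis using Suc.hyps(1)[of k' l "iprod v \<alpha>" \<beta>] Suc.hyps(2) Suc.prems \<open>k = Suc k'\<close> by simp
    qed
    show "alternating m (wedge (twist \<alpha>) (iprod v \<beta>))"
    proof (cases l)
      case 0
      then have "iprod v \<beta> = 0" using Suc.prems iprod_degree_0 by blast
      then show ?thesis by (simp add: alternating_zero)
    next
      case (Suc l')
      then have "alternating l' (iprod v \<beta>)" using Suc.prems alternating_iprod by blast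
      moreover have "alternating k (twist \<alpha>)"
        unfolding twist_alternating[OF Suc.prems(1)] by (rule alternating_scale[OF Suc.prems(1)])
      ultimately show ?thesis using Suc.hyps(1)[of k l' "twist \<alpha>" "iprod v \<beta>"] Suc.hyps(2) \<open>l = Suc l'\<close> by simp
    qed
  qed
  show ?case
  proof (rule alternatingI)
    show "wedge \<alpha> \<beta> vs = 0" if "length vs \<noteq> k + l" for vs
    proof (cases vs)
      case Nil
      then show ?thesis
        using that Suc.prems alternating_length[of k \<alpha> "[]"] alternating_length[of l \<beta> "[]"] by auto
    next
      case (Cons v us)
      then show ?thesis
        using alternating_length[OF alt[of v], of us] that Suc.hyps(2) by (simp add: iprod_def)
    qed
    show "alternating p (iprod v (wedge \<alpha> \<beta>))" if "k + l = Suc p" for v p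
      using alt Suc.hyps(2) that by simp
    show "linear (\<lambda>v. wedge \<alpha> \<beta> (v # vs))" for vs
      unfolding wedge_Cons
      using linear_compose[OF linear_compose[OF alternating_linear_iprod[OF Suc.prems(1)] linear_wedge_left] linear_apply]
        linear_compose[OF linear_compose[OF alternating_linear_iprod[OF Suc.prems(2)] linear_wedge_right] linear_apply]
      by (intro linear_compose_add) (simp_all add: o_def)
    show "wedge \<alpha> \<beta> (v # v # vs) = 0" for v vs
    proof -
      have "iprod v (iprod v (wedge \<alpha> \<beta>)) = 0"
        by (simp add: iprod_wedge iprod_twist iprod_iprod_same[OF Suc.prems(1)]
            iprod_iprod_same[OF Suc.prems(2)])
      then show ?thesis by (simp add: iprod_def fun_eq_iff)
    qed
  qed
qed

lemma wedge_unit_left [simp]: "wedge wedge_unit \<xi> = \<xi>"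
proof -
  have 1: "iprod v wedge_unit = 0" for v :: 'a
    by (auto simp: iprod_def wedge_unit_def)
  have 2: "twist wedge_unit = (wedge_unit :: 'a list \<Rightarrow> real)"
    by (auto simp: twist_def wedge_unit_def)
  have "wedge wedge_unit \<xi> vs = \<xi> vs" for vs
  proof (induction vs arbitrary: \<xi>)
    case Nil
    then show ?case by (simp add: wedge_unit_def)
  next
    case (Cons v vs)
    then show ?case by (simp add: wedge_Cons 1 2) (simp add: iprod_def)
  qed
  then show ?thesis by auto
qed

lemma alternating_unit: "alternating 0 wedge_unit"
  by (simp add: alternating_def wedge_unit_def)

lemma iprod_wedge_one:
  assumes "alternating 1 \<theta>"
  shows "iprod v (wedge \<theta> \<xi>) = \<theta> [v] *\<^sub>R \<xi> - wedge \<theta> (iprod v \<xi>)"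
proof -
  have "iprod v \<theta> = \<theta> [v] *\<^sub>R wedge_unit"
    using assms by (auto simp: fun_eq_iff iprod_def wedge_unit_def alternating_def)
  moreover have "twist \<theta> = - \<theta>"
    using twist_alternating[OF assms] by simp
  ultimately show ?thesis by (simp add: iprod_wedge)
qed

lemma iprod_wedge_two:
  assumes "alternating 2 \<omega>"
  shows "iprod v (wedge \<omega> \<xi>) = wedge (iprod v \<omega>) \<xi> + wedge \<omega> (iprod v \<xi>)"
  using twist_alternating[OF assms] by (simp add: iprod_wedge)

lemma wedge_one_one:
  assumes "alternating 1 \<theta>" "alternating 1 \<theta>'"
  shows "wedge \<theta> (wedge \<theta>' \<xi>) = - wedge \<theta>' (wedge \<theta> \<xi>)"
proof -
  have z: "\<theta> [] = 0" "\<theta>' [] = 0" using assms by (simp_all add: alternating_def)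
  have "wedge \<theta> (wedge \<theta>' \<xi>) vs = - wedge \<theta>' (wedge \<theta> \<xi>) vs" for vs
  proof (induction vs arbitrary: \<xi>)
    case (Cons v vs)
    have "iprod v (wedge \<theta> (wedge \<theta>' \<xi>)) vs = - iprod v (wedge \<theta>' (wedge \<theta> \<xi>)) vs"
      using Cons[of "iprod v \<xi>"] by (simp add: iprod_wedge_one[OF assms(1)] iprod_wedge_one[OF assms(2)])
    then show ?case by (simp add: iprod_def)
  qed (simp add: z)
  then show ?thesis by auto
qed

lemma wedge_two_one:
  assumes "alternating 2 \<omega>" "alternating 1 \<theta>"
  shows "wedge \<omega> (wedge \<theta> \<xi>) = wedge \<theta> (wedge \<omega> \<xi>)"
proof -
  have alt: "alternating 1 (iprod v \<omega>)" for v
    using assms(1) alternating_iprod[of 1] by (simp add: numeral_2_eq_2)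
  have "wedge \<omega> (wedge \<theta> \<xi>) vs = wedge \<theta> (wedge \<omega> \<xi>) vs" for vs
  proof (induction vs arbitrary: \<xi>)
    case (Cons v vs)
    have "iprod v (wedge \<omega> (wedge \<theta> \<xi>)) vs = iprod v (wedge \<theta> (wedge \<omega> \<xi>)) vs"
      using Cons[of "iprod v \<xi>"] wedge_one_one[OF assms(2) alt, of v \<xi>]
      by (simp add: iprod_wedge_one[OF assms(2)] iprod_wedge_two[OF assms(1)])
    then show ?case by (simp add: iprod_def)
  qed simp
  then show ?thesis by auto
qed

text \<open>
  The antisymmetrisation in which each argument in turn is singled out.  Both the product with a
  1-form and the exterior derivative are of this form.
\<close>

definition alt_insert :: "('v \<Rightarrow> 'v list \<Rightarrow> real) \<Rightarrow> 'v list \<Rightarrow> real" where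
  "alt_insert F vs = (\<Sum>i<length vs. (-1) ^ i * F (vs ! i) (take i vs @ drop (Suc i) vs))"

lemma alt_insert_Nil [simp]: "alt_insert F [] = 0"
  by (simp add: alt_insert_def)

lemma alt_insert_Cons: "alt_insert F (v # vs) = F v vs - alt_insert (\<lambda>u us. F u (v # us)) vs"
  unfolding alt_insert_def by (simp add: sum.lessThan_Suc_shift sum_negf del: sum.lessThan_Suc)

lemma wedge_one_eq_alt_insert:
  assumes "alternating 1 \<theta>"
  shows "wedge \<theta> \<xi> vs = alt_insert (\<lambda>u us. \<theta> [u] * \<xi> us) vs"
proof (induction vs arbitrary: \<xi>)
  case Nil
  then show ?case using assms by (simp add: alternating_def)
next
  case (Cons v vs)
  have "wedge \<theta> \<xi> (v # vs) = iprod v (wedge \<theta> \<xi>) vs" by (simp add: iprod_def)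
  also have "\<dots> = \<theta> [v] * \<xi> vs - wedge \<theta> (iprod v \<xi>) vs" by (simp add: iprod_wedge_one[OF assms])
  finally show ?case unfolding Cons by (simp add: alt_insert_Cons iprod_def)
qed

text \<open>Each of the \<open>k\<close> terms moves one argument to the front and compensates by the sign.\<close>

lemma alt_insert_iprod:
  assumes "alternating k \<xi>"
  shows "alt_insert (\<lambda>u us. \<xi> (u # us)) vs = real k * \<xi> vs"
proof (cases "length vs = k")
  case False
  then show ?thesis using assms by (auto simp: alt_insert_def alternating_def intro!: sum.neutral)
next
  case True
  have "(-1) ^ i * \<xi> (vs ! i # take i vs @ drop (Suc i) vs) = \<xi> vs" if "i < k" for i
    using alternating_move[OF assms, of "take i vs" "vs ! i" "drop (Suc i) vs"] that True
    by (simp add: id_take_nth_drop[symmetric])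
  then show ?thesis using True by (simp add: alt_insert_def)
qed

lemma alt_insert_sum: "alt_insert (\<lambda>u us. \<Sum>e\<in>S. F e u us) vs = (\<Sum>e\<in>S. alt_insert (F e) vs)"
  unfolding alt_insert_def sum_distrib_left by (rule sum.swap)

text \<open>
  Euler's identity \<open>\<Sum> e\<^sup>* \<and> \<iota>\<^sub>e \<xi> = k \<xi>\<close>, for any pair of dual families.  It shows that \<open>k\<close>-forms are
  generated by 1-forms, and it computes the commutator of \<open>L\<close> and \<open>\<Lambda>\<close>.
\<close>

lemma euler_wedge_iprod:
  assumes "\<And>e. e \<in> S \<Longrightarrow> alternating 1 (\<theta> e)" and "alternating k \<xi>"
    and dual: "\<And>v. (\<Sum>e\<in>S. \<theta> e [v] *\<^sub>R f e) = v"
  shows "(\<Sum>e\<in>S. wedge (\<theta> e) (iprod (f e) \<xi>)) = real k *\<^sub>R \<xi>"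
proof (rule ext)
  fix vs
  have "(\<Sum>e\<in>S. wedge (\<theta> e) (iprod (f e) \<xi>)) vs =
      alt_insert (\<lambda>u us. \<Sum>e\<in>S. \<theta> e [u] * \<xi> (f e # us)) vs"
    using assms(1) by (simp add: alt_insert_sum wedge_one_eq_alt_insert iprod_def)
  also have "(\<lambda>u us. \<Sum>e\<in>S. \<theta> e [u] * \<xi> (f e # us)) = (\<lambda>u us. \<xi> (u # us))"
  proof (intro ext)
    fix u us
    have "\<xi> (u # us) = \<xi> ((\<Sum>e\<in>S. \<theta> e [u] *\<^sub>R f e) # us)" by (simp add: dual)
    then show "(\<Sum>e\<in>S. \<theta> e [u] * \<xi> (f e # us)) = \<xi> (u # us)"
      using linear_sum[OF alternating_linear_Cons[OF assms(2), of us], of "\<lambda>e. \<theta> e [u] *\<^sub>R f e" S]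
        linear_scale[OF alternating_linear_Cons[OF assms(2), of us]] by simp
  qed
  finally show "(\<Sum>e\<in>S. wedge (\<theta> e) (iprod (f e) \<xi>)) vs = (real k *\<^sub>R \<xi>) vs"
    using alt_insert_iprod[OF assms(2)] by simp
qed

subsection \<open>Determination by values on a basis\<close>

lemma alternating_eq_0I:
  fixes \<eta> :: "'a::euclidean_space list \<Rightarrow> real"
  assumes "alternating k \<eta>" and "\<And>es. set es \<subseteq> Basis \<Longrightarrow> length es = k \<Longrightarrow> distinct es \<Longrightarrow> \<eta> es = 0"
  shows "\<eta> = 0"
proof -
  have b: "\<eta> es = 0" if "set es \<subseteq> Basis" for es
    using assms that unfolding alternating_def distinct_conv_nth by (metis linorder_neqE_nat)
  have "\<eta> vs = 0" for vs
    using assms(1) b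
  proof (induction vs arbitrary: k \<eta>)
    case (Cons v vs)
    have "iprod e \<eta> vs = 0" if "e \<in> Basis" for e
    proof (cases k)
      case 0
      then show ?thesis using iprod_degree_0[of \<eta> e] Cons.prems(1) by simp
    next
      case (Suc l)
      show ?thesis
        by (rule Cons.IH[OF alternating_iprod]) (use Cons.prems Suc that in \<open>auto simp: iprod_def\<close>)
    qed
    then have "\<eta> (e # vs) = 0" if "e \<in> Basis" for e using that by (simp add: iprod_def)
    moreover have "\<eta> (v # vs) = \<eta> ((\<Sum>e\<in>Basis. (v \<bullet> e) *\<^sub>R e) # vs)" by (simp add: euclidean_representation)
    ultimately show ?case
      using linear_sum[OF alternating_linear_Cons[OF Cons.prems(1), of vs], of "\<lambda>e. (v \<bullet> e) *\<^sub>R e" Basis]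
        linear_scale[OF alternating_linear_Cons[OF Cons.prems(1), of vs]] by simp
  qed simp
  then show ?thesis by auto
qed

lemma alternating_above_dim:
  fixes \<eta> :: "'a::euclidean_space list \<Rightarrow> real"
  assumes "alternating k \<eta>" "DIM('a) < k"
  shows "\<eta> = 0"
proof (rule alternating_eq_0I[OF assms(1)])
  fix es :: "'a list" assume "set es \<subseteq> Basis" "length es = k" "distinct es"
  then have "k \<le> DIM('a)" by (metis card_mono distinct_card finite_Basis)
  then show "\<eta> es = 0" using assms(2) by simp
qed

lemma alternating_reorder:
  assumes "alternating k \<eta>" "distinct xs" "distinct ys" "set xs = set ys" "\<eta> xs = 0"
  shows "\<eta> ys = 0"
  using assms
proof (induction xs arbitrary: ys k \<eta>)
  case (Cons a xs)
  obtain as bs where ys: "ys = as @ a # bs" using Cons.prems(4) by (metis list.set_intros(1) split_list)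
  show ?case
  proof (cases k)
    case 0
    then show ?thesis using Cons.prems(1) ys by (simp add: alternating_def)
  next
    case (Suc l)
    have "iprod a \<eta> (as @ bs) = 0"
    proof (rule Cons.IH)
      show "alternating l (iprod a \<eta>)" using Cons.prems(1) Suc alternating_iprod by blast
      show "set xs = set (as @ bs)" "distinct (as @ bs)" "distinct xs"
        using Cons.prems(2-4) ys by auto
      show "iprod a \<eta> xs = 0" using Cons.prems(5) by (simp add: iprod_def)
    qed
    then show ?thesis
      using alternating_move[OF Cons.prems(1), of as a bs] by (simp add: ys iprod_def)
  qed
qed simp

section \<open>Linear symplectic geometry\<close>

text \<open>The vector that represents the covector \<open>u \<bullet> _\<close> under \<open>v \<mapsto> \<omega>(_, v)\<close>.\<close>

definition dual_vec :: "('a::euclidean_space list \<Rightarrow> real) \<Rightarrow> 'a \<Rightarrow> 'a" where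
  "dual_vec \<omega> u = (THE v. \<forall>z. \<omega> [z, v] = u \<bullet> z)"

text \<open>
  The contraction with the Poisson bivector \<open>1/2 \<Sum> J e \<and> e\<close>, where \<open>e\<close> runs through the standard basis
  and \<open>J e = dual_vec \<omega> e\<close>.  The sign is chosen such that \<open>[\<Lambda>, \<iota>\<^sub>z\<omega> \<and>] = \<iota>\<^sub>z\<close>.
\<close>

definition poisson :: "('a::euclidean_space list \<Rightarrow> real) \<Rightarrow> ('a list \<Rightarrow> real) \<Rightarrow> 'a list \<Rightarrow> real" where
  "poisson \<omega> \<xi> = (1/2) *\<^sub>R (\<Sum>e\<in>Basis. iprod e (iprod (dual_vec \<omega> e) \<xi>))"

text \<open>Graded by integers, to match the grading of \<open>lefschetz_module\<close>.\<close>

definition alt_space :: "int \<Rightarrow> ('v::real_vector list \<Rightarrow> real) set" where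
  "alt_space k = (if k < 0 then {0} else {\<eta>. alternating (nat k) \<eta>})"

definition covec :: "'a::real_inner \<Rightarrow> 'a list \<Rightarrow> real" where
  "covec e vs = (case vs of [v] \<Rightarrow> e \<bullet> v | _ \<Rightarrow> 0)"

lemma alt_spaceD: "x \<in> alt_space k \<Longrightarrow> \<exists>l. alternating l x"
  by (auto simp: alt_space_def alternating_zero split: if_splits)

lemma alt_space_of_nat [simp]: "x \<in> alt_space (int k) \<longleftrightarrow> alternating k x"
  by (simp add: alt_space_def)

lemma alternating_iprod_pred: "alternating k \<eta> \<Longrightarrow> alternating (k - 1) (iprod v \<eta>)"
  using alternating_iprod[of "k - 1" \<eta> v] iprod_degree_0[of \<eta> v] by (cases k) (auto simp: alternating_zero)

lemma linear_poisson: "linear (poisson \<omega>)"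
  by (intro linearI) (simp_all add: poisson_def sum.distrib scaleR_add_right flip: scaleR_sum_right)

lemma poisson_mem: "x \<in> alt_space k \<Longrightarrow> poisson \<omega> x \<in> alt_space (k - 2)"
proof -
  assume x: "x \<in> alt_space k"
  show ?thesis
  proof (cases "k < 2")
    case True
    have "iprod e (iprod v x) = 0" for e v
    proof (cases "k < 0")
      case True
      then show ?thesis using x by (simp add: alt_space_def)
    next
      case False
      then have "nat k = 0 \<or> nat k = Suc 0" using \<open>k < 2\<close> by linarith
      then show ?thesis using x False iprod_degree_0[of x v] alternating_iprod[of 0 x v] iprod_degree_0
        by (auto simp: alt_space_def)
    qed
    then show ?thesis by (simp add: poisson_def alt_space_def alternating_zero)
  next
    case False
    then obtain m where k: "k = int (Suc (Suc m))"
      using nonneg_int_cases[of "k - 2"] by (metis add_diff_cancel_left' diff_add_cancel int_ops(4) linorder_not_less diff_ge_0_iff_ge add_2_eq_Suc of_nat_add of_nat_numeral add.commute)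
    have m: "k - 2 = int m" using k by simp
    have "alternating (Suc (Suc m)) x" using x unfolding k by (simp only: alt_space_of_nat)
    then show ?thesis
      unfolding m alt_space_of_nat poisson_def
      by (intro alternating_scale alternating_sum alternating_iprod)
  qed
qed

locale symplectic_space =
  fixes \<omega> :: "'a::euclidean_space list \<Rightarrow> real" and n :: nat
  assumes dim: "DIM('a) = 2 * n"
    and alt_\<omega>: "alternating 2 \<omega>"
    and nondegenerate: "(\<And>w. \<omega> [v, w] = 0) \<Longrightarrow> v = 0"
begin

abbreviation J :: "'a \<Rightarrow> 'a" where "J \<equiv> dual_vec \<omega>"

abbreviation \<theta> :: "'a \<Rightarrow> 'a list \<Rightarrow> real" where "\<theta> z \<equiv> iprod z \<omega>"

lemma alt_\<theta>: "alternating 1 (\<theta> z)"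
  using alternating_iprod[of 1 \<omega> z] alt_\<omega> by (simp add: numeral_2_eq_2)

lemma linear_left: "linear (\<lambda>u. \<omega> [u, v])"
  using alternating_linear_Cons[OF alt_\<omega>, of "[v]"] by simp

lemma linear_right: "linear (\<lambda>v. \<omega> [u, v])"
  using alternating_linear_Cons[OF alt_\<theta>, of u "[]"] by (simp add: iprod_def)

lemma skew: "\<omega> [u, v] = - \<omega> [v, u]"
  using alternating_swap[OF alt_\<omega>, of "[]" u v "[]"] by simp

lemma right_cancel: "(\<And>z. \<omega> [z, v] = \<omega> [z, w]) \<Longrightarrow> v = w"
  using nondegenerate[of "v - w"] linear_diff[OF linear_left] skew
  by (metis eq_iff_diff_eq_0)

lemma \<omega>_J: "\<omega> [z, J u] = u \<bullet> z"
proof -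
  let ?T = "\<lambda>v. \<Sum>f\<in>Basis. \<omega> [f, v] *\<^sub>R f"
  have expand: "\<omega> [z, v] = (\<Sum>f\<in>Basis. (z \<bullet> f) * \<omega> [f, v])" for z v
  proof -
    have "\<omega> [z, v] = \<omega> [(\<Sum>f\<in>Basis. (z \<bullet> f) *\<^sub>R f), v]" by (simp add: euclidean_representation)
    then show ?thesis by (simp add: linear_sum[OF linear_left] linear_scale[OF linear_left])
  qed
  have lin: "linear ?T"
    by (intro linearI) (simp_all add: linear_add[OF linear_right] linear_scale[OF linear_right]
        scaleR_add_left sum.distrib scaleR_sum_right)
  have "inj ?T"
  proof (rule linear_injective_0[OF lin, THEN iffD2], intro allI impI)
    fix v assume "?T v = 0"
    then have "?T v \<bullet> f = 0" for f by (metis inner_zero_left)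
    then have "\<omega> [f, v] = 0" if "f \<in> Basis" for f
      using inner_sum_left_Basis[OF that, of "\<lambda>f. \<omega> [f, v]"] by metis
    then have "\<omega> [z, v] = \<omega> [z, 0]" for z
      using expand[of z v] linear_0[OF linear_right] by simp
    then show "v = 0" by (rule right_cancel)
  qed
  then have "surj ?T" using linear_injective_imp_surjective[OF lin] by simp
  then obtain v where v: "u = ?T v" by (rule surjE)
  have fv: "\<omega> [f, v] = u \<bullet> f" if "f \<in> Basis" for f
    unfolding v by (rule inner_sum_left_Basis[OF that, symmetric])
  have "\<omega> [z, v] = (\<Sum>f\<in>Basis. (z \<bullet> f) * (u \<bullet> f))" for z
    unfolding expand[of z v] using fv by simp
  then have "\<forall>z. \<omega> [z, v] = u \<bullet> z"
    by (metis euclidean_inner mult.commute inner_commute)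
  moreover have "w = v" if "\<forall>z. \<omega> [z, w] = u \<bullet> z" for w
    using right_cancel calculation that by simp
  ultimately show ?thesis
    unfolding dual_vec_def using theI[of "\<lambda>v. \<forall>z. \<omega> [z, v] = u \<bullet> z" v] by blast
qed

lemma J_unique: "(\<And>z. \<omega> [z, v] = u \<bullet> z) \<Longrightarrow> v = J u"
  using right_cancel \<omega>_J by simp

lemma \<omega>_J_left: "\<omega> [J u, z] = - (u \<bullet> z)"
  using skew[of "J u"] \<omega>_J by simp

lemma linear_J: "linear J"
proof (intro linearI)
  show "J (u + v) = J u + J v" for u v
    by (rule J_unique[symmetric]) (simp add: linear_add[OF linear_right] \<omega>_J inner_add_left)
  show "J (r *\<^sub>R u) = r *\<^sub>R J u" for r u
    by (rule J_unique[symmetric]) (simp add: linear_scale[OF linear_right] \<omega>_J)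
qed

lemma J_expansion: "(\<Sum>e\<in>Basis. \<omega> [e, v] *\<^sub>R J e) = v"
proof (rule right_cancel)
  fix z
  have "\<omega> [z, \<Sum>e\<in>Basis. \<omega> [e, v] *\<^sub>R J e] = (\<Sum>e\<in>Basis. \<omega> [e, v] * (e \<bullet> z))"
    by (simp add: linear_sum[OF linear_right] linear_scale[OF linear_right] \<omega>_J)
  also have "\<dots> = \<omega> [(\<Sum>e\<in>Basis. (z \<bullet> e) *\<^sub>R e), v]"
    by (simp add: linear_sum[OF linear_left] linear_scale[OF linear_left] inner_commute mult.commute)
  finally show "\<omega> [z, \<Sum>e\<in>Basis. \<omega> [e, v] *\<^sub>R J e] = \<omega> [z, v]" by (simp add: euclidean_representation)
qed

lemma \<theta>_J: "\<theta> (J e) = - covec e"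
proof (rule ext)
  fix vs
  show "\<theta> (J e) vs = (- covec e) vs"
  proof (cases "length vs = 1")
    case True
    then obtain v where "vs = [v]" by (auto simp: length_Suc_conv)
    then show ?thesis by (simp add: covec_def iprod_def \<omega>_J_left)
  next
    case False
    then show ?thesis using alternating_length[OF alt_\<theta>, of vs]
      by (auto simp: covec_def split: list.splits)
  qed
qed

lemma euler_\<theta>: "alternating k \<xi> \<Longrightarrow> (\<Sum>e\<in>Basis. wedge (\<theta> e) (iprod (J e) \<xi>)) = real k *\<^sub>R \<xi>"
  by (rule euler_wedge_iprod[OF alt_\<theta>]) (simp_all add: iprod_def J_expansion)

lemma euler_\<theta>_J: "alternating k \<xi> \<Longrightarrow> (\<Sum>e\<in>Basis. wedge (\<theta> (J e)) (iprod e \<xi>)) = - (real k *\<^sub>R \<xi>)"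
proof -
  assume "alternating k \<xi>"
  then have "(\<Sum>e\<in>Basis. wedge (- \<theta> (J e)) (iprod e \<xi>)) = real k *\<^sub>R \<xi>"
  proof (rule euler_wedge_iprod[rotated])
    show "alternating 1 (- \<theta> (J e))" for e
      using alternating_scale[OF alt_\<theta>, of "-1" "J e"] by simp
    show "(\<Sum>e\<in>Basis. (- \<theta> (J e)) [v] *\<^sub>R e) = v" for v
      by (simp add: iprod_def \<omega>_J_left euclidean_representation inner_commute[of _ v])
  qed
  then show ?thesis by (simp add: sum_negf neg_equal_iff_equal flip: minus_equation_iff)
qed

lemma wedge_mem: "x \<in> alt_space k \<Longrightarrow> wedge \<omega> x \<in> alt_space (k + 2)"
proof (cases "k < 0")
  case True
  then show "x \<in> alt_space k \<Longrightarrow> wedge \<omega> x \<in> alt_space (k + 2)"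
    by (simp add: alt_space_def alternating_zero)
next
  case False
  then show "x \<in> alt_space k \<Longrightarrow> wedge \<omega> x \<in> alt_space (k + 2)"
    using alternating_wedge[OF alt_\<omega>, of "nat k" x] by (simp add: alt_space_def nat_add_distrib add.commute)
qed

text \<open>
  The two terms in which one of the contractions hits \<open>\<theta> z\<close> are both \<open>1/2 \<iota>\<^sub>z \<xi>\<close>, because \<open>\<omega>\<close> and the
  Poisson bivector are inverse to each other.
\<close>

lemma poisson_wedge_\<theta>:
  assumes "alternating k \<xi>"
  shows "poisson \<omega> (wedge (\<theta> z) \<xi>) = wedge (\<theta> z) (poisson \<omega> \<xi>) + iprod z \<xi>"
proof -
  have lin: "linear (\<lambda>v. iprod v \<xi>)" by (rule alternating_linear_iprod[OF assms])
  have 1: "(\<Sum>e\<in>Basis. \<theta> z [J e] *\<^sub>R iprod e \<xi>) = iprod z \<xi>"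
  proof -
    have "iprod z \<xi> = iprod (\<Sum>e\<in>Basis. (z \<bullet> e) *\<^sub>R e) \<xi>" by (simp add: euclidean_representation)
    then show ?thesis
      by (simp add: iprod_def[of z \<omega>] \<omega>_J linear_sum[OF lin] linear_scale[OF lin] inner_commute)
  qed
  have 2: "(\<Sum>e\<in>Basis. \<theta> z [e] *\<^sub>R iprod (J e) \<xi>) = - iprod z \<xi>"
  proof -
    have "iprod z \<xi> = iprod (\<Sum>e\<in>Basis. \<omega> [e, z] *\<^sub>R J e) \<xi>" by (simp add: J_expansion)
    also have "\<dots> = (\<Sum>e\<in>Basis. \<omega> [e, z] *\<^sub>R iprod (J e) \<xi>)"
      by (simp add: linear_sum[OF lin] linear_scale[OF lin])
    also have "\<dots> = - (\<Sum>e\<in>Basis. \<theta> z [e] *\<^sub>R iprod (J e) \<xi>)"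
      by (subst sum_negf[symmetric], rule sum.cong) (auto simp: iprod_def skew[of _ z])
    finally show ?thesis by simp
  qed
  have "iprod e (iprod (J e) (wedge (\<theta> z) \<xi>)) =
      \<theta> z [J e] *\<^sub>R iprod e \<xi> - \<theta> z [e] *\<^sub>R iprod (J e) \<xi> + wedge (\<theta> z) (iprod e (iprod (J e) \<xi>))" for e
    by (simp add: iprod_wedge_one[OF alt_\<theta>])
  then have "poisson \<omega> (wedge (\<theta> z) \<xi>) =
      (1/2) *\<^sub>R ((iprod z \<xi> - - iprod z \<xi>) + wedge (\<theta> z) (\<Sum>e\<in>Basis. iprod e (iprod (J e) \<xi>)))"
    unfolding poisson_def by (simp add: sum.distrib sum_subtractf 1 2)
  also have "\<dots> = wedge (\<theta> z) (poisson \<omega> \<xi>) + iprod z \<xi>"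
    by (simp add: poisson_def scaleR_add_right flip: scaleR_2)
  finally show ?thesis .
qed

text \<open>
  Before the factor \<open>1/2\<close>, contracting both slots of \<open>\<omega>\<close> gives \<open>-2n\<close>, and contracting one slot of \<open>\<omega>\<close> and
  one of \<open>\<xi>\<close> gives \<open>2k\<close>, by Euler's identity for two pairs of dual families.
\<close>

lemma poisson_wedge:
  assumes "alternating k \<xi>"
  shows "poisson \<omega> (wedge \<omega> \<xi>) = wedge \<omega> (poisson \<omega> \<xi>) + (real k - real n) *\<^sub>R \<xi>"
proof -
  have "iprod e (iprod (J e) (wedge \<omega> \<xi>)) =
      (- (e \<bullet> e)) *\<^sub>R \<xi> - wedge (\<theta> (J e)) (iprod e \<xi>) + wedge (\<theta> e) (iprod (J e) \<xi>)
      + wedge \<omega> (iprod e (iprod (J e) \<xi>))" for e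
    by (simp add: iprod_wedge_one[OF alt_\<theta>] iprod_wedge_two[OF alt_\<omega>])
       (simp add: iprod_def[of _ \<omega>] \<omega>_J_left)
  then have "poisson \<omega> (wedge \<omega> \<xi>) = (1/2) *\<^sub>R (\<Sum>e\<in>Basis. (- ((e :: 'a) \<bullet> e)) *\<^sub>R \<xi> - wedge (\<theta> (J e)) (iprod e \<xi>)
      + wedge (\<theta> e) (iprod (J e) \<xi>) + wedge \<omega> (iprod e (iprod (J e) \<xi>)))"
    unfolding poisson_def by simp
  also have "(\<Sum>e\<in>Basis. (- ((e :: 'a) \<bullet> e)) *\<^sub>R \<xi> - wedge (\<theta> (J e)) (iprod e \<xi>)
      + wedge (\<theta> e) (iprod (J e) \<xi>) + wedge \<omega> (iprod e (iprod (J e) \<xi>))) =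
      (\<Sum>e\<in>Basis. (- ((e :: 'a) \<bullet> e)) *\<^sub>R \<xi>) - - (real k *\<^sub>R \<xi>) + real k *\<^sub>R \<xi> + wedge \<omega> (\<Sum>e\<in>Basis. iprod e (iprod (J e) \<xi>))"
    unfolding sum.distrib sum_subtractf euler_\<theta>_J[OF assms] euler_\<theta>[OF assms] wedge_linear ..
  also have "(\<Sum>e\<in>Basis. (- ((e :: 'a) \<bullet> e)) *\<^sub>R \<xi>) = - (real (2 * n)) *\<^sub>R \<xi>"
    unfolding scaleR_sum_left[symmetric] dim[symmetric] by (simp add: inner_same_Basis sum_negf)
  also have "(1/2) *\<^sub>R (- (real (2 * n)) *\<^sub>R \<xi> - - (real k *\<^sub>R \<xi>) + real k *\<^sub>R \<xi> + wedge \<omega> (\<Sum>e\<in>Basis. iprod e (iprod (J e) \<xi>)))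
     = wedge \<omega> (poisson \<omega> \<xi>) + (real k - real n) *\<^sub>R \<xi>"
    unfolding poisson_def wedge_linear by (rule ext) (simp add: algebra_simps)
  finally show ?thesis .
qed

lemma lefschetz_module_alt_space: "lefschetz_module alt_space (wedge \<omega>) (poisson \<omega>) n"
proof (rule lefschetz_module.intro)
  fix x :: "'a list \<Rightarrow> real" and k :: int
  show "subspace (alt_space k :: ('a list \<Rightarrow> real) set)"
    by (simp add: alt_space_def subspace_single_0 alternating_subspace)
  show "k < 0 \<or> 2 * int n < k \<Longrightarrow> alt_space k = ({0} :: ('a list \<Rightarrow> real) set)"
    using alternating_above_dim[where 'a='a and k="nat k"] dim by (auto simp: alt_space_def alternating_zero)
  show "linear (wedge \<omega>)" "linear (poisson \<omega>)" by (rule linear_wedge_right linear_poisson)+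
  assume x: "x \<in> alt_space k"
  then show "wedge \<omega> x \<in> alt_space (k + 2)" "poisson \<omega> x \<in> alt_space (k - 2)"
    by (rule wedge_mem poisson_mem)+
  show "poisson \<omega> (wedge \<omega> x) = wedge \<omega> (poisson \<omega> x) + real_of_int (k - int n) *\<^sub>R x"
  proof (cases "k < 0")
    case True
    then show ?thesis using x by (simp add: alt_space_def linear_0[OF linear_poisson])
  next
    case False
    then have "alternating (nat k) x" "real_of_int (k - int n) = real (nat k) - real n"
      using x by (auto simp: alt_space_def)
    then show ?thesis using poisson_wedge by metis
  qed
qed

sublocale pt: lefschetz_module alt_space "wedge \<omega>" "poisson \<omega>" n
  by (rule lefschetz_module_alt_space)

lemma poisson_iprod:
  assumes "alternating k \<xi>"
  shows "poisson \<omega> (iprod z \<xi>) = iprod z (poisson \<omega> \<xi>)"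
proof -
  have "iprod e (iprod (J e) (iprod z \<xi>)) = iprod z (iprod e (iprod (J e) \<xi>))" for e
    using iprod_iprod_swap[OF assms, of "J e" z]
      iprod_iprod_swap[OF alternating_iprod_pred[OF assms], of e z "J e"] by simp
  then show ?thesis by (simp add: poisson_def)
qed

lemma L_pow_\<theta>: "(wedge \<omega> ^^ m) (wedge (\<theta> z) \<xi>) = wedge (\<theta> z) ((wedge \<omega> ^^ m) \<xi>)"
  by (induction m) (simp_all add: wedge_two_one[OF alt_\<omega> alt_\<theta>])

lemma iprod_L_pow:
  "iprod z ((wedge \<omega> ^^ m) \<xi>) =
     (wedge \<omega> ^^ m) (iprod z \<xi>) + real m *\<^sub>R wedge (\<theta> z) ((wedge \<omega> ^^ (m - 1)) \<xi>)"
proof (induction m)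
  case (Suc m)
  have "wedge \<omega> (wedge (\<theta> z) ((wedge \<omega> ^^ (m - 1)) \<xi>)) = wedge (\<theta> z) ((wedge \<omega> ^^ m) \<xi>)" if "m > 0"
    using that by (cases m) (simp_all add: wedge_two_one[OF alt_\<omega> alt_\<theta>])
  then have "real m *\<^sub>R wedge \<omega> (wedge (\<theta> z) ((wedge \<omega> ^^ (m - 1)) \<xi>)) = real m *\<^sub>R wedge (\<theta> z) ((wedge \<omega> ^^ m) \<xi>)"
    by (cases "m = 0") auto
  moreover have "iprod z ((wedge \<omega> ^^ Suc m) \<xi>) = wedge (\<theta> z) ((wedge \<omega> ^^ m) \<xi>) + wedge \<omega> (iprod z ((wedge \<omega> ^^ m) \<xi>))"
    by (simp add: iprod_wedge_two[OF alt_\<omega>])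
  ultimately have "iprod z ((wedge \<omega> ^^ Suc m) \<xi>) = wedge (\<theta> z) ((wedge \<omega> ^^ m) \<xi>)
      + ((wedge \<omega> ^^ Suc m) (iprod z \<xi>) + real m *\<^sub>R wedge (\<theta> z) ((wedge \<omega> ^^ m) \<xi>))"
    unfolding Suc wedge_linear by simp
  then show ?case
    unfolding of_nat_Suc scaleR_add_left by (simp only: scaleR_one diff_Suc_1 add.assoc add.commute add.left_commute)
qed simp

lemma poisson_pow_iprod:
  "x \<in> alt_space k \<Longrightarrow> (poisson \<omega> ^^ j) (iprod z x) = iprod z ((poisson \<omega> ^^ j) x)"
proof (induction j)
  case (Suc j)
  obtain l where "alternating l ((poisson \<omega> ^^ j) x)" using alt_spaceD[OF pt.\<Lambda>_pow_mem[OF Suc.prems]] by blast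
  then show ?case using Suc poisson_iprod by simp
qed simp

lemma poisson_pow_\<theta>:
  assumes "x \<in> alt_space k"
  shows "(poisson \<omega> ^^ j) (wedge (\<theta> z) x) =
    wedge (\<theta> z) ((poisson \<omega> ^^ j) x) + real j *\<^sub>R (poisson \<omega> ^^ (j - 1)) (iprod z x)"
proof (induction j)
  case (Suc j)
  obtain l where l: "alternating l ((poisson \<omega> ^^ j) x)" using alt_spaceD[OF pt.\<Lambda>_pow_mem[OF assms]] by blast
  have 1: "real j *\<^sub>R poisson \<omega> ((poisson \<omega> ^^ (j - 1)) (iprod z x)) = real j *\<^sub>R (poisson \<omega> ^^ j) (iprod z x)"
    by (cases j) auto
  have "(poisson \<omega> ^^ Suc j) (wedge (\<theta> z) x) = poisson \<omega> (wedge (\<theta> z) ((poisson \<omega> ^^ j) x))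
      + real j *\<^sub>R poisson \<omega> ((poisson \<omega> ^^ (j - 1)) (iprod z x))"
    unfolding funpow.simps o_apply Suc pt.\<Lambda>_simps ..
  also have "\<dots> = wedge (\<theta> z) ((poisson \<omega> ^^ Suc j) x) + (iprod z ((poisson \<omega> ^^ j) x) + real j *\<^sub>R (poisson \<omega> ^^ j) (iprod z x))"
    unfolding 1 poisson_wedge_\<theta>[OF l] by simp
  also have "iprod z ((poisson \<omega> ^^ j) x) + real j *\<^sub>R (poisson \<omega> ^^ j) (iprod z x) = real (Suc j) *\<^sub>R (poisson \<omega> ^^ (Suc j - 1)) (iprod z x)"
    using poisson_pow_iprod[OF assms, of j z] by (simp add: scaleR_add_left)
  finally show ?case .
qed simp

lemma inv_fact_L_pow_pred:
  "(inv_fact m * real (nat m)) *\<^sub>R (wedge \<omega> ^^ (nat m - 1)) y = inv_fact (m - 1) *\<^sub>R (wedge \<omega> ^^ nat (m - 1)) y"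
proof (cases "m \<le> 0")
  case False
  then have "nat (m - 1) = nat m - 1" by linarith
  then show ?thesis using inv_fact_pred[of m] by (simp only: mult.commute)
qed (simp add: inv_fact_def)

text \<open>
  The property that characterises the star.  On the left, \<open>\<theta> z\<close> is moved to the left of \<open>\<Lambda>\<^sup>j\<close> at
  the cost of \<open>j \<Lambda>\<^sup>j\<^sup>-\<^sup>1 \<iota>\<^sub>z\<close>; on the right, \<open>\<iota>\<^sub>z\<close> is moved to the right of \<open>L\<^sup>i\<close> at the cost of
  \<open>i \<theta> z L\<^sup>i\<^sup>-\<^sup>1\<close>.  The main term of each side is the extra term of the other, thanks to the weights
  \<open>1 / (i! j!)\<close>.
\<close>

lemma star_sum_\<theta>:
  assumes \<xi>: "alternating k \<xi>" and K: "int k + 1 < 2 * int K"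
  shows "pt.star_sum K N (int k + 1) (wedge (\<theta> z) \<xi>) = iprod z (pt.star_sum K N (int k) \<xi>)"
proof -
  let ?L = "\<lambda>m. wedge \<omega> ^^ nat m" and ?\<Lambda> = "\<lambda>j. poisson \<omega> ^^ j"
  let ?m = "\<lambda>j. N - int k + int j"
  have \<xi>': "\<xi> \<in> alt_space (int k)" using \<xi> by simp
  obtain K' where K': "K = Suc K'" using K by (cases K) auto
  \<comment> \<open>After the shift \<open>j \<mapsto> j + 1\<close> one summand is missing; it vanishes for degree reasons.\<close>
  have top: "?\<Lambda> K' (iprod z \<xi>) = 0"
    unfolding poisson_pow_iprod[OF \<xi>']
  proof -
    have "iprod z \<xi> \<in> alt_space (int k - 1)"
      using alternating_iprod[of "k - 1" \<xi> z] iprod_degree_0[of \<xi> z] \<xi>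
      by (cases k) (auto simp: alt_space_def)
    then have "?\<Lambda> K' (iprod z \<xi>) = 0" using pt.\<Lambda>_pow_eq_zero K K' by simp
    then show "iprod z (?\<Lambda> K' \<xi>) = 0" using poisson_pow_iprod[OF \<xi>'] by simp
  qed
  have "pt.star_sum K N (int k + 1) (wedge (\<theta> z) \<xi>) =
      (\<Sum>j<K. (inv_fact (?m j - 1) / fact j) *\<^sub>R wedge (\<theta> z) (?L (?m j - 1) (?\<Lambda> j \<xi>))) +
      (\<Sum>j<K. (inv_fact (?m j - 1) / fact j * real j) *\<^sub>R ?L (?m j - 1) (?\<Lambda> (j - 1) (iprod z \<xi>)))"
    unfolding pt.star_sum_def poisson_pow_\<theta>[OF \<xi>'] sum.distrib[symmetric]
    by (intro sum.cong refl) (simp add: pt.L_pow_simps L_pow_\<theta> scaleR_add_right algebra_simps)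
  also have "(\<Sum>j<K. (inv_fact (?m j - 1) / fact j * real j) *\<^sub>R ?L (?m j - 1) (?\<Lambda> (j - 1) (iprod z \<xi>)))
      = (\<Sum>j<K'. (inv_fact (?m j) / fact j) *\<^sub>R ?L (?m j) (?\<Lambda> j (iprod z \<xi>)))"
    unfolding K' sum.lessThan_Suc_shift
    by (simp add: field_simps del: of_nat_Suc) (intro sum.cong refl, simp add: field_simps)
  also have "\<dots> = (\<Sum>j<K. (inv_fact (?m j) / fact j) *\<^sub>R ?L (?m j) (?\<Lambda> j (iprod z \<xi>)))"
    unfolding K' by (simp add: top pt.L_pow_simps)
  also have "(\<Sum>j<K. (inv_fact (?m j - 1) / fact j) *\<^sub>R wedge (\<theta> z) (?L (?m j - 1) (?\<Lambda> j \<xi>))) +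
      (\<Sum>j<K. (inv_fact (?m j) / fact j) *\<^sub>R ?L (?m j) (?\<Lambda> j (iprod z \<xi>))) =
      (\<Sum>j<K. (inv_fact (?m j) / fact j) *\<^sub>R iprod z (?L (?m j) (?\<Lambda> j \<xi>)))"
    unfolding sum.distrib[symmetric]
  proof (intro sum.cong refl)
    fix j
    have "(inv_fact (?m j) / fact j) *\<^sub>R iprod z (?L (?m j) (?\<Lambda> j \<xi>)) =
        (inv_fact (?m j) / fact j) *\<^sub>R ?L (?m j) (?\<Lambda> j (iprod z \<xi>)) +
        (1 / fact j) *\<^sub>R ((inv_fact (?m j) * real (nat (?m j))) *\<^sub>R wedge (\<theta> z) ((wedge \<omega> ^^ (nat (?m j) - 1)) (?\<Lambda> j \<xi>)))"
      by (simp add: iprod_L_pow poisson_pow_iprod[OF \<xi>'] scaleR_add_right)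
    also have "(inv_fact (?m j) * real (nat (?m j))) *\<^sub>R wedge (\<theta> z) ((wedge \<omega> ^^ (nat (?m j) - 1)) (?\<Lambda> j \<xi>)) =
        inv_fact (?m j - 1) *\<^sub>R wedge (\<theta> z) (?L (?m j - 1) (?\<Lambda> j \<xi>))"
      using inv_fact_L_pow_pred[of "?m j" "wedge (\<theta> z) (?\<Lambda> j \<xi>)"] by (simp only: L_pow_\<theta>)
    also have "(1 / fact j) *\<^sub>R (inv_fact (?m j - 1) *\<^sub>R wedge (\<theta> z) (?L (?m j - 1) (?\<Lambda> j \<xi>))) =
        (inv_fact (?m j - 1) / fact j) *\<^sub>R wedge (\<theta> z) (?L (?m j - 1) (?\<Lambda> j \<xi>))"
      by simp
    finally show "(inv_fact (?m j - 1) / fact j) *\<^sub>R wedge (\<theta> z) (?L (?m j - 1) (?\<Lambda> j \<xi>)) +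
        (inv_fact (?m j) / fact j) *\<^sub>R ?L (?m j) (?\<Lambda> j (iprod z \<xi>)) =
        (inv_fact (?m j) / fact j) *\<^sub>R iprod z (?L (?m j) (?\<Lambda> j \<xi>))"
      by (simp only: add.commute)
  qed
  also have "\<dots> = iprod z (pt.star_sum K N (int k) \<xi>)"
    by (simp add: pt.star_sum_def)
  finally show ?thesis .
qed

lemma star_sum_degree_0:
  assumes "alternating 0 \<xi>" "0 < K"
  shows "pt.star_sum K (int m) 0 \<xi> = (1 / fact m) *\<^sub>R (wedge \<omega> ^^ m) \<xi>"
proof -
  have "pt.star_sum K (int m) 0 \<xi> = pt.star_sum 1 (int m) 0 \<xi>"
    using assms by (intro pt.star_sum_cong) (auto simp: alt_space_def)
  then show ?thesis by (simp add: pt.star_sum_def inv_fact_def)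
qed

lemma star_sum_Suc:
  assumes "alternating (Suc k) \<xi>" and K: "int k + 1 < 2 * int K"
  shows "pt.star_sum K N (int (Suc k)) \<xi> =
    (1 / real (Suc k)) *\<^sub>R (\<Sum>e\<in>Basis. iprod e (pt.star_sum K N (int k) (iprod (J e) \<xi>)))"
proof -
  have "\<xi> = (1 / real (Suc k)) *\<^sub>R (\<Sum>e\<in>Basis. wedge (\<theta> e) (iprod (J e) \<xi>))"
    unfolding euler_\<theta>[OF assms(1)] by simp
  then have "pt.star_sum K N (int (Suc k)) \<xi> =
      pt.star_sum K N (int (Suc k)) ((1 / real (Suc k)) *\<^sub>R (\<Sum>e\<in>Basis. wedge (\<theta> e) (iprod (J e) \<xi>)))"
    by simp
  also have "\<dots> = (1 / real (Suc k)) *\<^sub>R (\<Sum>e\<in>Basis. pt.star_sum K N (int k + 1) (wedge (\<theta> e) (iprod (J e) \<xi>)))"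
    by (simp only: linear_scale[OF pt.linear_star_sum] linear_sum[OF pt.linear_star_sum] of_nat_Suc add.commute)
  also have "\<dots> = (1 / real (Suc k)) *\<^sub>R (\<Sum>e\<in>Basis. iprod e (pt.star_sum K N (int k) (iprod (J e) \<xi>)))"
    using star_sum_\<theta>[OF alternating_iprod[OF assms(1)] K] by simp
  finally show ?thesis .
qed

text \<open>
  On constants the sum is a multiple of \<open>\<omega>\<^sup>n\<^sup>+\<^sup>1\<close>, a form above the top degree, and \<open>star_sum_Suc\<close> carries
  this over to all degrees.
\<close>

lemma star_sum_Suc_n_eq_0: "alternating k \<xi> \<Longrightarrow> int k < 2 * int K \<Longrightarrow> pt.star_sum K (int (Suc n)) (int k) \<xi> = 0"
proof (induction k arbitrary: \<xi>)
  case 0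
  have "(wedge \<omega> ^^ Suc n) \<xi> = 0"
    using pt.eq_zero[OF pt.L_pow_mem[of \<xi> 0 "Suc n"]] 0 by (simp add: alt_space_def)
  then show ?case using star_sum_degree_0[of \<xi> K "Suc n"] 0 by simp
next
  case (Suc k)
  then have "pt.star_sum K (int (Suc n)) (int k) (iprod (J e) \<xi>) = 0" for e
    by (intro Suc.IH alternating_iprod) auto
  then show ?case using star_sum_Suc[OF Suc.prems(1), of K] Suc.prems(2) by simp
qed

text \<open>
  Moving \<open>\<iota>\<^sub>z\<close> to the left through the sum produces \<open>\<iota>\<^sub>z\<close> of the sum for \<open>n + 1\<close>, which vanishes, and
  a correction in which \<open>\<theta> z\<close> takes its place.
\<close>

lemma star_sum_iprod:
  assumes \<xi>: "alternating k \<xi>" and K: "int k < 2 * int K"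
  shows "pt.star_sum K (int n) (int k - 1) (iprod z \<xi>) = - wedge (\<theta> z) (pt.star_sum K (int n) (int k) \<xi>)"
proof -
  let ?L = "\<lambda>m. wedge \<omega> ^^ nat m" and ?\<Lambda> = "\<lambda>j. poisson \<omega> ^^ j"
  let ?m = "\<lambda>j. int (Suc n) - int k + int j"
  have \<xi>': "\<xi> \<in> alt_space (int k)" using \<xi> by simp
  have "(inv_fact (?m j) / fact j) *\<^sub>R ?L (?m j) (?\<Lambda> j (iprod z \<xi>)) =
      iprod z ((inv_fact (?m j) / fact j) *\<^sub>R ?L (?m j) (?\<Lambda> j \<xi>)) -
      wedge (\<theta> z) ((inv_fact (?m j - 1) / fact j) *\<^sub>R ?L (?m j - 1) (?\<Lambda> j \<xi>))" for j
  proof -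
    have "wedge (\<theta> z) ((inv_fact (?m j - 1) / fact j) *\<^sub>R ?L (?m j - 1) (?\<Lambda> j \<xi>)) =
      (1 / fact j) *\<^sub>R (inv_fact (?m j - 1) *\<^sub>R ?L (?m j - 1) (wedge (\<theta> z) (?\<Lambda> j \<xi>)))"
      by (simp add: L_pow_\<theta>)
    also have "\<dots> = (inv_fact (?m j) / fact j) *\<^sub>R (real (nat (?m j)) *\<^sub>R (wedge \<omega> ^^ (nat (?m j) - 1)) (wedge (\<theta> z) (?\<Lambda> j \<xi>)))"
      unfolding inv_fact_L_pow_pred[symmetric] by simp
    finally show ?thesis
      by (simp add: iprod_L_pow poisson_pow_iprod[OF \<xi>'] L_pow_\<theta> scaleR_add_right)
  qed
  then have "pt.star_sum K (int n) (int k - 1) (iprod z \<xi>) =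
      iprod z (pt.star_sum K (int (Suc n)) (int k) \<xi>) - wedge (\<theta> z) (pt.star_sum K (int n) (int k) \<xi>)"
    unfolding pt.star_sum_def iprod_linear wedge_linear sum_subtractf[symmetric]
    by (intro sum.cong refl) (simp add: algebra_simps)
  then show ?thesis using star_sum_Suc_n_eq_0[OF assms] by simp
qed

text \<open>
  If the star of \<open>\<xi>\<close> vanishes, so does the star of \<open>\<iota>\<^sub>z\<xi>\<close> for all \<open>z\<close>.  In degree 0 injectivity means
  \<open>\<omega>\<^sup>n \<noteq> 0\<close>, which is \<open>L_pow_inj\<close> for \<open>j = n\<close>.
\<close>

lemma star_sum_inj: "alternating k \<xi> \<Longrightarrow> int k < 2 * int K \<Longrightarrow> pt.star_sum K (int n) (int k) \<xi> = 0 \<Longrightarrow> \<xi> = 0"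
proof (induction k arbitrary: \<xi>)
  case 0
  then have "0 < K" by simp
  then have "(1 / fact n) *\<^sub>R (wedge \<omega> ^^ n) \<xi> = 0"
    using star_sum_degree_0[OF 0(1), of K n] 0(3) by (simp only: of_nat_0)
  then have "(wedge \<omega> ^^ n) \<xi> = 0" unfolding scaleR_eq_0_iff by simp
  then show ?case using pt.L_pow_inj[of \<xi> n] 0 by (simp add: alt_space_def)
next
  case (Suc k)
  have "iprod z \<xi> = 0" for z
  proof (rule Suc.IH[OF alternating_iprod[OF Suc.prems(1)]])
    show "pt.star_sum K (int n) (int k) (iprod z \<xi>) = 0"
      using star_sum_iprod[OF Suc.prems(1,2), of z] unfolding Suc.prems(3) wedge_linear neg_0_equal_iff_equal by simp
  qed (use Suc.prems(2) in simp)
  then have "\<xi> (z # vs) = 0" for z vs by (metis iprod_def zero_fun_apply)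
  moreover have "\<xi> [] = 0" using Suc.prems(1) by (simp add: alternating_def)
  ultimately show ?case by (metis ext neq_Nil_conv zero_fun_apply)
qed

end

section \<open>The symplectic star\<close>

lemma alternating_repeat:
  "alternating k \<eta> \<Longrightarrow> length vs = k \<Longrightarrow> i < j \<Longrightarrow> j < k \<Longrightarrow> vs ! i = vs ! j \<Longrightarrow> \<eta> vs = 0"
  unfolding alternating_def by blast

lemma alternating_map:
  assumes "alternating k \<xi>" "linear A"
  shows "alternating k (\<lambda>vs. \<xi> (map A vs))"
  unfolding alternating_def
proof (intro conjI allI impI)
  fix vs :: "'b list" and i assume "length vs = k" "i < k"
  then have "linear (\<lambda>v. \<xi> ((map A vs)[i := v]))"
    using assms(1) by (simp add: alternating_def)
  from linear_compose[OF assms(2) this] show "linear (\<lambda>v. \<xi> (map A (vs[i := v])))"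
    by (simp add: o_def map_update)
next
  fix vs :: "'b list" and i j assume "length vs = k" "i < j" "j < k" "vs ! i = vs ! j"
  then show "\<xi> (map A vs) = 0"
    using alternating_repeat[OF assms(1), of "map A vs" i j] by simp
qed (use assms(1) in \<open>simp add: alternating_def\<close>)

lemma alternating_not_distinct:
  assumes "alternating k \<eta>" "\<not> distinct vs"
  shows "\<eta> vs = 0"
proof (cases "length vs = k")
  case True
  obtain i j where "i < length vs" "j < length vs" "i \<noteq> j" "vs ! i = vs ! j"
    using assms(2) by (auto simp: distinct_conv_nth)
  then show ?thesis
    using alternating_repeat[OF assms(1) True, of i j] alternating_repeat[OF assms(1) True, of j i] True
    by (cases "i < j") auto
qed (rule alternating_length[OF assms(1)])

lemma wedge_power_eq: "wedge_power \<omega> m = (wedge \<omega> ^^ m) wedge_unit"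
  by (induction m) simp_all

lemma iprod_unit [simp]: "iprod v wedge_unit = 0"
  by (rule ext) (simp add: iprod_def wedge_unit_def)

lemma degree_0_eq: "alternating 0 \<xi> \<Longrightarrow> \<xi> = \<xi> [] *\<^sub>R wedge_unit"
  by (rule ext) (simp add: wedge_unit_def alternating_def)

text \<open>
  This is \<open>(-1)\<^bsup>k(k-1)/2\<^esup>\<close>, the sign of the reversal of \<open>k\<close> vectors.
\<close>

definition star_sign :: "nat \<Rightarrow> real" where
  "star_sign k = (\<Prod>i<k. (-1) ^ i)"

lemma star_sign_nonzero [simp]: "star_sign k \<noteq> 0"
  by (simp add: star_sign_def)

context symplectic_space
begin

text \<open>
  The inverse of \<open>v \<mapsto> \<omega>(_, v)\<close>; composition with it inverts \<open>flat\<close>.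
\<close>

definition covector_dual :: "('a \<Rightarrow>\<^sub>L real) \<Rightarrow> 'a" where
  "covector_dual \<alpha> = (\<Sum>e\<in>Basis. blinfun_apply \<alpha> e *\<^sub>R J e)"

lemma linear_covector_dual: "linear covector_dual"
  by (intro linearI) (simp_all add: covector_dual_def blinfun.add_left blinfun.scaleR_left
      scaleR_add_left sum.distrib scaleR_sum_right)

lemma apply_flat_vector: "blinfun_apply (Blinfun (\<lambda>z. \<omega> [z, v])) z = \<omega> [z, v]"
  using linear_left[of v] by (simp add: linear_conv_bounded_linear bounded_linear_Blinfun_apply)

lemma covector_dual_flat: "covector_dual (Blinfun (\<lambda>z. \<omega> [z, v])) = v"
  by (simp add: covector_dual_def apply_flat_vector J_expansion)

lemma flat_covector_dual: "Blinfun (\<lambda>z. \<omega> [z, covector_dual \<alpha>]) = \<alpha>"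
proof (rule blinfun_eqI)
  fix z
  have "blinfun_apply (Blinfun (\<lambda>z. \<omega> [z, covector_dual \<alpha>])) z = (\<Sum>e\<in>Basis. blinfun_apply \<alpha> e * (e \<bullet> z))"
    unfolding apply_flat_vector by (simp add: covector_dual_def linear_sum[OF linear_right] linear_scale[OF linear_right] \<omega>_J)
  also have "\<dots> = blinfun_apply \<alpha> (\<Sum>e\<in>Basis. (z \<bullet> e) *\<^sub>R e)"
    by (simp add: blinfun.sum_right blinfun.scaleR_right inner_commute mult.commute)
  finally show "blinfun_apply (Blinfun (\<lambda>z. \<omega> [z, covector_dual \<alpha>])) z = blinfun_apply \<alpha> z"
    by (simp add: euclidean_representation)
qed

lemma covector_dual_inner: "covector_dual (blinfun_inner_left e) = J e"
proof -
  have "covector_dual (blinfun_inner_left e) = J (\<Sum>f\<in>Basis. (e \<bullet> f) *\<^sub>R f)"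
    by (simp add: covector_dual_def linear_sum[OF linear_J] linear_scale[OF linear_J] inner_commute)
  then show ?thesis by (simp add: euclidean_representation)
qed

lemma the_inv_flat:
  assumes "alternating k \<xi>"
  shows "the_inv_into {Z. alternating k Z} (flat \<omega>) \<xi> = (\<lambda>\<alpha>s. \<xi> (map covector_dual \<alpha>s))"
proof (rule the_inv_into_f_eq)
  show "inj_on (flat \<omega>) {Z. alternating k Z}"
  proof (rule inj_onI)
    fix Z W :: "('a \<Rightarrow>\<^sub>L real) list \<Rightarrow> real" assume eq: "flat \<omega> Z = flat \<omega> W"
    show "Z = W"
    proof (rule ext)
      fix \<alpha>s
      have "flat \<omega> Z (map covector_dual \<alpha>s) = flat \<omega> W (map covector_dual \<alpha>s)" by (simp add: eq)
      then show "Z \<alpha>s = W \<alpha>s" by (simp add: flat_def o_def flat_covector_dual)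
    qed
  qed
  show "flat \<omega> (\<lambda>\<alpha>s. \<xi> (map covector_dual \<alpha>s)) = \<xi>"
    by (rule ext) (simp add: flat_def o_def covector_dual_flat)
  show "(\<lambda>\<alpha>s. \<xi> (map covector_dual \<alpha>s)) \<in> {Z. alternating k Z}"
    using alternating_map[OF assms linear_covector_dual] by simp
qed

abbreviation vol :: "'a list \<Rightarrow> real" where "vol \<equiv> wedge_power \<omega> n"

lemma alternating_wedge_power: "alternating (2 * m) (wedge_power \<omega> m)"
proof (induction m)
  case (Suc m)
  then show ?case using alternating_wedge[OF alt_\<omega> Suc] by simp
qed (simp add: alternating_unit)

lemma star_eval:
  assumes "alternating k \<xi>"
  shows "symplectic_star \<omega> n k \<xi> vs =
    (\<Sum>es | set es \<subseteq> Basis \<and> length es = k. \<xi> (map J es) * vol (es @ vs)) / fact k"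
proof -
  show ?thesis
    unfolding symplectic_star_def contract_def the_inv_flat[OF assms] by (simp add: o_def covector_dual_inner)
qed

text \<open>
  The recursion that Euler's identity gives for \<open>star_sum\<close> (\<open>star_sum_Suc\<close>), up to the sign that
  arises from moving \<open>e\<close> past the \<open>k\<close> other contracted vectors.
\<close>

lemma star_Suc:
  assumes "alternating (Suc k) \<xi>"
  shows "symplectic_star \<omega> n (Suc k) \<xi> =
    ((-1) ^ k / real (Suc k)) *\<^sub>R (\<Sum>e\<in>Basis. iprod e (symplectic_star \<omega> n k (iprod (J e) \<xi>)))"
proof (rule ext)
  fix vs
  let ?B = "\<lambda>k. {es :: 'a list. set es \<subseteq> Basis \<and> length es = k}"
  have "(\<Sum>es\<in>?B (Suc k). \<xi> (map J es) * vol (es @ vs)) =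
      (\<Sum>(e, es)\<in>Basis \<times> ?B k. \<xi> (J e # map J es) * vol (e # es @ vs))"
    by (rule sum.reindex_bij_witness[where i = "\<lambda>(e, es). e # es" and j = "\<lambda>es. (hd es, tl es)"])
       (auto simp: length_Suc_conv)
  also have "\<dots> = (\<Sum>e\<in>Basis. \<Sum>es\<in>?B k. \<xi> (J e # map J es) * vol (e # es @ vs))"
    by (subst sum.cartesian_product) simp
  also have "\<dots> = (\<Sum>e\<in>Basis. \<Sum>es\<in>?B k. (-1) ^ k * (iprod (J e) \<xi> (map J es) * vol (es @ e # vs)))"
  proof (intro sum.cong refl)
    fix e :: 'a and es assume "es \<in> ?B k"
    then have "vol (es @ e # vs) = (-1) ^ k * vol (e # es @ vs)"
      using alternating_move[OF alternating_wedge_power[of n], of es e vs] by simp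
    then have "(-1) ^ k * vol (es @ e # vs) = vol (e # es @ vs)"
      by (simp flip: power_mult_distrib mult.assoc)
    then show "\<xi> (J e # map J es) * vol (e # es @ vs) = (-1) ^ k * (iprod (J e) \<xi> (map J es) * vol (es @ e # vs))"
      by (simp add: iprod_def mult.left_commute)
  qed
  also have "\<dots> = (-1) ^ k * fact k * (\<Sum>e\<in>Basis. iprod e (symplectic_star \<omega> n k (iprod (J e) \<xi>)) vs)"
    by (simp add: iprod_def[of _ "symplectic_star _ _ _ _"] star_eval[OF alternating_iprod[OF assms]]
        sum_distrib_left[symmetric] sum_divide_distrib[symmetric])
  finally show "symplectic_star \<omega> n (Suc k) \<xi> vs =
    (((-1) ^ k / real (Suc k)) *\<^sub>R (\<Sum>e\<in>Basis. iprod e (symplectic_star \<omega> n k (iprod (J e) \<xi>)))) vs"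
    unfolding star_eval[OF assms] fact_Suc by (simp del: of_nat_Suc)
qed

theorem symplectic_star_eq_star_sum:
  "alternating k \<xi> \<Longrightarrow> k < 2 * K \<Longrightarrow>
    symplectic_star \<omega> n k \<xi> = (star_sign k * fact n) *\<^sub>R pt.star_sum K (int n) (int k) \<xi>"
proof (induction k arbitrary: \<xi>)
  case 0
  have "symplectic_star \<omega> n 0 \<xi> = \<xi> [] *\<^sub>R vol"
  proof (rule ext)
    fix vs
    have "{es :: 'a list. set es \<subseteq> Basis \<and> length es = 0} = {[]}" by auto
    then show "symplectic_star \<omega> n 0 \<xi> vs = (\<xi> [] *\<^sub>R vol) vs"
      unfolding star_eval[OF 0(1)] by simp
  qed
  also have "\<dots> = (wedge \<omega> ^^ n) (\<xi> [] *\<^sub>R wedge_unit)"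
    by (simp only: wedge_power_eq linear_scale[OF pt.linear_L_pow])
  also have "\<dots> = (wedge \<omega> ^^ n) \<xi>" by (rule arg_cong[OF degree_0_eq[OF 0(1)], symmetric])
  also have "\<dots> = fact n *\<^sub>R pt.star_sum K (int n) 0 \<xi>"
    using star_sum_degree_0[OF 0(1), of K n] 0(2) by simp
  finally show ?case by (simp add: star_sign_def)
next
  case (Suc k)
  let ?c = "star_sign k * fact n"
  have "symplectic_star \<omega> n k (iprod (J e) \<xi>) = ?c *\<^sub>R pt.star_sum K (int n) (int k) (iprod (J e) \<xi>)" for e
    by (rule Suc.IH[OF alternating_iprod[OF Suc.prems(1)]]) (use Suc.prems(2) in simp)
  then have "symplectic_star \<omega> n (Suc k) \<xi> = ((-1) ^ k / real (Suc k)) *\<^sub>R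
      (\<Sum>e\<in>Basis. ?c *\<^sub>R iprod e (pt.star_sum K (int n) (int k) (iprod (J e) \<xi>)))"
    unfolding star_Suc[OF Suc.prems(1)] by (simp only: iprod_linear)
  also have "\<dots> = ((-1) ^ k * ?c) *\<^sub>R ((1 / real (Suc k)) *\<^sub>R
      (\<Sum>e\<in>Basis. iprod e (pt.star_sum K (int n) (int k) (iprod (J e) \<xi>))))"
    by (simp add: scaleR_sum_right[symmetric] del: of_nat_Suc)
  also have "\<dots> = ((-1) ^ k * ?c) *\<^sub>R pt.star_sum K (int n) (int (Suc k)) \<xi>"
    using star_sum_Suc[OF Suc.prems(1), of K "int n"] Suc.prems(2) by simp
  also have "(-1) ^ k * ?c = star_sign (Suc k) * fact n"
    by (simp add: star_sign_def)
  finally show ?case .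
qed

lemma vol_nonzero:
  assumes "distinct bs" "set bs = Basis"
  shows "vol bs \<noteq> 0"
proof
  assume z: "vol bs = 0"
  have "vol = 0"
  proof (rule alternating_eq_0I[OF alternating_wedge_power])
    fix es :: "'a list" assume es: "set es \<subseteq> Basis" "length es = 2 * n" "distinct es"
    then have "set es = Basis"
      using card_subset_eq[OF finite_Basis es(1)] dim distinct_card[OF es(3)] by simp
    then show "vol es = 0"
      using alternating_reorder[OF alternating_wedge_power assms(1) es(3) _ z] assms(2) by simp
  qed
  then have "(wedge \<omega> ^^ n) wedge_unit = 0" by (simp only: wedge_power_eq)
  moreover have "(wedge_unit :: 'a list \<Rightarrow> real) \<in> alt_space (int n - int n)"
    by (simp add: alt_space_def alternating_unit)
  ultimately have "(wedge_unit :: 'a list \<Rightarrow> real) = 0" using pt.L_pow_inj by blast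
  then have "wedge_unit ([] :: 'a list) = 0" by simp
  then show False by (simp add: wedge_unit_def)
qed

text \<open>
  Cramer's rule for the inverse of \<open>\<omega>\<close>: insert \<open>us\<close> into the identity
  \<open>\<iota>\<^bsub>J e\<^esub> \<omega>\<^sup>n = n (\<iota>\<^bsub>J e\<^esub>\<omega>) \<and> \<omega>\<^sup>n\<^sup>-\<^sup>1\<close>, in which \<open>\<iota>\<^bsub>J e\<^esub>\<omega>\<close> is a constant covector.  On the left only the
  component of \<open>J e\<close> along \<open>f\<close> contributes.
\<close>

lemma J_component:
  assumes "f \<in> Basis" "distinct us" "set us = Basis - {f}"
  shows "J e \<bullet> f = - (real n * wedge (covec e) (wedge_power \<omega> (n - 1)) us) / vol (f # us)"
proof -
  have "iprod (J e) vol us = - (real n * wedge (covec e) (wedge_power \<omega> (n - 1)) us)"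
    unfolding wedge_power_eq iprod_L_pow \<theta>_J by (simp add: pt.L_pow_simps)
  moreover have "iprod (J e) vol us = (\<Sum>g\<in>Basis. (J e \<bullet> g) * vol (g # us))"
  proof -
    have "vol (J e # us) = vol ((\<Sum>g\<in>Basis. (J e \<bullet> g) *\<^sub>R g) # us)" by (simp add: euclidean_representation)
    then show ?thesis
      using linear_sum[OF alternating_linear_Cons[OF alternating_wedge_power[of n], of us], of "\<lambda>g. (J e \<bullet> g) *\<^sub>R g" Basis]
        linear_scale[OF alternating_linear_Cons[OF alternating_wedge_power[of n], of us]] by (simp add: iprod_def)
  qed
  moreover have "(\<Sum>g\<in>Basis. (J e \<bullet> g) * vol (g # us)) = (\<Sum>g\<in>{f}. (J e \<bullet> g) * vol (g # us))"
    using assms alternating_not_distinct[OF alternating_wedge_power[of n]]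
    by (intro sum.mono_neutral_right) auto
  moreover have "vol (f # us) \<noteq> 0"
    using assms by (intro vol_nonzero) auto
  ultimately have "vol (f # us) \<noteq> 0"
    "(J e \<bullet> f) * vol (f # us) = - (real n * wedge (covec e) (wedge_power \<omega> (n - 1)) us)" by simp_all
  then show ?thesis using nonzero_eq_divide_eq by blast
qed

end

lemma wedge_map: "wedge \<alpha> \<beta> (map A vs) = wedge (\<lambda>us. \<alpha> (map A us)) (\<lambda>us. \<beta> (map A us)) vs"
  by (simp add: wedge_def nths_map)

text \<open>A linear isomorphism that pulls \<open>\<omega>\<close> back to \<open>\<omega>'\<close> maps one Poisson bivector to the other.\<close>

lemma poisson_map:
  fixes A :: "'a::euclidean_space \<Rightarrow> 'a"
  assumes \<omega>: "symplectic_space \<omega> n" and \<omega>': "symplectic_space \<omega>' n"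
    and A: "linear A" "surj A" and pull: "\<And>vs. \<omega>' vs = \<omega> (map A vs)" and \<xi>: "alternating k \<xi>"
  shows "poisson \<omega>' (\<lambda>vs. \<xi> (map A vs)) vs = poisson \<omega> \<xi> (map A vs)"
proof -
  interpret \<omega>: symplectic_space \<omega> n by (rule \<omega>)
  interpret \<omega>': symplectic_space \<omega>' n by (rule \<omega>')
  let ?q = "\<lambda>u w. \<xi> (u # w # map A vs)"
  have lin1: "linear (\<lambda>u. ?q u w)" for w
    by (rule alternating_linear_Cons[OF \<xi>])
  have lin2: "linear (\<lambda>w. ?q u w)" for u
    using alternating_linear_Cons[OF alternating_iprod_pred[OF \<xi>, of u], of "map A vs"] by (simp add: iprod_def)
  have J: "(\<Sum>e\<in>Basis. (A e \<bullet> f) *\<^sub>R A (\<omega>'.J e)) = \<omega>.J f" for f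
  proof (rule \<omega>.J_unique)
    fix y
    obtain z where y: "y = A z" using A(2) by (rule surjE)
    have "\<omega> [A z, A (\<omega>'.J e)] = e \<bullet> z" for e
      using pull[of "[z, \<omega>'.J e]"] \<omega>'.\<omega>_J[of z e] by simp
    then have "\<omega> [A z, (\<Sum>e\<in>Basis. (A e \<bullet> f) *\<^sub>R A (\<omega>'.J e))] = (\<Sum>e\<in>Basis. (A e \<bullet> f) * (e \<bullet> z))"
      by (simp add: linear_sum[OF \<omega>.linear_right] linear_scale[OF \<omega>.linear_right])
    also have "\<dots> = A (\<Sum>e\<in>Basis. (z \<bullet> e) *\<^sub>R e) \<bullet> f"
      by (simp add: linear_sum[OF A(1)] linear_scale[OF A(1)] inner_sum_left inner_sum_right inner_commute mult.commute)
    also have "\<dots> = A z \<bullet> f" by (simp only: euclidean_representation)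
    finally show "\<omega> [y, (\<Sum>e\<in>Basis. (A e \<bullet> f) *\<^sub>R A (\<omega>'.J e))] = f \<bullet> y"
      by (simp add: y inner_commute)
  qed
  have "(\<Sum>e\<in>Basis. ?q (A (\<omega>'.J e)) (A e)) = (\<Sum>e\<in>Basis. \<Sum>f\<in>Basis. (A e \<bullet> f) * ?q (A (\<omega>'.J e)) f)"
  proof (intro sum.cong refl)
    fix e
    have "?q (A (\<omega>'.J e)) (A e) = ?q (A (\<omega>'.J e)) (\<Sum>f\<in>Basis. (A e \<bullet> f) *\<^sub>R f)" by (simp add: euclidean_representation)
    then show "?q (A (\<omega>'.J e)) (A e) = (\<Sum>f\<in>Basis. (A e \<bullet> f) * ?q (A (\<omega>'.J e)) f)"
      by (simp add: linear_sum[OF lin2] linear_scale[OF lin2])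
  qed
  also have "\<dots> = (\<Sum>f\<in>Basis. \<Sum>e\<in>Basis. (A e \<bullet> f) * ?q (A (\<omega>'.J e)) f)" by (rule sum.swap)
  also have "\<dots> = (\<Sum>f\<in>Basis. ?q (\<Sum>e\<in>Basis. (A e \<bullet> f) *\<^sub>R A (\<omega>'.J e)) f)"
    by (simp add: linear_sum[OF lin1] linear_scale[OF lin1])
  also have "\<dots> = (\<Sum>f\<in>Basis. ?q (\<omega>.J f) f)" unfolding J ..
  finally show ?thesis by (simp add: poisson_def iprod_def)
qed

section \<open>Smooth functions\<close>

lemma frechet_derivative_unique: "(f has_derivative f') (at x) \<Longrightarrow> frechet_derivative f (at x) = f'"
  using frechet_derivative_at by metis

lemma frechet_derivative_cong:
  assumes "open S" "x \<in> S" "\<And>y. y \<in> S \<Longrightarrow> f y = g y" "f differentiable at x"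
  shows "g differentiable at x" "frechet_derivative g (at x) = frechet_derivative f (at x)"
proof -
  have "(f has_derivative frechet_derivative f (at x)) (at x)"
    using assms(4) by (simp add: frechet_derivative_works)
  then have "(g has_derivative frechet_derivative f (at x)) (at x)"
    by (rule has_derivative_transform_within_open[where f = f, OF _ assms(1,2)]) (use assms in auto)
  then show "g differentiable at x" "frechet_derivative g (at x) = frechet_derivative f (at x)"
    by (auto simp: differentiable_def frechet_derivative_unique)
qed

lemma frechet_derivative_eq_0:
  assumes "open S" "x \<in> S" "\<And>y. y \<in> S \<Longrightarrow> f y = 0"
  shows "frechet_derivative f (at x) v = 0"
  using frechet_derivative_cong(2)[OF assms(1,2), of "\<lambda>_. 0" f] assms(3) by simp

lemma frechet_derivative_linear: "f differentiable at x \<Longrightarrow> linear (frechet_derivative f (at x))"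
  using linear_frechet_derivative by blast

lemma frechet_derivative_add:
  assumes "f differentiable at x" "g differentiable at x"
  shows "frechet_derivative (\<lambda>x. f x + g x) (at x) v = frechet_derivative f (at x) v + frechet_derivative g (at x) v"
proof -
  have "((\<lambda>x. f x + g x) has_derivative (\<lambda>v. frechet_derivative f (at x) v + frechet_derivative g (at x) v)) (at x)"
    using assms by (intro has_derivative_add) (simp_all add: frechet_derivative_works)
  then show ?thesis by (simp add: frechet_derivative_unique)
qed

lemma frechet_derivative_mult:
  fixes f g :: "'a::euclidean_space \<Rightarrow> real"
  assumes "f differentiable at x" "g differentiable at x"
  shows "frechet_derivative (\<lambda>x. f x * g x) (at x) v =
    f x * frechet_derivative g (at x) v + frechet_derivative f (at x) v * g x"
proof -
  have "((\<lambda>x. f x * g x) has_derivative (\<lambda>v. f x * frechet_derivative g (at x) v + frechet_derivative f (at x) v * g x)) (at x)"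
    using assms by (intro has_derivative_mult) (simp_all add: frechet_derivative_works)
  then show ?thesis by (simp add: frechet_derivative_unique)
qed

lemma frechet_derivative_cmult:
  fixes f :: "'a::euclidean_space \<Rightarrow> real"
  assumes "f differentiable at x"
  shows "frechet_derivative (\<lambda>x. c * f x) (at x) v = c * frechet_derivative f (at x) v"
  using frechet_derivative_mult[of "\<lambda>_. c" x f v] assms by simp

lemma frechet_derivative_sum:
  assumes "\<And>i. i \<in> I \<Longrightarrow> f i differentiable at x"
  shows "frechet_derivative (\<lambda>x. \<Sum>i\<in>I. f i x) (at x) v = (\<Sum>i\<in>I. frechet_derivative (f i) (at x) v)"
proof -
  have "((\<lambda>x. \<Sum>i\<in>I. f i x) has_derivative (\<lambda>v. \<Sum>i\<in>I. frechet_derivative (f i) (at x) v)) (at x)"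
    using assms by (intro has_derivative_sum) (simp add: frechet_derivative_works)
  then show ?thesis by (simp add: frechet_derivative_unique)
qed

text \<open>The calculus of \<open>Ck_on\<close> is by induction on \<open>k\<close>, with the rules of differentiation in the step.\<close>

lemma Ck_on_cong:
  assumes "open S"
  shows "(\<And>x. x \<in> S \<Longrightarrow> f x = g x) \<Longrightarrow> Ck_on k S f \<Longrightarrow> Ck_on k S g"
proof (induction k arbitrary: f g)
  case 0
  then show ?case by (simp cong: continuous_on_cong)
next
  case (Suc k)
  have d: "f differentiable at x" if "x \<in> S" for x using Suc.prems(2) that by simp
  have "Ck_on k S (\<lambda>x. frechet_derivative g (at x) v)" for v
  proof (rule Suc.IH)
    show "Ck_on k S (\<lambda>x. frechet_derivative f (at x) v)" using Suc.prems(2) by simp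
    show "frechet_derivative f (at x) v = frechet_derivative g (at x) v" if "x \<in> S" for x
      using frechet_derivative_cong(2)[OF assms that Suc.prems(1) d[OF that]] by simp
  qed
  then show ?case
    using frechet_derivative_cong(1)[OF assms _ Suc.prems(1) d] by simp
qed

lemma Ck_on_pred: "Ck_on (Suc k) S f \<Longrightarrow> Ck_on k S f"
proof (induction k arbitrary: f)
  case 0
  then show ?case
    by (auto intro!: continuous_at_imp_continuous_on differentiable_imp_continuous_within)
next
  case (Suc k)
  have "\<And>v. Ck_on (Suc k) S (\<lambda>x. frechet_derivative f (at x) v)" and d: "\<forall>x\<in>S. f differentiable at x"
    using Suc.prems Ck_on.simps(2)[of "Suc k" S f] by blast+
  then have "\<And>v. Ck_on k S (\<lambda>x. frechet_derivative f (at x) v)" using Suc.IH by blast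
  then show ?case using d by simp
qed

lemma Ck_on_const: "Ck_on k S (\<lambda>_. c)"
  by (induction k arbitrary: c) (simp_all add: frechet_derivative_const)

lemma Ck_on_add:
  assumes "open S"
  shows "Ck_on k S f \<Longrightarrow> Ck_on k S g \<Longrightarrow> Ck_on k S (\<lambda>x. f x + g x)"
proof (induction k arbitrary: f g)
  case 0
  then show ?case by (simp add: continuous_on_add)
next
  case (Suc k)
  have "Ck_on k S (\<lambda>x. frechet_derivative (\<lambda>x. f x + g x) (at x) v)" for v
    by (rule Ck_on_cong[OF assms _ Suc.IH[of "\<lambda>x. frechet_derivative f (at x) v" "\<lambda>x. frechet_derivative g (at x) v"]])
       (use Suc.prems in \<open>simp_all add: frechet_derivative_add\<close>)
  then show ?case using Suc.prems by (simp add: differentiable_add)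
qed

lemma Ck_on_mult:
  fixes f g :: "'a::euclidean_space \<Rightarrow> real"
  assumes "open S"
  shows "Ck_on k S f \<Longrightarrow> Ck_on k S g \<Longrightarrow> Ck_on k S (\<lambda>x. f x * g x)"
proof (induction k arbitrary: f g)
  case 0
  then show ?case by (simp add: continuous_on_mult)
next
  case (Suc k)
  have "Ck_on k S (\<lambda>x. frechet_derivative (\<lambda>x. f x * g x) (at x) v)" for v
  proof (rule Ck_on_cong[OF assms])
    show "Ck_on k S (\<lambda>x. f x * frechet_derivative g (at x) v + frechet_derivative f (at x) v * g x)"
      using Suc.prems Ck_on_pred[OF Suc.prems(1)] Ck_on_pred[OF Suc.prems(2)]
      by (intro Ck_on_add[OF assms] Suc.IH) simp_all
  qed (use Suc.prems in \<open>simp add: frechet_derivative_mult\<close>)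
  then show ?case using Suc.prems by (simp add: differentiable_mult)
qed

lemma Ck_on_inverse:
  fixes f :: "'a::euclidean_space \<Rightarrow> real"
  assumes "open S" "\<And>x. x \<in> S \<Longrightarrow> f x \<noteq> 0"
  shows "Ck_on k S f \<Longrightarrow> Ck_on k S (\<lambda>x. inverse (f x))"
proof (induction k)
  case 0
  then show ?case using assms(2) by (simp add: continuous_on_inverse)
next
  case (Suc k)
  have inv: "Ck_on k S (\<lambda>x. inverse (f x))" using Suc Ck_on_pred by blast
  have der: "((\<lambda>x. inverse (f x)) has_derivative (\<lambda>v. - (inverse (f x) * frechet_derivative f (at x) v * inverse (f x)))) (at x)"
    if "x \<in> S" for x
    using Suc.prems that assms(2) by (intro Deriv.has_derivative_inverse) (simp_all add: frechet_derivative_works)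
  have "Ck_on k S (\<lambda>x. frechet_derivative (\<lambda>x. inverse (f x)) (at x) v)" for v
  proof (rule Ck_on_cong[OF assms(1)])
    show "Ck_on k S (\<lambda>x. - 1 * (inverse (f x) * frechet_derivative f (at x) v * inverse (f x)))"
      using Suc.prems by (intro Ck_on_mult[OF assms(1)] inv Ck_on_const) simp
  qed (simp add: frechet_derivative_unique[OF der])
  moreover have "\<forall>x\<in>S. (\<lambda>x. inverse (f x)) differentiable at x"
    using der by (auto simp: differentiable_def)
  ultimately show ?case by simp
qed

lemma smooth_on_differentiable: "smooth_on S f \<Longrightarrow> x \<in> S \<Longrightarrow> f differentiable at x"
  unfolding smooth_on_def by (metis Ck_on.simps(2))

lemma smooth_on_frechet_derivative: "smooth_on S f \<Longrightarrow> smooth_on S (\<lambda>x. frechet_derivative f (at x) v)"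
  unfolding smooth_on_def by (metis Ck_on.simps(2))

lemma smooth_on_cong: "open S \<Longrightarrow> smooth_on S f \<Longrightarrow> (\<And>x. x \<in> S \<Longrightarrow> f x = g x) \<Longrightarrow> smooth_on S g"
  unfolding smooth_on_def using Ck_on_cong by blast

lemma smooth_on_const: "smooth_on S (\<lambda>_. c)"
  by (simp add: smooth_on_def Ck_on_const)

lemma smooth_on_add: "open S \<Longrightarrow> smooth_on S f \<Longrightarrow> smooth_on S g \<Longrightarrow> smooth_on S (\<lambda>x. f x + g x)"
  by (simp add: smooth_on_def Ck_on_add)

lemma smooth_on_mult:
  fixes f g :: "'a::euclidean_space \<Rightarrow> real"
  shows "open S \<Longrightarrow> smooth_on S f \<Longrightarrow> smooth_on S g \<Longrightarrow> smooth_on S (\<lambda>x. f x * g x)"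
  by (simp add: smooth_on_def Ck_on_mult)

lemma smooth_on_cmult:
  fixes f :: "'a::euclidean_space \<Rightarrow> real"
  shows "open S \<Longrightarrow> smooth_on S f \<Longrightarrow> smooth_on S (\<lambda>x. c * f x)"
  by (rule smooth_on_mult[OF _ smooth_on_const])

lemma smooth_on_sum:
  "open S \<Longrightarrow> (\<And>i. i \<in> I \<Longrightarrow> smooth_on S (f i)) \<Longrightarrow> smooth_on S (\<lambda>x. \<Sum>i\<in>I. f i x)"
proof (induction I rule: infinite_finite_induct)
  case (insert i I)
  then show ?case using smooth_on_add[of S "f i" "\<lambda>x. \<Sum>i\<in>I. f i x"] by simp
qed (simp_all add: smooth_on_const)

lemma smooth_on_divide:
  fixes f g :: "'a::euclidean_space \<Rightarrow> real"
  shows "open S \<Longrightarrow> smooth_on S f \<Longrightarrow> smooth_on S g \<Longrightarrow> (\<And>x. x \<in> S \<Longrightarrow> g x \<noteq> 0) \<Longrightarrow> smooth_on S (\<lambda>x. f x / g x)"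
  unfolding divide_inverse
  by (rule smooth_on_mult) (simp_all add: smooth_on_def Ck_on_inverse)

lemma frechet_derivative_inner:
  assumes "f differentiable at x"
  shows "(\<lambda>x. f x \<bullet> e) differentiable at x"
    "frechet_derivative (\<lambda>x. f x \<bullet> e) (at x) v = frechet_derivative f (at x) v \<bullet> e"
proof -
  have "((\<lambda>x. f x \<bullet> e) has_derivative (\<lambda>v. frechet_derivative f (at x) v \<bullet> e)) (at x)"
    using assms by (intro has_derivative_inner_left) (simp add: frechet_derivative_works)
  then show "(\<lambda>x. f x \<bullet> e) differentiable at x"
    "frechet_derivative (\<lambda>x. f x \<bullet> e) (at x) v = frechet_derivative f (at x) v \<bullet> e"
    by (auto simp: differentiable_def frechet_derivative_unique)
qed

lemma Ck_on_inner:
  assumes "open S"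
  shows "Ck_on k S f \<Longrightarrow> Ck_on k S (\<lambda>x. f x \<bullet> e)"
proof (induction k arbitrary: f)
  case 0
  then show ?case by (simp add: continuous_on_inner)
next
  case (Suc k)
  have "Ck_on k S (\<lambda>x. frechet_derivative (\<lambda>x. f x \<bullet> e) (at x) v)" for v
    by (rule Ck_on_cong[OF assms _ Suc.IH[of "\<lambda>x. frechet_derivative f (at x) v"]])
       (use Suc.prems in \<open>simp_all add: frechet_derivative_inner\<close>)
  then show ?case using Suc.prems by (simp add: frechet_derivative_inner)
qed

subsection \<open>Symmetry of second derivatives\<close>

abbreviation second_derivative :: "('a::euclidean_space \<Rightarrow> 'b::real_normed_vector) \<Rightarrow> 'a \<Rightarrow> 'a \<Rightarrow> 'a \<Rightarrow> 'b" where
  "second_derivative f x u v \<equiv> frechet_derivative (\<lambda>y. frechet_derivative f (at y) u) (at x) v"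

lemma has_real_derivative_along_line:
  fixes f :: "'a::euclidean_space \<Rightarrow> real"
  assumes "f differentiable at (c + s *\<^sub>R u)"
  shows "((\<lambda>s. f (c + s *\<^sub>R u)) has_real_derivative frechet_derivative f (at (c + s *\<^sub>R u)) u) (at s)"
proof -
  let ?f' = "frechet_derivative f (at (c + s *\<^sub>R u))"
  have "((\<lambda>s. c + s *\<^sub>R u) has_derivative (\<lambda>h. h *\<^sub>R u)) (at s)"
    by (auto intro!: derivative_eq_intros)
  moreover have "(f has_derivative ?f') (at (c + s *\<^sub>R u))"
    using assms by (simp add: frechet_derivative_works)
  ultimately have "(f \<circ> (\<lambda>s. c + s *\<^sub>R u) has_derivative ?f' \<circ> (\<lambda>h. h *\<^sub>R u)) (at s)"
    by (rule diff_chain_at)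
  moreover have "?f' \<circ> (\<lambda>h. h *\<^sub>R u) = (*) (?f' u)"
    using linear_scale[OF frechet_derivative_linear[OF assms]] by (auto simp: o_def mult.commute)
  ultimately show ?thesis by (simp add: has_field_derivative_def o_def)
qed

text \<open>
  The mean value theorem in the direction \<open>u\<close>, followed by the mean value theorem in the direction
  \<open>v\<close>.  The left-hand side is symmetric in \<open>u\<close> and \<open>v\<close>.
\<close>

lemma second_difference:
  fixes f :: "'a::euclidean_space \<Rightarrow> real"
  assumes "Ck_on 2 S f" "h > 0" and S: "\<And>y. dist y x \<le> h * (norm u + norm v) \<Longrightarrow> y \<in> S"
  shows "\<exists>p. dist p x \<le> h * (norm u + norm v) \<and>
    f (x + h *\<^sub>R u + h *\<^sub>R v) - f (x + h *\<^sub>R u) - f (x + h *\<^sub>R v) + f x = h * h * second_derivative f p u v"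
proof -
  have d1: "f differentiable at y" and d2: "(\<lambda>y. frechet_derivative f (at y) u) differentiable at y" if "y \<in> S" for y
    using assms(1) that by (simp_all add: numeral_2_eq_2)
  have near: "dist (x + s *\<^sub>R u + t *\<^sub>R v) x \<le> h * (norm u + norm v)" if "0 \<le> s" "s \<le> h" "0 \<le> t" "t \<le> h" for s t
  proof -
    have "dist (x + s *\<^sub>R u + t *\<^sub>R v) x \<le> norm (s *\<^sub>R u) + norm (t *\<^sub>R v)"
      using norm_triangle_ineq[of "s *\<^sub>R u" "t *\<^sub>R v"] by (simp only: dist_norm add.assoc add_diff_cancel_left')
    also have "\<dots> \<le> h * norm u + h * norm v"
      using that by (intro add_mono) (auto intro: mult_right_mono)
    finally show ?thesis by (simp add: algebra_simps)
  qed
  let ?\<phi> = "\<lambda>s. f (x + h *\<^sub>R v + s *\<^sub>R u) - f (x + s *\<^sub>R u)"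
  have "\<exists>s>0. s < h \<and> ?\<phi> h - ?\<phi> 0 = (h - 0) *
      (frechet_derivative f (at (x + h *\<^sub>R v + s *\<^sub>R u)) u - frechet_derivative f (at (x + s *\<^sub>R u)) u)"
  proof (rule MVT2[OF assms(2)])
    fix s assume "0 \<le> s" "s \<le> h"
    then have "x + h *\<^sub>R v + s *\<^sub>R u \<in> S" "x + s *\<^sub>R u \<in> S"
      using S near[of s h] near[of s 0] assms(2) by (simp_all add: algebra_simps)
    then show "(?\<phi> has_real_derivative frechet_derivative f (at (x + h *\<^sub>R v + s *\<^sub>R u)) u - frechet_derivative f (at (x + s *\<^sub>R u)) u) (at s)"
      by (intro DERIV_diff has_real_derivative_along_line d1)
  qed
  then obtain s where s: "0 < s" "s < h" "?\<phi> h - ?\<phi> 0 = h *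
      (frechet_derivative f (at (x + h *\<^sub>R v + s *\<^sub>R u)) u - frechet_derivative f (at (x + s *\<^sub>R u)) u)"
    by auto
  let ?\<psi> = "\<lambda>t. frechet_derivative f (at (x + s *\<^sub>R u + t *\<^sub>R v)) u"
  have "\<exists>t>0. t < h \<and> ?\<psi> h - ?\<psi> 0 = (h - 0) * second_derivative f (x + s *\<^sub>R u + t *\<^sub>R v) u v"
  proof (rule MVT2[OF assms(2)])
    fix t assume "0 \<le> t" "t \<le> h"
    then have "x + s *\<^sub>R u + t *\<^sub>R v \<in> S" using S near[of s t] s by simp
    then show "(?\<psi> has_real_derivative second_derivative f (x + s *\<^sub>R u + t *\<^sub>R v) u v) (at t)"
      by (intro has_real_derivative_along_line d2)
  qed
  then obtain t where t: "0 < t" "t < h" "?\<psi> h - ?\<psi> 0 = h * second_derivative f (x + s *\<^sub>R u + t *\<^sub>R v) u v"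
    by auto
  have "f (x + h *\<^sub>R u + h *\<^sub>R v) - f (x + h *\<^sub>R u) - f (x + h *\<^sub>R v) + f x = ?\<phi> h - ?\<phi> 0"
    by (simp add: algebra_simps)
  also have "\<dots> = h * (?\<psi> h - ?\<psi> 0)"
    using s(3) by (simp add: algebra_simps)
  finally show ?thesis
    using t s near[of s t] by (intro exI[of _ "x + s *\<^sub>R u + t *\<^sub>R v"]) simp
qed

text \<open>
  Both derivatives at \<open>x\<close> are limits of the same second difference quotient, by the continuity of
  the second derivatives.
\<close>

lemma second_derivative_symmetric_real:
  fixes f :: "'a::euclidean_space \<Rightarrow> real"
  assumes "open S" "x \<in> S" "Ck_on 2 S f"
  shows "second_derivative f x u v = second_derivative f x v u"
proof (rule ccontr)
  assume ne: "second_derivative f x u v \<noteq> second_derivative f x v u"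
  define \<epsilon> where "\<epsilon> = \<bar>second_derivative f x u v - second_derivative f x v u\<bar> / 2"
  have "\<epsilon> > 0" using ne by (simp add: \<epsilon>_def)
  have "\<exists>\<delta>>0. \<forall>y. dist y x < \<delta> \<longrightarrow> y \<in> S \<and> \<bar>second_derivative f y a b - second_derivative f x a b\<bar> < \<epsilon>" for a b
  proof -
    have "continuous_on S (\<lambda>y. second_derivative f y a b)" using assms(3) by (simp add: numeral_2_eq_2)
    then obtain \<delta> where \<delta>: "\<delta> > 0" "\<forall>y\<in>S. dist y x < \<delta> \<longrightarrow> dist (second_derivative f y a b) (second_derivative f x a b) < \<epsilon>"
      using \<open>\<epsilon> > 0\<close> assms(2) unfolding continuous_on_iff by meson
    obtain r where "r > 0" "ball x r \<subseteq> S" using assms(1,2) openE by blast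
    then show ?thesis using \<delta> by (intro exI[of _ "min \<delta> r"]) (auto simp: dist_real_def dist_commute subset_iff)
  qed
  then obtain \<delta>1 \<delta>2 where \<delta>: "\<delta>1 > 0" "\<delta>2 > 0"
    "\<And>y. dist y x < \<delta>1 \<Longrightarrow> y \<in> S \<and> \<bar>second_derivative f y u v - second_derivative f x u v\<bar> < \<epsilon>"
    "\<And>y. dist y x < \<delta>2 \<Longrightarrow> y \<in> S \<and> \<bar>second_derivative f y v u - second_derivative f x v u\<bar> < \<epsilon>"
    by meson
  \<comment> \<open>The step is small enough for both points of \<open>second_difference\<close> to stay in the neighbourhoods; the
    summand 1 avoids a division by zero.\<close>
  define h where "h = min \<delta>1 \<delta>2 / (norm u + norm v + 1)"
  have pos: "norm u + norm v + 1 > 0" using norm_ge_zero[of u] norm_ge_zero[of v] by linarith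
  have h: "h > 0" using \<delta> pos by (simp add: h_def)
  have "h * (norm u + norm v) < h * (norm u + norm v + 1)" using h by simp
  also have "\<dots> = min \<delta>1 \<delta>2" using pos by (simp add: h_def)
  finally have small: "h * (norm u + norm v) < \<delta>1" "h * (norm u + norm v) < \<delta>2" by auto
  obtain p where p: "dist p x \<le> h * (norm u + norm v)"
      "f (x + h *\<^sub>R u + h *\<^sub>R v) - f (x + h *\<^sub>R u) - f (x + h *\<^sub>R v) + f x = h * h * second_derivative f p u v"
    using second_difference[OF assms(3) h, of x u v] \<delta>(3) small by force
  obtain q where q: "dist q x \<le> h * (norm v + norm u)"
      "f (x + h *\<^sub>R v + h *\<^sub>R u) - f (x + h *\<^sub>R v) - f (x + h *\<^sub>R u) + f x = h * h * second_derivative f q v u"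
    using second_difference[OF assms(3) h, of x v u] \<delta>(3) small by (force simp: add.commute)
  have "h * h * second_derivative f p u v = h * h * second_derivative f q v u"
    using p(2) q(2) by (simp add: algebra_simps)
  then have "second_derivative f p u v = second_derivative f q v u" using h by simp
  moreover have "\<bar>second_derivative f p u v - second_derivative f x u v\<bar> < \<epsilon>" using \<delta>(3) p(1) small by force
  moreover have "\<bar>second_derivative f q v u - second_derivative f x v u\<bar> < \<epsilon>" using \<delta>(4) q(1) small by (force simp: add.commute)
  ultimately show False by (simp add: \<epsilon>_def abs_if split: if_splits)
qed

lemma second_derivative_symmetric:
  fixes f :: "'a::euclidean_space \<Rightarrow> 'b::euclidean_space"
  assumes "open S" "x \<in> S" "smooth_on S f"
  shows "second_derivative f x u v = second_derivative f x v u"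
proof (rule euclidean_eqI)
  fix e :: 'b
  have d: "f differentiable at y" if "y \<in> S" for y using smooth_on_differentiable assms(3) that by blast
  have dd: "(\<lambda>y. frechet_derivative f (at y) a) differentiable at x" for a
    using smooth_on_differentiable smooth_on_frechet_derivative assms(2,3) by blast
  have "second_derivative (\<lambda>y. f y \<bullet> e) x a b = second_derivative f x a b \<bullet> e" for a b
  proof -
    have "second_derivative (\<lambda>y. f y \<bullet> e) x a b = frechet_derivative (\<lambda>y. frechet_derivative f (at y) a \<bullet> e) (at x) b"
      using frechet_derivative_cong(2)[OF assms(1,2) _ frechet_derivative_inner(1)[OF dd[of a]], of e "\<lambda>y. frechet_derivative (\<lambda>y. f y \<bullet> e) (at y) a"]
        frechet_derivative_inner(2)[OF d] by metis
    then show ?thesis using frechet_derivative_inner(2)[OF dd] by simp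
  qed
  moreover have "Ck_on 2 S (\<lambda>y. f y \<bullet> e)"
    using Ck_on_inner[OF assms(1), of 2 f e] assms(3) unfolding smooth_on_def by blast
  ultimately show "second_derivative f x u v \<bullet> e = second_derivative f x v u \<bullet> e"
    using second_derivative_symmetric_real[OF assms(1,2), of "\<lambda>y. f y \<bullet> e" u v] by simp
qed

section \<open>The exterior derivative\<close>

text \<open>
  The identities of \<open>d\<close> are proved by inductions that pass from \<open>\<eta>\<close> to \<open>D\<^sub>v\<eta>\<close>, \<open>\<iota>\<^sub>v\<eta>\<close> and products and
  twists of these.  Smoothness of the components is preserved by all these operations.
\<close>

definition smooth_components :: "'a::euclidean_space set \<Rightarrow> ('a \<Rightarrow> 'a list \<Rightarrow> real) \<Rightarrow> bool" where
  "smooth_components V \<eta> \<longleftrightarrow> (\<forall>vs. smooth_on V (\<lambda>x. \<eta> x vs))"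

definition dir_deriv :: "'a::euclidean_space \<Rightarrow> ('a \<Rightarrow> 'a list \<Rightarrow> real) \<Rightarrow> 'a \<Rightarrow> 'a list \<Rightarrow> real" where
  "dir_deriv v \<eta> x vs = frechet_derivative (\<lambda>y. \<eta> y vs) (at x) v"

lemma ext_deriv_eq_alt_insert: "ext_deriv \<eta> x = alt_insert (\<lambda>u us. dir_deriv u \<eta> x us)"
  by (rule ext) (simp add: ext_deriv_def alt_insert_def dir_deriv_def)

lemma ext_deriv_Nil [simp]: "ext_deriv \<eta> x [] = 0"
  by (simp add: ext_deriv_def)

text \<open>Cartan's formula for a constant vector field \<open>v\<close>.\<close>

lemma ext_deriv_Cons: "ext_deriv \<eta> x (v # vs) = dir_deriv v \<eta> x vs - ext_deriv (\<lambda>y. iprod v (\<eta> y)) x vs"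
  unfolding ext_deriv_eq_alt_insert alt_insert_Cons by (simp add: dir_deriv_def[abs_def] iprod_def[abs_def])

lemma iprod_ext_deriv: "iprod v (ext_deriv \<eta> x) = dir_deriv v \<eta> x - ext_deriv (\<lambda>y. iprod v (\<eta> y)) x"
  by (rule ext) (simp add: iprod_def[of v "ext_deriv \<eta> x"] ext_deriv_Cons)

lemma smooth_componentsD:
  "smooth_components V \<eta> \<Longrightarrow> smooth_on V (\<lambda>x. \<eta> x vs)"
  "smooth_components V \<eta> \<Longrightarrow> x \<in> V \<Longrightarrow> (\<lambda>x. \<eta> x vs) differentiable at x"
  by (auto simp: smooth_components_def intro: smooth_on_differentiable)

lemma smooth_components_iprod: "smooth_components V \<eta> \<Longrightarrow> smooth_components V (\<lambda>x. iprod v (\<eta> x))"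
  by (simp add: smooth_components_def iprod_def)

lemma smooth_components_dir_deriv: "smooth_components V \<eta> \<Longrightarrow> smooth_components V (dir_deriv v \<eta>)"
  by (simp add: smooth_components_def dir_deriv_def smooth_on_frechet_derivative)

lemma smooth_components_twist: "open V \<Longrightarrow> smooth_components V \<eta> \<Longrightarrow> smooth_components V (\<lambda>x. twist (\<eta> x))"
  by (simp add: smooth_components_def twist_def smooth_on_cmult)

lemma smooth_components_wedge:
  "open V \<Longrightarrow> smooth_components V \<alpha> \<Longrightarrow> smooth_components V \<beta> \<Longrightarrow> smooth_components V (\<lambda>x. wedge (\<alpha> x) (\<beta> x))"
  unfolding smooth_components_def wedge_def by (intro allI smooth_on_sum smooth_on_mult smooth_on_const) auto

lemma smooth_components_ext_deriv:
  "open V \<Longrightarrow> smooth_components V \<eta> \<Longrightarrow> smooth_components V (ext_deriv \<eta>)"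
  unfolding smooth_components_def ext_deriv_def
  by (intro allI smooth_on_sum smooth_on_cmult smooth_on_frechet_derivative) auto

lemma ext_deriv_cong:
  assumes "open V" "x \<in> V" "\<And>y. y \<in> V \<Longrightarrow> \<eta> y = \<zeta> y" "smooth_components V \<eta>"
  shows "ext_deriv \<eta> x = ext_deriv \<zeta> x"
proof -
  have "frechet_derivative (\<lambda>y. \<zeta> y us) (at x) = frechet_derivative (\<lambda>y. \<eta> y us) (at x)" for us
    by (rule frechet_derivative_cong(2)[OF assms(1,2)]) (use assms smooth_componentsD(2) in auto)
  then show ?thesis by (simp add: ext_deriv_def fun_eq_iff)
qed

lemma ext_deriv_add:
  assumes "smooth_components V \<eta>" "smooth_components V \<zeta>" "x \<in> V"
  shows "ext_deriv (\<lambda>y. \<eta> y + \<zeta> y) x = ext_deriv \<eta> x + ext_deriv \<zeta> x"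
  using smooth_componentsD(2)[OF assms(1,3)] smooth_componentsD(2)[OF assms(2,3)]
  by (intro ext) (simp add: ext_deriv_def frechet_derivative_add distrib_left sum.distrib)

lemma ext_deriv_scale:
  assumes "smooth_components V \<eta>" "x \<in> V"
  shows "ext_deriv (\<lambda>y. r *\<^sub>R \<eta> y) x = r *\<^sub>R ext_deriv \<eta> x"
  using smooth_componentsD(2)[OF assms]
  by (intro ext) (simp add: ext_deriv_def frechet_derivative_cmult sum_distrib_left mult.left_commute)

lemma ext_deriv_diff:
  assumes "open V" "smooth_components V \<eta>" "smooth_components V \<zeta>" "x \<in> V"
  shows "ext_deriv (\<lambda>y. \<eta> y - \<zeta> y) x = ext_deriv \<eta> x - ext_deriv \<zeta> x"
proof -
  have "smooth_components V (\<lambda>y. -1 *\<^sub>R \<zeta> y)"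
    using assms(1,3) smooth_on_cmult[of V _ "-1"] unfolding smooth_components_def by (simp only: scaleR_fun_apply real_scaleR_def) blast
  from ext_deriv_add[OF assms(2) this assms(4)] show ?thesis
    using ext_deriv_scale[OF assms(3,4), of "-1"] by simp
qed

lemma ext_deriv_twist:
  assumes "smooth_components V \<eta>" "x \<in> V"
  shows "ext_deriv (\<lambda>y. twist (\<eta> y)) x = - twist (ext_deriv \<eta> x)"
proof (rule ext)
  fix vs
  have "frechet_derivative (\<lambda>y. c * \<eta> y us) (at x) u = c * frechet_derivative (\<lambda>y. \<eta> y us) (at x) u" for c us u
    by (rule frechet_derivative_cmult[OF smooth_componentsD(2)[OF assms]])
  then have "ext_deriv (\<lambda>y. twist (\<eta> y)) x vs = (\<Sum>i<length vs. (-1) ^ i * ((-1) ^ (length vs - 1) *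
      frechet_derivative (\<lambda>y. \<eta> y (take i vs @ drop (Suc i) vs)) (at x) (vs ! i)))"
    unfolding ext_deriv_def twist_def by (intro sum.cong refl) auto
  also have "\<dots> = (- twist (ext_deriv \<eta> x)) vs"
  proof (cases vs)
    case (Cons v us)
    then show ?thesis
      by (simp add: ext_deriv_def twist_def sum_distrib_left sum_negf mult.left_commute del: sum.lessThan_Suc)
  qed (simp add: twist_def)
  finally show "ext_deriv (\<lambda>y. twist (\<eta> y)) x vs = (- twist (ext_deriv \<eta> x)) vs" .
qed

lemma dir_deriv_ext_deriv:
  assumes "open V" "x \<in> V" "smooth_components V \<eta>"
  shows "dir_deriv v (ext_deriv \<eta>) x = ext_deriv (dir_deriv v \<eta>) x"
proof (rule ext)
  fix vs
  have d: "(\<lambda>y. frechet_derivative (\<lambda>y. \<eta> y us) (at y) u) differentiable at x" for us u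
    using smooth_componentsD(1)[OF assms(3)] smooth_on_frechet_derivative smooth_on_differentiable assms(2) by blast
  have "dir_deriv v (ext_deriv \<eta>) x vs = (\<Sum>i<length vs. (-1) ^ i *
      second_derivative (\<lambda>y. \<eta> y (take i vs @ drop (Suc i) vs)) x (vs ! i) v)"
    unfolding dir_deriv_def ext_deriv_def using d
    by (simp add: frechet_derivative_sum frechet_derivative_cmult differentiable_mult)
  also have "\<dots> = ext_deriv (dir_deriv v \<eta>) x vs"
    unfolding ext_deriv_def dir_deriv_def
    using second_derivative_symmetric[OF assms(1,2) smooth_componentsD(1)[OF assms(3)]] by metis
  finally show "dir_deriv v (ext_deriv \<eta>) x vs = ext_deriv (dir_deriv v \<eta>) x vs" .
qed

text \<open>
  By \<open>ext_deriv_Cons\<close>, \<open>\<iota>\<^sub>v d d = D\<^sub>v d - d D\<^sub>v + d d \<iota>\<^sub>v\<close>.  The first two terms cancel by the symmetry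
  of second derivatives.
\<close>

lemma ext_deriv_ext_deriv:
  assumes V: "open V" "x \<in> V" and "smooth_components V \<eta>"
  shows "ext_deriv (ext_deriv \<eta>) x = 0"
proof (rule ext)
  fix vs
  show "ext_deriv (ext_deriv \<eta>) x vs = 0 vs"
    using assms(3)
  proof (induction vs arbitrary: \<eta>)
    case (Cons v vs)
    note sm = smooth_components_iprod[OF Cons.prems, of v]
    have "ext_deriv (\<lambda>y. iprod v (ext_deriv \<eta> y)) x =
        ext_deriv (dir_deriv v \<eta>) x - ext_deriv (ext_deriv (\<lambda>y. iprod v (\<eta> y))) x"
      unfolding iprod_ext_deriv
      by (rule ext_deriv_diff[OF V(1) smooth_components_dir_deriv[OF Cons.prems] smooth_components_ext_deriv[OF V(1) sm] V(2)])
    then have "ext_deriv (ext_deriv \<eta>) x (v # vs) = ext_deriv (ext_deriv (\<lambda>y. iprod v (\<eta> y))) x vs"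
      unfolding ext_deriv_Cons[of "ext_deriv \<eta>"] dir_deriv_ext_deriv[OF V Cons.prems] by (simp only: minus_apply diff_diff_eq2 add_diff_cancel_left')
    then show ?case using Cons.IH[OF sm] by simp
  qed simp
qed

lemma dir_deriv_wedge:
  assumes "smooth_components V \<alpha>" "smooth_components V \<beta>" "x \<in> V"
  shows "dir_deriv v (\<lambda>y. wedge (\<alpha> y) (\<beta> y)) x = wedge (dir_deriv v \<alpha> x) (\<beta> x) + wedge (\<alpha> x) (dir_deriv v \<beta> x)"
proof (rule ext)
  fix vs
  note d = smooth_componentsD(2)[OF assms(1,3)] smooth_componentsD(2)[OF assms(2,3)]
  show "dir_deriv v (\<lambda>y. wedge (\<alpha> y) (\<beta> y)) x vs = (wedge (dir_deriv v \<alpha> x) (\<beta> x) + wedge (\<alpha> x) (dir_deriv v \<beta> x)) vs"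
    unfolding dir_deriv_def wedge_def plus_fun_apply sum.distrib[symmetric]
    using d by (simp add: frechet_derivative_sum frechet_derivative_cmult frechet_derivative_mult
        differentiable_mult mult.assoc algebra_simps)
qed

text \<open>
  Both sides satisfy the same recursion under the insertion of a vector, by \<open>iprod_wedge\<close>,
  \<open>iprod_ext_deriv\<close> and the product rule for \<open>D\<^sub>v\<close>.
\<close>

lemma ext_deriv_wedge:
  assumes V: "open V" "x \<in> V" and "smooth_components V \<alpha>" "smooth_components V \<beta>"
  shows "ext_deriv (\<lambda>y. wedge (\<alpha> y) (\<beta> y)) x = wedge (ext_deriv \<alpha> x) (\<beta> x) + wedge (twist (\<alpha> x)) (ext_deriv \<beta> x)"
proof (rule ext)
  fix vs
  show "ext_deriv (\<lambda>y. wedge (\<alpha> y) (\<beta> y)) x vs = (wedge (ext_deriv \<alpha> x) (\<beta> x) + wedge (twist (\<alpha> x)) (ext_deriv \<beta> x)) vs"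
    using assms(3,4)
  proof (induction vs arbitrary: \<alpha> \<beta>)
    case (Cons v vs)
    note sm = smooth_components_iprod[OF Cons.prems(1), of v] smooth_components_iprod[OF Cons.prems(2), of v]
      smooth_components_twist[OF V(1) Cons.prems(1)]
    let ?i = "iprod v" and ?D = "dir_deriv v"
    have "ext_deriv (\<lambda>y. ?i (wedge (\<alpha> y) (\<beta> y))) x =
        ext_deriv (\<lambda>y. wedge (?i (\<alpha> y)) (\<beta> y)) x + ext_deriv (\<lambda>y. wedge (twist (\<alpha> y)) (?i (\<beta> y))) x"
      unfolding iprod_wedge
      by (rule ext_deriv_add[OF smooth_components_wedge[OF V(1) sm(1) Cons.prems(2)] smooth_components_wedge[OF V(1) sm(3,2)] V(2)])
    then have 1: "ext_deriv (\<lambda>y. ?i (wedge (\<alpha> y) (\<beta> y))) x vs =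
        (wedge (ext_deriv (\<lambda>y. ?i (\<alpha> y)) x) (\<beta> x) + wedge (twist (?i (\<alpha> x))) (ext_deriv \<beta> x) +
         (wedge (ext_deriv (\<lambda>y. twist (\<alpha> y)) x) (?i (\<beta> x)) + wedge (twist (twist (\<alpha> x))) (ext_deriv (\<lambda>y. ?i (\<beta> y)) x))) vs"
      unfolding plus_fun_apply by (simp only: Cons.IH[OF sm(1) Cons.prems(2)] Cons.IH[OF sm(3,2)] plus_fun_apply)
    have 2: "(wedge (ext_deriv \<alpha> x) (\<beta> x) + wedge (twist (\<alpha> x)) (ext_deriv \<beta> x)) (v # vs) =
        (wedge (?i (ext_deriv \<alpha> x)) (\<beta> x) + wedge (twist (ext_deriv \<alpha> x)) (?i (\<beta> x)) +
         (wedge (?i (twist (\<alpha> x))) (ext_deriv \<beta> x) + wedge (twist (twist (\<alpha> x))) (?i (ext_deriv \<beta> x)))) vs"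
      by (simp add: wedge_Cons)
    show ?case
      unfolding ext_deriv_Cons dir_deriv_wedge[OF Cons.prems V(2)] 1 2 iprod_ext_deriv ext_deriv_twist[OF Cons.prems(1) V(2)]
        iprod_twist twist_twist wedge_linear
      by (simp add: algebra_simps)
  qed (simp add: twist_def)
qed

subsection \<open>The derivative of a form is a form\<close>

lemma smooth_form_components: "smooth_form V k \<eta> \<Longrightarrow> smooth_components V \<eta>"
  by (simp add: smooth_form_def smooth_components_def)

lemma smooth_form_alternating: "smooth_form V k \<eta> \<Longrightarrow> x \<in> V \<Longrightarrow> alternating k (\<eta> x)"
  by (simp add: smooth_form_def)

lemma smooth_form_iprod: "smooth_form V (Suc k) \<eta> \<Longrightarrow> smooth_form V k (\<lambda>x. iprod v (\<eta> x))"
  using smooth_components_iprod[of V \<eta> v] by (auto simp: smooth_form_def smooth_components_def alternating_iprod)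

lemma ext_deriv_eq_0: 
  assumes "open V" "x \<in> V" "\<And>y. y \<in> V \<Longrightarrow> \<eta> y = 0"
  shows "ext_deriv \<eta> x = 0"
  by (rule ext) (use assms in \<open>simp add: ext_deriv_def frechet_derivative_eq_0[OF assms(1,2)]\<close>)

lemma linear_cmult: "linear f \<Longrightarrow> linear (\<lambda>v. c * f v :: real)"
  using linear_compose_scale_right[of f c] by simp

lemma frechet_derivative_linear_family:
  fixes F :: "'b::real_vector \<Rightarrow> 'a::euclidean_space \<Rightarrow> real"
  assumes "open V" "x \<in> V" "\<And>y. y \<in> V \<Longrightarrow> linear (\<lambda>v. F v y)" "\<And>v. F v differentiable at x"
  shows "linear (\<lambda>v. frechet_derivative (F v) (at x) w)"
proof (rule linearI)
  fix u v :: 'b and r :: real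
  have "frechet_derivative (F (u + v)) (at x) = frechet_derivative (\<lambda>y. F u y + F v y) (at x)"
    by (rule frechet_derivative_cong(2)[OF assms(1,2)])
       (use assms(4) in \<open>auto simp: linear_add[OF assms(3)] intro: differentiable_add\<close>)
  then show "frechet_derivative (F (u + v)) (at x) w = frechet_derivative (F u) (at x) w + frechet_derivative (F v) (at x) w"
    by (simp add: frechet_derivative_add assms(4))
  have "frechet_derivative (F (r *\<^sub>R u)) (at x) = frechet_derivative (\<lambda>y. r * F u y) (at x)"
    by (rule frechet_derivative_cong(2)[OF assms(1,2)])
       (use assms(4) in \<open>auto simp: linear_scale[OF assms(3)] intro: differentiable_mult\<close>)
  then show "frechet_derivative (F (r *\<^sub>R u)) (at x) w = r *\<^sub>R frechet_derivative (F u) (at x) w"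
    by (simp add: frechet_derivative_cmult assms(4))
qed

lemma alternating_dir_deriv:
  assumes V: "open V" "x \<in> V" and \<eta>: "smooth_form V k \<eta>"
  shows "alternating k (dir_deriv w \<eta> x)"
  unfolding alternating_def dir_deriv_def
proof (intro conjI allI impI)
  fix vs :: "'a list" assume len: "length vs \<noteq> k"
  show "frechet_derivative (\<lambda>y. \<eta> y vs) (at x) w = 0"
    by (rule frechet_derivative_eq_0[OF V]) (rule alternating_length[OF smooth_form_alternating[OF \<eta>] len])
next
  fix vs :: "'a list" and i assume "length vs = k" "i < k"
  then show "linear (\<lambda>v. frechet_derivative (\<lambda>y. \<eta> y (vs[i := v])) (at x) w)"
    using smooth_form_alternating[OF \<eta>] smooth_componentsD(2)[OF smooth_form_components[OF \<eta>] V(2)]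
    by (intro frechet_derivative_linear_family[OF V]) (auto simp: alternating_def)
next
  fix vs :: "'a list" and i j assume rep: "length vs = k" "i < j" "j < k" "vs ! i = vs ! j"
  show "frechet_derivative (\<lambda>y. \<eta> y vs) (at x) w = 0"
    by (rule frechet_derivative_eq_0[OF V]) (rule alternating_repeat[OF smooth_form_alternating[OF \<eta>] rep])
qed

text \<open>
  The induction is on the degree: \<open>\<iota>\<^sub>v d\<eta> = D\<^sub>v\<eta> - d\<iota>\<^sub>v\<eta>\<close> is alternating if \<open>d\<iota>\<^sub>v\<eta>\<close> is.
\<close>

lemma alternating_ext_deriv:
  assumes V: "open V" "x \<in> V"
    and "smooth_form V k \<eta>"
  shows "alternating (Suc k) (ext_deriv \<eta> x)"
proof -
  have step: "alternating (Suc k) (ext_deriv \<eta> x)"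
    if \<eta>: "smooth_form V k \<eta>" and alt: "\<And>v. alternating k (ext_deriv (\<lambda>y. iprod v (\<eta> y)) x)" for k \<eta>
  proof (rule alternatingI)
    note d = smooth_componentsD(2)[OF smooth_form_components[OF \<eta>] V(2)]
    show "ext_deriv \<eta> x vs = 0" if "length vs \<noteq> Suc k" for vs
      unfolding ext_deriv_def
    proof (rule sum.neutral, intro ballI)
      fix i assume "i \<in> {..<length vs}"
      then have len: "length (take i vs @ drop (Suc i) vs) \<noteq> k" using that by auto
      have "frechet_derivative (\<lambda>y. \<eta> y (take i vs @ drop (Suc i) vs)) (at x) (vs ! i) = 0"
        by (rule frechet_derivative_eq_0[OF V]) (rule alternating_length[OF smooth_form_alternating[OF \<eta>] len])
      then show "(-1) ^ i * frechet_derivative (\<lambda>y. \<eta> y (take i vs @ drop (Suc i) vs)) (at x) (vs ! i) = 0" by simp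
    qed
    show "alternating l (iprod v (ext_deriv \<eta> x))" if "Suc k = Suc l" for v l
      unfolding iprod_ext_deriv using that alt alternating_dir_deriv[OF V \<eta>] by (auto intro: alternating_diff)
    show "linear (\<lambda>v. ext_deriv \<eta> x (v # vs))" for vs
      unfolding ext_deriv_Cons
    proof (rule linear_compose_sub)
      show "linear (\<lambda>v. dir_deriv v \<eta> x vs)"
        unfolding dir_deriv_def by (rule frechet_derivative_linear[OF d])
      have "linear (\<lambda>v. frechet_derivative (\<lambda>y. \<eta> y (v # us)) (at x) u)" for us u
        using alternating_linear_Cons[OF smooth_form_alternating[OF \<eta>]] d
        by (intro frechet_derivative_linear_family[OF V]) auto
      then show "linear (\<lambda>v. ext_deriv (\<lambda>y. iprod v (\<eta> y)) x vs)"
        unfolding ext_deriv_def iprod_def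
        by (intro linear_compose_sum ballI linear_cmult)
    qed
    show "ext_deriv \<eta> x (v # v # vs) = 0" for v vs
    proof -
      have "ext_deriv (\<lambda>y. iprod v (iprod v (\<eta> y))) x = 0"
        by (rule ext_deriv_eq_0[OF V]) (rule iprod_iprod_same[OF smooth_form_alternating[OF \<eta>]])
      then show ?thesis
        by (simp add: ext_deriv_Cons) (simp add: dir_deriv_def iprod_def)
    qed
  qed
  show ?thesis
    using assms(3)
  proof (induction k arbitrary: \<eta>)
    case 0
    have "ext_deriv (\<lambda>y. iprod v (\<eta> y)) x = 0" for v
      by (rule ext_deriv_eq_0[OF V]) (rule iprod_degree_0[OF smooth_form_alternating[OF 0]])
    then show ?case by (intro step[OF 0]) (simp add: alternating_zero)
  next
    case (Suc k)
    show ?case by (rule step[OF Suc.prems Suc.IH[OF smooth_form_iprod[OF Suc.prems]]])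
  qed
qed

lemma smooth_form_ext_deriv:
  "open V \<Longrightarrow> smooth_form V k \<eta> \<Longrightarrow> smooth_form V (Suc k) (ext_deriv \<eta>)"
  using smooth_components_ext_deriv[OF _ smooth_form_components, of V k \<eta>] alternating_ext_deriv[of V _ k \<eta>]
  by (simp add: smooth_form_def smooth_components_def)

subsection \<open>Naturality\<close>

lemma smooth_form_iprod_pred: "smooth_form V k \<eta> \<Longrightarrow> smooth_form V (k - 1) (\<lambda>x. iprod v (\<eta> x))"
  using smooth_components_iprod[of V \<eta> v] by (auto simp: smooth_form_def smooth_components_def alternating_iprod_pred[unfolded One_nat_def])

lemma linear_basis_expansion:
  fixes f :: "'a::euclidean_space \<Rightarrow> real"
  assumes "linear f"
  shows "(\<Sum>e\<in>Basis. (v \<bullet> e) * f e) = f v"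
proof -
  have "f v = f (\<Sum>e\<in>Basis. (v \<bullet> e) *\<^sub>R e)" by (simp only: euclidean_representation)
  then show ?thesis by (simp only: linear_sum[OF assms] linear_scale[OF assms] real_scaleR_def)
qed

text \<open>
  The product rule for \<open>y \<mapsto> \<eta>\<^bsub>g(y)\<^esub>(W\<^sub>y u\<^sub>1, \<dots>, W\<^sub>y u\<^sub>k)\<close>, where \<open>B u\<close> is the derivative of \<open>y \<mapsto> W\<^sub>y u\<close>.  The
  induction expands the first argument in the standard basis, so that only products of two
  functions have to be differentiated.
\<close>

lemma has_derivative_form_along:
  fixes g :: "'a::euclidean_space \<Rightarrow> 'a"
  assumes V: "open V" "x \<in> V" and V': "open V'" "\<And>y. y \<in> V \<Longrightarrow> g y \<in> V'"
    and g: "(g has_derivative g') (at x)" and W: "\<And>u. ((\<lambda>y. W y u) has_derivative B u) (at x)"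
    and "smooth_form V' k \<eta>"
  shows "((\<lambda>y. \<eta> (g y) (map (W y) us)) has_derivative
    (\<lambda>h. frechet_derivative (\<lambda>z. \<eta> z (map (W x) us)) (at (g x)) (g' h) +
      (\<Sum>j<length us. \<eta> (g x) ((map (W x) us)[j := B (us ! j) h])))) (at x)"
  using assms(7)
proof (induction us arbitrary: k \<eta>)
  case Nil
  have "(\<lambda>z. \<eta> z []) differentiable at (g x)"
    using smooth_componentsD(2)[OF smooth_form_components[OF Nil]] V V' by blast
  then have "((\<lambda>z. \<eta> z []) has_derivative frechet_derivative (\<lambda>z. \<eta> z []) (at (g x))) (at (g x))"
    by (simp add: frechet_derivative_works)
  from has_derivative_compose[OF g this] show ?case by simp
next
  case (Cons u us)
  let ?r = "map (W x) us"
  note alt = smooth_form_alternating[OF Cons.prems]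
  have gx: "g x \<in> V'" using V V' by blast
  have D: "(\<lambda>z. \<eta> z ws) differentiable at (g x)" for ws
    using smooth_componentsD(2)[OF smooth_form_components[OF Cons.prems] gx] .
  have lin: "linear (\<lambda>v. \<eta> (g y) (v # ws))" if "y \<in> V" for y ws
    by (rule alternating_linear_Cons[OF alt[OF V'(2)[OF that]]])
  have linD: "linear (\<lambda>v. frechet_derivative (\<lambda>z. \<eta> z (v # ws)) (at (g x)) w)" for ws w
    by (rule frechet_derivative_linear_family[OF V'(1) gx alternating_linear_Cons[OF alt] D])
  let ?d = "\<lambda>e h. frechet_derivative (\<lambda>z. \<eta> z (e # ?r)) (at (g x)) (g' h) +
      (\<Sum>j<length us. \<eta> (g x) (e # ?r[j := B (us ! j) h]))"
  have IH: "((\<lambda>y. \<eta> (g y) (e # map (W y) us)) has_derivative ?d e) (at x)" for e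
    using Cons.IH[OF smooth_form_iprod_pred[OF Cons.prems, of e]] by (simp add: iprod_def)
  have "((\<lambda>y. \<Sum>e\<in>Basis. (W y u \<bullet> e) * \<eta> (g y) (e # map (W y) us)) has_derivative
      (\<lambda>h. \<Sum>e\<in>Basis. (W x u \<bullet> e) * ?d e h + (B u h \<bullet> e) * \<eta> (g x) (e # ?r))) (at x)"
    by (intro has_derivative_sum has_derivative_mult has_derivative_inner_left W IH)
  then have "((\<lambda>y. \<eta> (g y) (map (W y) (u # us))) has_derivative
      (\<lambda>h. \<Sum>e\<in>Basis. (W x u \<bullet> e) * ?d e h + (B u h \<bullet> e) * \<eta> (g x) (e # ?r))) (at x)"
    by (rule has_derivative_transform_within_open[OF _ V]) (simp add: linear_basis_expansion[OF lin])
  moreover have "(\<Sum>e\<in>Basis. (W x u \<bullet> e) * ?d e h + (B u h \<bullet> e) * \<eta> (g x) (e # ?r)) =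
      frechet_derivative (\<lambda>z. \<eta> z (map (W x) (u # us))) (at (g x)) (g' h) +
      (\<Sum>j<length (u # us). \<eta> (g x) ((map (W x) (u # us))[j := B ((u # us) ! j) h]))" for h
  proof -
    have 1: "linear (\<lambda>e. ?d e h)"
      by (intro linear_compose_add linear_compose_sum ballI linD lin V)
    show ?thesis
      unfolding sum.distrib linear_basis_expansion[OF 1] linear_basis_expansion[OF lin[OF V(2)]]
      by (simp add: sum.lessThan_Suc_shift del: sum.lessThan_Suc)
  qed
  ultimately show ?case by (simp only:)
qed

lemma alt_insert_diff: "alt_insert (\<lambda>u us. F u us - G u us) vs = alt_insert F vs - alt_insert G vs"
  by (simp add: alt_insert_def right_diff_distrib sum_subtractf)

text \<open>
  The terms that single out \<open>u\<close> and then \<open>v\<close>, and \<open>v\<close> and then \<open>u\<close>, have opposite signs.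
\<close>

lemma alt_insert_symmetric:
  "(\<And>u v r. Z u v r = Z v u r) \<Longrightarrow> alt_insert (\<lambda>v us. alt_insert (Z v) us) vs = 0"
proof (induction vs arbitrary: Z)
  case (Cons a vs)
  have "alt_insert (\<lambda>v us. alt_insert (\<lambda>u r. Z v u (a # r)) us) vs = 0"
    by (rule Cons.IH) (rule Cons.prems)
  moreover have "Z a = (\<lambda>v. Z v a)" using Cons.prems by blast
  ultimately show ?case by (simp add: alt_insert_Cons alt_insert_diff)
qed simp

text \<open>
  Differentiating \<open>\<phi>\<^sup>*\<eta>\<close> gives the pulled back derivative of \<open>\<eta>\<close> and terms that contain a second
  derivative of \<open>\<phi>\<close>.  The latter cancel in the antisymmetrisation.
\<close>

theorem ext_deriv_pullback:
  assumes V: "open V" "x \<in> V" and V': "open V'" "\<phi> ` V \<subseteq> V'"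
    and \<phi>: "smooth_on V \<phi>" and \<eta>: "smooth_form V' k \<eta>"
  shows "ext_deriv (pullback \<phi> \<eta>) x = pullback \<phi> (ext_deriv \<eta>) x"
proof (rule ext)
  fix vs
  let ?A = "frechet_derivative \<phi> (at x)" and ?b = "second_derivative \<phi> x"
  have gx: "\<phi> x \<in> V'" using V V' by blast
  have W: "((\<lambda>y. frechet_derivative \<phi> (at y) u) has_derivative ?b u) (at x)" for u
    using smooth_on_differentiable[OF smooth_on_frechet_derivative[OF \<phi>] V(2)] by (simp add: frechet_derivative_works)
  have g: "(\<phi> has_derivative ?A) (at x)"
    using smooth_on_differentiable[OF \<phi> V(2)] by (simp add: frechet_derivative_works)
  have D: "frechet_derivative (\<lambda>y. pullback \<phi> \<eta> y us) (at x) v =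
      frechet_derivative (\<lambda>z. \<eta> z (map ?A us)) (at (\<phi> x)) (?A v) +
      alt_insert (\<lambda>u r. \<eta> (\<phi> x) (?b u v # map ?A r)) us" for us v
  proof -
    have "\<eta> (\<phi> x) ((map ?A us)[j := w]) = (-1) ^ j * \<eta> (\<phi> x) (w # map ?A (take j us @ drop (Suc j) us))"
      if "j < length us" for j w
      using alternating_move[OF smooth_form_alternating[OF \<eta> gx], of "take j (map ?A us)" w "drop (Suc j) (map ?A us)"] that
      by (simp add: upd_conv_take_nth_drop take_map drop_map)
    then have "(\<Sum>j<length us. \<eta> (\<phi> x) ((map ?A us)[j := ?b (us ! j) v])) =
        alt_insert (\<lambda>u r. \<eta> (\<phi> x) (?b u v # map ?A r)) us"
      by (simp add: alt_insert_def)
    then show ?thesis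
      unfolding pullback_def
      using frechet_derivative_unique[OF has_derivative_form_along[OF V V'(1) _ g W \<eta>, where us = us]] V'(2) by (simp add: image_subset_iff)
  qed
  have "ext_deriv (pullback \<phi> \<eta>) x vs =
      alt_insert (\<lambda>v us. frechet_derivative (\<lambda>z. \<eta> z (map ?A us)) (at (\<phi> x)) (?A v)) vs +
      alt_insert (\<lambda>v us. alt_insert (\<lambda>u r. \<eta> (\<phi> x) (?b u v # map ?A r)) us) vs"
    unfolding ext_deriv_eq_alt_insert dir_deriv_def D by (simp add: alt_insert_def distrib_left sum.distrib)
  also have "alt_insert (\<lambda>v us. alt_insert (\<lambda>u r. \<eta> (\<phi> x) (?b u v # map ?A r)) us) vs = 0"
    by (rule alt_insert_symmetric) (simp add: second_derivative_symmetric[OF V \<phi>])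
  finally show "ext_deriv (pullback \<phi> \<eta>) x vs = pullback \<phi> (ext_deriv \<eta>) x vs"
    by (simp add: alt_insert_def pullback_def ext_deriv_def take_map drop_map)
qed

lemma pullback_wedge: "pullback \<phi> (\<lambda>y. wedge (\<alpha> y) (\<beta> y)) x = wedge (pullback \<phi> \<alpha> x) (pullback \<phi> \<beta> x)"
  by (rule ext) (simp add: pullback_def[abs_def] wedge_map)

lemma pullback_poisson:
  assumes \<omega>: "symplectic_space (\<omega> (\<phi> x)) n" and \<omega>': "symplectic_space (pullback \<phi> \<omega> x) n"
    and \<phi>: "\<phi> differentiable at x" and \<xi>: "alternating k (\<xi> (\<phi> x))"
  shows "pullback \<phi> (\<lambda>y. poisson (\<omega> y) (\<xi> y)) x = poisson (pullback \<phi> \<omega> x) (pullback \<phi> \<xi> x)"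
proof (rule ext)
  fix vs
  let ?A = "frechet_derivative \<phi> (at x)"
  interpret \<omega>: symplectic_space "\<omega> (\<phi> x)" n by (rule \<omega>)
  interpret \<omega>': symplectic_space "pullback \<phi> \<omega> x" n by (rule \<omega>')
  have lin: "linear ?A" using \<phi> by (rule frechet_derivative_linear)
  have "inj ?A"
  proof (rule linear_injective_0[OF lin, THEN iffD2], intro allI impI)
    fix v assume "?A v = 0"
    then have "pullback \<phi> \<omega> x [v, w] = 0" for w
      using linear_0[OF \<omega>.linear_left] by (simp add: pullback_def)
    then show "v = 0" by (rule \<omega>'.nondegenerate)
  qed
  then have "surj ?A" using linear_injective_imp_surjective[OF lin] by simp
  then show "pullback \<phi> (\<lambda>y. poisson (\<omega> y) (\<xi> y)) x vs = poisson (pullback \<phi> \<omega> x) (pullback \<phi> \<xi> x) vs"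
    using poisson_map[OF \<omega> \<omega>' lin _ _ \<xi>, of vs] by (simp add: pullback_def[abs_def])
qed

subsection \<open>Smoothness of the Lefschetz operators\<close>

lemma smooth_form_wedge:
  "open V \<Longrightarrow> smooth_form V k \<alpha> \<Longrightarrow> smooth_form V l \<beta> \<Longrightarrow> smooth_form V (k + l) (\<lambda>x. wedge (\<alpha> x) (\<beta> x))"
  using smooth_components_wedge[OF _ smooth_form_components smooth_form_components, of V k \<alpha> l \<beta>]
  by (auto simp: smooth_form_def smooth_components_def alternating_wedge)

lemma smooth_components_wedge_power:
  "open V \<Longrightarrow> smooth_components V \<omega> \<Longrightarrow> smooth_components V (\<lambda>x. wedge_power (\<omega> x) m)"
proof (induction m)
  case 0
  show ?case by (simp add: smooth_components_def smooth_on_const)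
next
  case (Suc m)
  then show ?case using smooth_components_wedge[of V \<omega> "\<lambda>x. wedge_power (\<omega> x) m"] by simp
qed

lemma smooth_on_dual_vec:
  assumes V: "open V" and \<omega>: "smooth_components V \<omega>" "\<And>x. x \<in> V \<Longrightarrow> symplectic_space (\<omega> x) n" and f: "f \<in> Basis"
  shows "smooth_on V (\<lambda>x. dual_vec (\<omega> x) e \<bullet> f)"
proof -
  obtain us :: "'a list" where us: "set us = Basis - {f}" "distinct us"
    using finite_distinct_list[of "Basis - {f}"] by auto
  have "smooth_on V (\<lambda>x. - 1 * (real n * wedge (covec e) (wedge_power (\<omega> x) (n - 1)) us) / wedge_power (\<omega> x) n (f # us))"
  proof (intro smooth_on_divide smooth_on_cmult V)
    have "smooth_components V (\<lambda>x. covec e)" by (simp add: smooth_components_def smooth_on_const)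
    then show "smooth_on V (\<lambda>x. wedge (covec e) (wedge_power (\<omega> x) (n - 1)) us)"
      using smooth_components_wedge[OF V _ smooth_components_wedge_power[OF V \<omega>(1), of "n - 1"], of "\<lambda>x. covec e"]
      by (simp add: smooth_components_def)
    show "smooth_on V (\<lambda>x. wedge_power (\<omega> x) n (f # us))"
      using smooth_components_wedge_power[OF V \<omega>(1), of n] by (simp add: smooth_components_def)
    show "wedge_power (\<omega> x) n (f # us) \<noteq> 0" if "x \<in> V" for x
      by (rule symplectic_space.vol_nonzero[OF \<omega>(2)[OF that]]) (use us f in auto)
  qed
  then show ?thesis
    by (rule smooth_on_cong[OF V]) (simp add: symplectic_space.J_component[OF \<omega>(2) f us(2,1)])
qed

lemma smooth_components_poisson:
  assumes V: "open V" and \<omega>: "smooth_components V \<omega>" "\<And>x. x \<in> V \<Longrightarrow> symplectic_space (\<omega> x) n"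
    and \<xi>: "smooth_form V k \<xi>"
  shows "smooth_components V (\<lambda>x. poisson (\<omega> x) (\<xi> x))"
  unfolding smooth_components_def
proof
  fix vs
  let ?J = "\<lambda>x. dual_vec (\<omega> x)"
  have "smooth_on V (\<lambda>x. (1/2) * (\<Sum>e\<in>Basis. \<Sum>f\<in>Basis. (?J x e \<bullet> f) * \<xi> x (f # e # vs)))"
    using smooth_componentsD(1)[OF smooth_form_components[OF \<xi>]]
    by (intro smooth_on_cmult smooth_on_sum smooth_on_mult smooth_on_dual_vec[OF V \<omega>] V)
  then show "smooth_on V (\<lambda>x. poisson (\<omega> x) (\<xi> x) vs)"
  proof (rule smooth_on_cong[OF V])
    fix x assume x: "x \<in> V"
    show "(1/2) * (\<Sum>e\<in>Basis. \<Sum>f\<in>Basis. (?J x e \<bullet> f) * \<xi> x (f # e # vs)) = poisson (\<omega> x) (\<xi> x) vs"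
      by (simp add: linear_basis_expansion[OF alternating_linear_Cons[OF smooth_form_alternating[OF \<xi> x]]] poisson_def iprod_def)
  qed
qed

section \<open>Forms on an orbifold\<close>

text \<open>
  Group elements and injections impose the same condition on a form, invariance under pullback.
  Collecting them in one predicate treats both at once.
\<close>

definition transition ::
    "'i set \<Rightarrow> ('i \<Rightarrow> ('a::euclidean_space, 'g, 'x) chart) \<Rightarrow> 'i \<Rightarrow> 'i \<Rightarrow> ('a \<Rightarrow> 'a) \<Rightarrow> bool" where
  "transition I c i j f \<longleftrightarrow> i \<in> I \<and> j \<in> I \<and>
     (i = j \<and> f \<in> chart_act (c i) ` carrier (chart_group (c i)) \<or> chart_injection (c i) (c j) f)"

lemma on_charts_eq_iff:
  "on_charts I c \<xi> = \<xi> \<longleftrightarrow> (\<forall>i x. \<not> (i \<in> I \<and> x \<in> chart_dom (c i)) \<longrightarrow> \<xi> i x = 0)"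
  by (auto simp: on_charts_def fun_eq_iff)

lemma on_charts_in: "i \<in> I \<Longrightarrow> x \<in> chart_dom (c i) \<Longrightarrow> on_charts I c \<xi> i x = \<xi> i x"
  by (rule ext) (simp add: on_charts_def)

lemma on_charts_out: "\<not> (i \<in> I \<and> x \<in> chart_dom (c i)) \<Longrightarrow> on_charts I c \<xi> i x = 0"
  by (rule ext) (auto simp: on_charts_def)

lemma orbi_forms_iff:
  "\<xi> \<in> orbi_forms I c k \<longleftrightarrow>
     (\<forall>i x. \<not> (i \<in> I \<and> x \<in> chart_dom (c i)) \<longrightarrow> \<xi> i x = 0) \<and>
     (\<forall>i\<in>I. smooth_form (chart_dom (c i)) k (\<xi> i)) \<and>
     (\<forall>i j f. transition I c i j f \<longrightarrow> (\<forall>x \<in> chart_dom (c i). pullback f (\<xi> j) x = \<xi> i x))"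
  unfolding orbi_forms_def on_charts_eq_iff transition_def by blast

lemma smooth_form_cong:
  assumes "open V" "\<And>x. x \<in> V \<Longrightarrow> \<eta> x = \<zeta> x" "smooth_form V k \<eta>"
  shows "smooth_form V k \<zeta>"
  unfolding smooth_form_def
proof (intro conjI ballI allI)
  show "alternating k (\<zeta> x)" if "x \<in> V" for x
    using assms(2)[OF that] smooth_form_alternating[OF assms(3) that] by simp
  show "smooth_on V (\<lambda>x. \<zeta> x vs)" for vs
    by (rule smooth_on_cong[OF assms(1) smooth_componentsD(1)[OF smooth_form_components[OF assms(3)]]])
       (simp add: assms(2))
qed

lemma smooth_form_linear:
  assumes "open V"
  shows "smooth_form V k 0" "smooth_form V k \<eta> \<Longrightarrow> smooth_form V k \<zeta> \<Longrightarrow> smooth_form V k (\<eta> + \<zeta>)"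
    "smooth_form V k \<eta> \<Longrightarrow> smooth_form V k (r *\<^sub>R \<eta>)"
  using assms by (simp_all add: smooth_form_def alternating_zero alternating_add alternating_scale
      smooth_on_const smooth_on_add smooth_on_cmult)

lemma pullback_linear:
  "pullback f 0 x = 0" "pullback f (\<eta> + \<zeta>) x = pullback f \<eta> x + pullback f \<zeta> x"
  "pullback f (r *\<^sub>R \<eta>) x = r *\<^sub>R pullback f \<eta> x"
  by (simp_all add: pullback_def fun_eq_iff)

lemma pullback_cong: "\<eta> (f x) = \<zeta> (f x) \<Longrightarrow> pullback f \<eta> x = pullback f \<zeta> x"
  by (rule ext) (simp add: pullback_def)

definition orbi_poisson ::
    "('i \<Rightarrow> 'a::euclidean_space \<Rightarrow> 'a list \<Rightarrow> real) \<Rightarrow> ('i \<Rightarrow> 'a \<Rightarrow> 'a list \<Rightarrow> real) \<Rightarrow>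
      'i \<Rightarrow> 'a \<Rightarrow> 'a list \<Rightarrow> real" where
  "orbi_poisson \<omega> \<xi> i x = poisson (\<omega> i x) (\<xi> i x)"

lemma orbi_wedge_at: "orbi_wedge \<omega> \<xi> i x = wedge (\<omega> i x) (\<xi> i x)"
  by (simp add: orbi_wedge_def)

lemma linear_orbi_wedge: "linear (orbi_wedge \<omega>)"
  by (intro linearI ext) (simp_all add: orbi_wedge_at)

lemma linear_orbi_poisson: "linear (orbi_poisson \<omega>)"
  by (intro linearI ext) (simp_all add: orbi_poisson_def linear_add[OF linear_poisson] linear_scale[OF linear_poisson])

lemma orbi_wedge_pow_at: "(orbi_wedge \<omega> ^^ m) \<xi> i x = (wedge (\<omega> i x) ^^ m) (\<xi> i x)"
  by (induction m) (simp_all add: orbi_wedge_at)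

lemma orbi_poisson_pow_at: "(orbi_poisson \<omega> ^^ m) \<xi> i x = (poisson (\<omega> i x) ^^ m) (\<xi> i x)"
  by (induction m) (simp_all add: orbi_poisson_def)

text \<open>Graded by integers, to match the grading of \<open>lefschetz_module\<close>.\<close>

definition graded_forms ::
    "'i set \<Rightarrow> ('i \<Rightarrow> ('a::euclidean_space, 'g, 'x) chart) \<Rightarrow> int \<Rightarrow>
      ('i \<Rightarrow> 'a \<Rightarrow> 'a list \<Rightarrow> real) set" where
  "graded_forms I c k = (if k < 0 then {0} else orbi_forms I c (nat k))"

lemma graded_forms_of_nat [simp]: "graded_forms I c (int k) = orbi_forms I c k"
  by (simp add: graded_forms_def)

text \<open>
  A form is a family of forms on the chart domains that is invariant under the transitions.  The
  transitions are smooth and preserve \<open>\<omega>\<close>, so that the invariance of \<open>\<xi>\<close> passes on to \<open>\<omega> \<and> \<xi>\<close>, to \<open>\<Lambda> \<xi>\<close> and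
  to \<open>d\<xi>\<close>.
\<close>

locale symplectic_orbifold =
  fixes I :: "'i set" and c :: "'i \<Rightarrow> ('a::euclidean_space, 'g, 'x) chart"
    and \<omega> :: "'i \<Rightarrow> 'a \<Rightarrow> 'a list \<Rightarrow> real" and n :: nat
  assumes dim: "DIM('a) = 2 * n"
    and open_dom: "i \<in> I \<Longrightarrow> open (chart_dom (c i))"
    and transition_smooth: "transition I c i j f \<Longrightarrow> smooth_on (chart_dom (c i)) f"
    and transition_into: "transition I c i j f \<Longrightarrow> f ` chart_dom (c i) \<subseteq> chart_dom (c j)"
    and symplectic: "symplectic_form I c \<omega>"
begin

abbreviation dom :: "'i \<Rightarrow> 'a set" where "dom i \<equiv> chart_dom (c i)"
abbreviation \<Omega> :: "nat \<Rightarrow> ('i \<Rightarrow> 'a \<Rightarrow> 'a list \<Rightarrow> real) set" where "\<Omega> \<equiv> orbi_forms I c"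
abbreviation A :: "int \<Rightarrow> ('i \<Rightarrow> 'a \<Rightarrow> 'a list \<Rightarrow> real) set" where "A \<equiv> graded_forms I c"
abbreviation L where "L \<equiv> orbi_wedge \<omega>"
abbreviation P where "P \<equiv> orbi_poisson \<omega>"
abbreviation d where "d \<equiv> orbi_d I c"

lemma transition_index: "transition I c i j f \<Longrightarrow> i \<in> I" "transition I c i j f \<Longrightarrow> j \<in> I"
  by (auto simp: transition_def)

lemma form_out: "\<xi> \<in> \<Omega> k \<Longrightarrow> \<not> (i \<in> I \<and> x \<in> dom i) \<Longrightarrow> \<xi> i x = 0"
  by (simp add: orbi_forms_iff)

lemma form_smooth: "\<xi> \<in> \<Omega> k \<Longrightarrow> i \<in> I \<Longrightarrow> smooth_form (dom i) k (\<xi> i)"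
  by (simp add: orbi_forms_iff)

lemma form_components: "\<xi> \<in> \<Omega> k \<Longrightarrow> i \<in> I \<Longrightarrow> smooth_components (dom i) (\<xi> i)"
  by (rule smooth_form_components[OF form_smooth])

lemma form_pullback: "\<xi> \<in> \<Omega> k \<Longrightarrow> transition I c i j f \<Longrightarrow> x \<in> dom i \<Longrightarrow> pullback f (\<xi> j) x = \<xi> i x"
  by (simp add: orbi_forms_iff)

lemma form_alternating: "\<xi> \<in> \<Omega> k \<Longrightarrow> i \<in> I \<Longrightarrow> x \<in> dom i \<Longrightarrow> alternating k (\<xi> i x)"
  using form_smooth smooth_form_alternating by blast

lemma form_alternating': "\<xi> \<in> \<Omega> k \<Longrightarrow> alternating k (\<xi> i x)"
  using form_alternating[of \<xi> k i x] form_out[of \<xi> k i x] by (cases "i \<in> I \<and> x \<in> dom i") (auto simp: alternating_zero)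

lemma graded_alt_space: "\<xi> \<in> A k \<Longrightarrow> \<xi> i x \<in> alt_space k"
  using form_alternating'[of \<xi> "nat k" i x] by (auto simp: graded_forms_def alt_space_def split: if_splits)

lemma \<omega>_form: "\<omega> \<in> \<Omega> 2"
  using symplectic by (simp add: symplectic_form_def closed_forms_def)

lemma pointwise_symplectic: "i \<in> I \<Longrightarrow> x \<in> dom i \<Longrightarrow> symplectic_space (\<omega> i x) n"
  using symplectic dim form_alternating[OF \<omega>_form] unfolding symplectic_form_def symplectic_space_def by blast

lemma orbi_d_in: "i \<in> I \<Longrightarrow> x \<in> dom i \<Longrightarrow> d \<xi> i x = ext_deriv (\<xi> i) x"
  unfolding orbi_d_def by (rule on_charts_in)

lemma orbi_d_out: "\<not> (i \<in> I \<and> x \<in> dom i) \<Longrightarrow> d \<xi> i x = 0"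
  unfolding orbi_d_def by (rule on_charts_out)

lemma subspace_forms: "subspace (\<Omega> k)"
  unfolding subspace_def
proof (intro conjI ballI allI)
  show "0 \<in> \<Omega> k"
    by (simp add: orbi_forms_iff smooth_form_linear open_dom pullback_linear)
  show "\<xi> + \<zeta> \<in> \<Omega> k" if "\<xi> \<in> \<Omega> k" "\<zeta> \<in> \<Omega> k" for \<xi> \<zeta>
    using that by (simp add: orbi_forms_iff smooth_form_linear open_dom pullback_linear)
  show "r *\<^sub>R \<xi> \<in> \<Omega> k" if "\<xi> \<in> \<Omega> k" for r \<xi>
    using that by (simp add: orbi_forms_iff smooth_form_linear open_dom pullback_linear)
qed

lemma L_form:
  assumes "\<xi> \<in> \<Omega> k" shows "L \<xi> \<in> \<Omega> (k + 2)"
  unfolding orbi_forms_iff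
proof (intro conjI allI impI ballI)
  show "L \<xi> i x = 0" if "\<not> (i \<in> I \<and> x \<in> dom i)" for i x
    using form_out[OF assms that] by (simp add: orbi_wedge_at)
  show "smooth_form (dom i) (k + 2) (L \<xi> i)" if "i \<in> I" for i
    using smooth_form_wedge[OF open_dom[OF that] form_smooth[OF \<omega>_form that] form_smooth[OF assms that]]
    unfolding orbi_wedge_def[abs_def] by (simp add: add.commute)
  show "pullback f (L \<xi> j) x = L \<xi> i x" if "transition I c i j f" "x \<in> dom i" for i j f x
    using form_pullback[OF assms that] form_pullback[OF \<omega>_form that] pullback_wedge[of f "\<omega> j" "\<xi> j" x]
    by (simp add: orbi_wedge_def[abs_def])
qed

lemma P_form:
  assumes "\<xi> \<in> \<Omega> (k + 2)" shows "P \<xi> \<in> \<Omega> k"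
  unfolding orbi_forms_iff
proof (intro conjI allI impI ballI)
  show "P \<xi> i x = 0" if "\<not> (i \<in> I \<and> x \<in> dom i)" for i x
    using form_out[OF assms that] by (simp add: orbi_poisson_def linear_0[OF linear_poisson])
  show "smooth_form (dom i) k (P \<xi> i)" if i: "i \<in> I" for i
  proof -
    have "smooth_components (dom i) (P \<xi> i)"
      unfolding orbi_poisson_def[abs_def]
      using smooth_components_poisson[OF open_dom[OF i] form_components[OF \<omega>_form i] pointwise_symplectic[OF i] form_smooth[OF assms i]] .
    moreover have "alternating k (P \<xi> i x)" for x
    proof -
      have "\<xi> i x \<in> alt_space (int (k + 2))"
        using form_alternating'[OF assms] by (simp only: alt_space_of_nat)
      moreover have "int (k + 2) - 2 = int k" by simp
      ultimately have "poisson (\<omega> i x) (\<xi> i x) \<in> alt_space (int k)" by (metis poisson_mem)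
      then show ?thesis by (simp add: orbi_poisson_def)
    qed
    ultimately show ?thesis by (simp add: smooth_form_def smooth_components_def)
  qed
  show "pullback f (P \<xi> j) x = P \<xi> i x" if t: "transition I c i j f" and x: "x \<in> dom i" for i j f x
  proof -
    note ij = transition_index[OF t]
    have fx: "f x \<in> dom j" using transition_into[OF t] x by blast
    have "pullback f (\<lambda>y. poisson (\<omega> j y) (\<xi> j y)) x = poisson (pullback f (\<omega> j) x) (pullback f (\<xi> j) x)"
    proof (rule pullback_poisson)
      show "symplectic_space (pullback f (\<omega> j) x) n"
        using pointwise_symplectic[OF ij(1) x] form_pullback[OF \<omega>_form t x] by simp
    qed (use pointwise_symplectic[OF ij(2) fx] smooth_on_differentiable[OF transition_smooth[OF t] x] form_alternating[OF assms ij(2) fx] in auto)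
    then show ?thesis
      using form_pullback[OF assms t x] form_pullback[OF \<omega>_form t x] by (simp add: orbi_poisson_def[abs_def])
  qed
qed

lemma d_form:
  assumes "\<xi> \<in> \<Omega> k" shows "d \<xi> \<in> \<Omega> (Suc k)"
  unfolding orbi_forms_iff
proof (intro conjI allI impI ballI)
  show "d \<xi> i x = 0" if "\<not> (i \<in> I \<and> x \<in> dom i)" for i x
    by (rule orbi_d_out[OF that])
  show "smooth_form (dom i) (Suc k) (d \<xi> i)" if i: "i \<in> I" for i
    by (rule smooth_form_cong[OF open_dom[OF i] _ smooth_form_ext_deriv[OF open_dom[OF i] form_smooth[OF assms i]]])
       (simp add: orbi_d_in[OF i])
  show "pullback f (d \<xi> j) x = d \<xi> i x" if t: "transition I c i j f" and x: "x \<in> dom i" for i j f x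
  proof -
    note ij = transition_index[OF t]
    have fx: "f x \<in> dom j" using transition_into[OF t] x by blast
    have "pullback f (d \<xi> j) x = pullback f (ext_deriv (\<xi> j)) x"
      by (rule pullback_cong) (rule orbi_d_in[OF ij(2) fx])
    also have "\<dots> = ext_deriv (pullback f (\<xi> j)) x"
      by (rule ext_deriv_pullback[OF open_dom[OF ij(1)] x open_dom[OF ij(2)] transition_into[OF t]
            transition_smooth[OF t] form_smooth[OF assms ij(2)], symmetric])
    also have "\<dots> = ext_deriv (\<xi> i) x"
      by (rule ext_deriv_cong[OF open_dom[OF ij(1)] x _ form_components[OF assms ij(1)], symmetric])
         (rule form_pullback[OF assms t, symmetric])
    also have "\<dots> = d \<xi> i x" by (rule orbi_d_in[OF ij(1) x, symmetric])
    finally show ?thesis .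
  qed
qed

lemma forms_eqI:
  assumes "\<And>i x. i \<in> I \<Longrightarrow> x \<in> dom i \<Longrightarrow> f i x = g i x"
    and "\<And>i x. \<not> (i \<in> I \<and> x \<in> dom i) \<Longrightarrow> f i x = 0" "\<And>i x. \<not> (i \<in> I \<and> x \<in> dom i) \<Longrightarrow> g i x = 0"
  shows "f = (g :: 'i \<Rightarrow> 'a \<Rightarrow> 'a list \<Rightarrow> real)"
proof (intro ext)
  fix i x vs
  show "f i x vs = g i x vs" using assms(1)[of i x] assms(2,3)[of i x] by (cases "i \<in> I \<and> x \<in> dom i") auto
qed

lemma d_add: "\<xi> \<in> \<Omega> k \<Longrightarrow> \<zeta> \<in> \<Omega> k \<Longrightarrow> d (\<xi> + \<zeta>) = d \<xi> + d \<zeta>"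
proof (rule forms_eqI)
  fix i x assume *: "\<xi> \<in> \<Omega> k" "\<zeta> \<in> \<Omega> k" "i \<in> I" "x \<in> dom i"
  show "d (\<xi> + \<zeta>) i x = (d \<xi> + d \<zeta>) i x"
    using ext_deriv_add[OF form_components[OF *(1,3)] form_components[OF *(2,3)] *(4)]
    by (simp add: orbi_d_in[OF *(3,4)] plus_fun_def)
qed (simp_all add: orbi_d_out)

lemma d_scale: "\<xi> \<in> \<Omega> k \<Longrightarrow> d (r *\<^sub>R \<xi>) = r *\<^sub>R d \<xi>"
proof (rule forms_eqI)
  fix i x assume *: "\<xi> \<in> \<Omega> k" "i \<in> I" "x \<in> dom i"
  show "d (r *\<^sub>R \<xi>) i x = (r *\<^sub>R d \<xi>) i x"
    using ext_deriv_scale[OF form_components[OF *(1,2)] *(3), of r]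
    by (simp add: orbi_d_in[OF *(2,3)] scaleR_fun_def)
qed (simp_all add: orbi_d_out)

lemma d_d: "\<xi> \<in> \<Omega> k \<Longrightarrow> d (d \<xi>) = 0"
proof (rule forms_eqI)
  fix i x assume *: "\<xi> \<in> \<Omega> k" "i \<in> I" "x \<in> dom i"
  have "d (d \<xi>) i x = ext_deriv (d \<xi> i) x" by (rule orbi_d_in[OF *(2,3)])
  also have "\<dots> = ext_deriv (ext_deriv (\<xi> i)) x"
    by (rule ext_deriv_cong[OF open_dom[OF *(2)] *(3) _ form_components[OF d_form[OF *(1)] *(2)]])
       (rule orbi_d_in[OF *(2)])
  also have "\<dots> = 0" by (rule ext_deriv_ext_deriv[OF open_dom[OF *(2)] *(3) form_components[OF *(1,2)]])
  finally show "d (d \<xi>) i x = 0 i x" by simp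
qed (simp_all add: orbi_d_out)

lemma d_L: "\<xi> \<in> \<Omega> k \<Longrightarrow> d (L \<xi>) = L (d \<xi>)"
proof (rule forms_eqI)
  fix i x assume *: "\<xi> \<in> \<Omega> k" "i \<in> I" "x \<in> dom i"
  have "d \<omega> = (\<lambda>_ _ _. 0)" using symplectic by (simp add: symplectic_form_def closed_forms_def)
  then have d\<omega>: "ext_deriv (\<omega> i) x = 0" using orbi_d_in[OF *(2,3), of \<omega>] by (simp add: zero_fun_def)
  have "d (L \<xi>) i x = ext_deriv (\<lambda>y. wedge (\<omega> i y) (\<xi> i y)) x"
    unfolding orbi_d_in[OF *(2,3)] orbi_wedge_def[abs_def] ..
  also have "\<dots> = wedge (ext_deriv (\<omega> i) x) (\<xi> i x) + wedge (twist (\<omega> i x)) (ext_deriv (\<xi> i) x)"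
    by (rule ext_deriv_wedge[OF open_dom[OF *(2)] *(3) form_components[OF \<omega>_form *(2)] form_components[OF *(1,2)]])
  also have "\<dots> = L (d \<xi>) i x"
    unfolding d\<omega> twist_alternating[OF form_alternating'[OF \<omega>_form]] orbi_wedge_at orbi_d_in[OF *(2,3)] by simp
  finally show "d (L \<xi>) i x = L (d \<xi>) i x" .
next
  fix i x assume *: "\<xi> \<in> \<Omega> k" "\<not> (i \<in> I \<and> x \<in> dom i)"
  show "L (d \<xi>) i x = 0" using orbi_d_out[OF *(2), of \<xi>] by (simp add: orbi_wedge_at)
qed (simp_all add: orbi_d_out)

lemma d_zero: "d 0 = 0"
  using d_scale[OF subspace_0[OF subspace_forms], of 0] by simp

lemma L_zero: "L 0 = 0" and P_zero: "P 0 = 0"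
  by (rule linear_0[OF linear_orbi_wedge] linear_0[OF linear_orbi_poisson])+

lemma nonneg_cases: "(k < 0 \<Longrightarrow> Q) \<Longrightarrow> (\<And>m. k = int m \<Longrightarrow> Q) \<Longrightarrow> Q"
  by (metis nonneg_int_cases not_le)

lemma lefschetz_complex: "lefschetz_complex A L P n d"
proof (rule lefschetz_complex.intro[OF lefschetz_module.intro lefschetz_complex_axioms.intro])
  show "subspace (A k)" for k
    by (simp add: graded_forms_def subspace_single_0 subspace_forms)
  show "linear L" "linear P" by (rule linear_orbi_wedge linear_orbi_poisson)+
  show "A k = {0}" if k: "k < 0 \<or> 2 * int n < k" for k
  proof (cases "k < 0")
    case False
    have "\<xi> = 0" if "\<xi> \<in> \<Omega> (nat k)" for \<xi>
    proof (intro ext)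
      fix i x vs
      have "\<xi> i x = 0"
        by (rule alternating_above_dim[OF form_alternating'[OF that]]) (use k False dim in simp)
      then show "\<xi> i x vs = 0 i x vs" by simp
    qed
    then show ?thesis using False subspace_0[OF subspace_forms] by (auto simp: graded_forms_def)
  qed (simp add: graded_forms_def)
  fix x k assume x: "x \<in> A k"
  show "L x \<in> A (k + 2)"
  proof (cases k rule: nonneg_cases)
    case 1
    then have "x = 0" using x by (simp add: graded_forms_def)
    then show ?thesis using subspace_0[OF subspace_forms] by (simp add: L_zero graded_forms_def)
  next
    case (2 m)
    have e: "k + 2 = int (m + 2)" using 2 by simp
    show ?thesis using x L_form unfolding e unfolding 2 graded_forms_of_nat by blast
  qed
  show "d x \<in> A (k + 1)"
  proof (cases k rule: nonneg_cases)
    case 1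
    then have "x = 0" using x by (simp add: graded_forms_def)
    then show ?thesis using subspace_0[OF subspace_forms] by (simp add: d_zero graded_forms_def)
  next
    case (2 m)
    have e: "k + 1 = int (Suc m)" using 2 by simp
    show ?thesis using x d_form unfolding e unfolding 2 graded_forms_of_nat by blast
  qed
  show "P x \<in> A (k - 2)"
  proof (cases "k < 2")
    case True
    have "P x i y = 0" for i y
      using poisson_mem[OF graded_alt_space[OF x], of "\<omega> i y" i y] True by (simp add: orbi_poisson_def alt_space_def)
    then have "P x = 0" by (intro ext) simp
    then show ?thesis using True by (simp add: graded_forms_def)
  next
    case False
    then obtain m where m: "k - 2 = int m" using nonneg_int_cases[of "k - 2"] by auto
    then have e: "k = int (m + 2)" by simp
    show ?thesis using x P_form unfolding m unfolding e graded_forms_of_nat by blast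
  qed
  show "P (L x) = L (P x) + real_of_int (k - int n) *\<^sub>R x"
  proof (rule forms_eqI)
    fix i y assume iy: "i \<in> I" "y \<in> dom i"
    interpret symplectic_space "\<omega> i y" n by (rule pointwise_symplectic[OF iy])
    show "P (L x) i y = (L (P x) + real_of_int (k - int n) *\<^sub>R x) i y"
      using pt.commutator[OF graded_alt_space[OF x, of i y]] by (simp add: orbi_poisson_def orbi_wedge_at)
  next
    fix i y assume "\<not> (i \<in> I \<and> y \<in> dom i)"
    then have "x i y = 0" using x form_out[of x "nat k" i y] by (auto simp: graded_forms_def split: if_splits)
    then show "P (L x) i y = 0" "(L (P x) + real_of_int (k - int n) *\<^sub>R x) i y = 0"
      by (simp_all add: orbi_poisson_def orbi_wedge_at linear_0[OF linear_poisson])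
  qed
  show "d (r *\<^sub>R x) = r *\<^sub>R d x" for r
    using x d_scale by (auto simp: graded_forms_def d_zero split: if_splits)
  show "d (d x) = 0" using x d_d by (auto simp: graded_forms_def d_zero split: if_splits)
  show "d (L x) = L (d x)" using x d_L by (auto simp: graded_forms_def d_zero L_zero split: if_splits)
  show "d (x + y) = d x + d y" if "y \<in> A k" for y
    using x that d_add by (auto simp: graded_forms_def d_zero split: if_splits)
qed

sublocale orb: lefschetz_complex A L P n d
  by (rule lefschetz_complex)

subsection \<open>Harmonic forms\<close>

lemma star_sum_at:
  assumes "i \<in> I" "x \<in> dom i"
  shows "orb.star_sum K N k \<xi> i x = lefschetz_module.star_sum (wedge (\<omega> i x)) (poisson (\<omega> i x)) K N k (\<xi> i x)"
proof -
  interpret symplectic_space "\<omega> i x" n by (rule pointwise_symplectic[OF assms])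
  show ?thesis
    unfolding orb.star_sum_def pt.star_sum_def by (rule ext) (simp add: orbi_wedge_pow_at orbi_poisson_pow_at)
qed

lemma orbi_star_eq:
  assumes "\<xi> \<in> \<Omega> k" "k < 2 * K"
  shows "orbi_star I c \<omega> n k \<xi> = (star_sign k * fact n) *\<^sub>R orb.star_sum K (int n) (int k) \<xi>"
proof (rule forms_eqI)
  fix i x assume ix: "i \<in> I" "x \<in> dom i"
  interpret symplectic_space "\<omega> i x" n by (rule pointwise_symplectic[OF ix])
  have "orbi_star I c \<omega> n k \<xi> i x = symplectic_star (\<omega> i x) n k (\<xi> i x)"
    unfolding orbi_star_def by (rule on_charts_in[where i = i and x = x and I = I and c = c, OF ix])
  also have "\<dots> = (star_sign k * fact n) *\<^sub>R pt.star_sum K (int n) (int k) (\<xi> i x)"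
    by (rule symplectic_star_eq_star_sum[OF form_alternating'[OF assms(1)] assms(2)])
  also have "\<dots> = ((star_sign k * fact n) *\<^sub>R orb.star_sum K (int n) (int k) \<xi>) i x"
    unfolding scaleR_fun_apply star_sum_at[OF ix] ..
  finally show "orbi_star I c \<omega> n k \<xi> i x = ((star_sign k * fact n) *\<^sub>R orb.star_sum K (int n) (int k) \<xi>) i x" .
next
  fix i x assume out: "\<not> (i \<in> I \<and> x \<in> dom i)"
  show "orbi_star I c \<omega> n k \<xi> i x = 0" unfolding orbi_star_def by (rule on_charts_out[where i = i and x = x and I = I and c = c, OF out])
  have "orb.star_sum K (int n) (int k) \<xi> \<in> A (2 * int n - int k)"
    by (rule orb.star_sum_mem) (use assms(1) in simp)
  then have "orb.star_sum K (int n) (int k) \<xi> i x = 0"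
    using form_out[OF _ out] by (auto simp: graded_forms_def split: if_splits)
  then show "((star_sign k * fact n) *\<^sub>R orb.star_sum K (int n) (int k) \<xi>) i x = 0" by simp
qed

lemma star_sum_eq_0_iff:
  assumes "\<xi> \<in> \<Omega> k" "k < 2 * K"
  shows "orb.star_sum K (int n) (int k) \<xi> = 0 \<longleftrightarrow> \<xi> = 0"
proof
  assume z: "orb.star_sum K (int n) (int k) \<xi> = 0"
  show "\<xi> = 0"
  proof (rule forms_eqI)
    fix i x assume ix: "i \<in> I" "x \<in> dom i"
    interpret symplectic_space "\<omega> i x" n by (rule pointwise_symplectic[OF ix])
    have "pt.star_sum K (int n) (int k) (\<xi> i x) = 0"
      unfolding star_sum_at[OF ix, symmetric] z by simp
    then have "\<xi> i x = 0" by (intro star_sum_inj[OF form_alternating'[OF assms(1)], of K]) (use assms(2) in simp_all)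
    then show "\<xi> i x = 0 i x" by simp
  qed (use form_out[OF assms(1)] in simp_all)
qed (simp add: linear_0[OF orb.linear_star_sum])

lemma orbi_star_eq_0_iff: "\<xi> \<in> \<Omega> k \<Longrightarrow> orbi_star I c \<omega> n k \<xi> = 0 \<longleftrightarrow> \<xi> = 0"
  using orbi_star_eq[of \<xi> k "Suc k"] star_sum_eq_0_iff[of \<xi> k "Suc k"] by simp

text \<open>
  The outer star of \<open>\<delta>\<close> is injective, so \<open>\<delta> \<xi> = 0\<close> means \<open>d \<star> \<xi> = 0\<close>.  As \<open>\<xi>\<close> is closed, this is the
  vanishing of \<open>\<star> [\<Lambda>, d] \<xi> = - \<star> d \<Lambda> \<xi>\<close> up to a constant.
\<close>

lemma harmonic_iff: "harmonic I c \<omega> n k \<xi> \<longleftrightarrow> \<xi> \<in> orb.Harm (int k)"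
proof (cases "\<xi> \<in> \<Omega> k \<and> d \<xi> = 0")
  case False
  then show ?thesis by (auto simp: harmonic_def orb.Harm_def zero_fun_def)
next
  case True
  then have \<xi>: "\<xi> \<in> \<Omega> k" "\<xi> \<in> A (int k)" and d\<xi>: "d \<xi> = 0" by simp_all
  let ?star = "orbi_star I c \<omega> n"
  have "orbi_delta I c \<omega> n k \<xi> = (-1) ^ k *\<^sub>R ?star (2 * n - k + 1) (d (?star k \<xi>))"
    unfolding orbi_delta_def by (intro ext) simp
  then have delta: "orbi_delta I c \<omega> n k \<xi> = 0 \<longleftrightarrow> ?star (2 * n - k + 1) (d (?star k \<xi>)) = 0" by simp
  have "orbi_delta I c \<omega> n k \<xi> = 0 \<longleftrightarrow> d (P \<xi>) = 0"
  proof (cases "k \<le> 2 * n")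
    case False
    \<comment> \<open>Here \<open>2 * n - k\<close> is truncated, but all forms vanish.\<close>
    then have "\<xi> = 0" using orb.eq_zero[OF \<xi>(2)] by simp
    moreover have "?star m 0 = 0" for m
      using orbi_star_eq_0_iff[of 0 m] subspace_0[OF subspace_forms] by simp
    ultimately show ?thesis unfolding delta by (simp add: d_zero P_zero)
  next
    case True
    let ?c = "star_sign k * fact n" and ?s = "orb.star_sum (Suc k) (int n) (int k) \<xi>"
    have e: "2 * int n - int k = int (2 * n - k)" using True by simp
    have s: "?s \<in> \<Omega> (2 * n - k)" using orb.star_sum_mem[OF \<xi>(2), of "Suc k" "int n"] unfolding e by simp
    have star: "?star k \<xi> = ?c *\<^sub>R ?s" by (rule orbi_star_eq[OF \<xi>(1)]) simp
    have "d (?star k \<xi>) \<in> \<Omega> (2 * n - k + 1)"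
      unfolding star using d_form[OF subspace_scale[OF subspace_forms s]] by simp
    then have "orbi_delta I c \<omega> n k \<xi> = 0 \<longleftrightarrow> d (?star k \<xi>) = 0"
      unfolding delta by (rule orbi_star_eq_0_iff)
    also have "d (?star k \<xi>) = ?c *\<^sub>R d ?s" unfolding star by (rule d_scale[OF s])
    also have "?c *\<^sub>R d ?s = 0 \<longleftrightarrow> d ?s = 0" by simp
    also have "d ?s = - orb.star_sum k (int n) (int k - 1) (orb.codiff \<xi>)"
      by (rule orb.d_star_sum[OF \<xi>(2) d\<xi>])
    also have "\<dots> = 0 \<longleftrightarrow> orb.codiff \<xi> = 0"
    proof (cases k)
      case 0
      then have "orb.codiff \<xi> = 0" using orb.eq_zero[OF orb.codiff_mem[OF \<xi>(2)]] by simp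
      then show ?thesis by (simp add: linear_0[OF orb.linear_star_sum])
    next
      case (Suc m)
      then have e: "int k - 1 = int m" by simp
      have "orb.codiff \<xi> \<in> \<Omega> m" using orb.codiff_mem[OF \<xi>(2)] unfolding e by simp
      then show ?thesis unfolding e neg_equal_0_iff_equal by (rule star_sum_eq_0_iff) (simp add: Suc)
    qed
    also have "orb.codiff \<xi> = 0 \<longleftrightarrow> d (P \<xi>) = 0"
      by (simp only: orb.codiff_def d\<xi> P_zero diff_0 neg_equal_0_iff_equal)
    finally show ?thesis .
  qed
  then show ?thesis using \<xi> d\<xi> by (simp add: harmonic_def orb.Harm_def zero_fun_def)
qed

subsection \<open>Cohomology\<close>

lemma closed_forms_iff: "x \<in> closed_forms I c k \<longleftrightarrow> x \<in> A (int k) \<and> d x = 0"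
  by (simp add: closed_forms_def zero_fun_def)

lemma exact_forms_eq: "exact_forms I c k = d ` A (int k - 1)"
proof (cases k)
  case 0
  then show ?thesis by (simp add: exact_forms_def graded_forms_def d_zero) (simp add: zero_fun_def)
next
  case (Suc m)
  then have "int k - 1 = int m" by simp
  then show ?thesis by (simp add: exact_forms_def Suc)
qed

lemma subspace_exact: "subspace (exact_forms I c k)"
  unfolding subspace_def exact_forms_eq
proof (intro conjI ballI allI)
  show "0 \<in> d ` A (int k - 1)" using orb.zero_mem d_zero by force
  fix x y assume "x \<in> d ` A (int k - 1)" "y \<in> d ` A (int k - 1)"
  then show "x + y \<in> d ` A (int k - 1)"
    using orb.d_add subspace_add[OF orb.subspace] by (smt (verit) imageE imageI)
next
  fix r x assume "x \<in> d ` A (int k - 1)"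
  then show "r *\<^sub>R x \<in> d ` A (int k - 1)"
    using orb.d_scale subspace_scale[OF orb.subspace] by (smt (verit) imageE imageI)
qed

lemma cohomology_class_eq: "cohomology_class I c k x = (\<lambda>\<eta>. x + \<eta>) ` exact_forms I c k"
  unfolding cohomology_class_def by (rule image_cong) (auto simp: fun_eq_iff)

lemma mem_cohomology_class: "y \<in> cohomology_class I c k x \<longleftrightarrow> y - x \<in> exact_forms I c k"
  unfolding cohomology_class_eq by (metis (no_types, lifting) add_diff_cancel_left' diff_add_cancel add.commute image_iff)

lemma cohomology_class_eq_iff: "cohomology_class I c k x = cohomology_class I c k y \<longleftrightarrow> x - y \<in> exact_forms I c k"
proof
  assume "cohomology_class I c k x = cohomology_class I c k y"
  moreover have "x \<in> cohomology_class I c k x"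
    using subspace_0[OF subspace_exact] by (simp add: mem_cohomology_class)
  ultimately show "x - y \<in> exact_forms I c k" by (simp add: mem_cohomology_class)
next
  assume xy: "x - y \<in> exact_forms I c k"
  show "cohomology_class I c k x = cohomology_class I c k y"
  proof (rule Set.set_eqI)
    fix z
    have "z - y = (z - x) + (x - y)" "z - x = (z - y) - (x - y)" by simp_all
    then show "z \<in> cohomology_class I c k x \<longleftrightarrow> z \<in> cohomology_class I c k y"
      unfolding mem_cohomology_class
      using subspace_add[OF subspace_exact _ xy] subspace_diff[OF subspace_exact _ xy] by metis
  qed
qed

lemma L_exact: "x \<in> exact_forms I c m \<Longrightarrow> L x \<in> exact_forms I c (m + 2)"
proof -
  assume "x \<in> exact_forms I c m"
  then obtain z where z: "z \<in> A (int m - 1)" "x = d z" by (auto simp: exact_forms_eq)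
  then have "L x = d (L z)" using orb.d_L by simp
  moreover have "L z \<in> A (int (m + 2) - 1)" using orb.L_mem[OF z(1)] by (simp add: algebra_simps)
  ultimately show ?thesis by (auto simp: exact_forms_eq)
qed

text \<open>The classes of \<open>\<omega> \<and> y\<close>, for \<open>y\<close> in the class of \<open>x\<close>, all coincide, because \<open>L\<close> maps exact forms to exact forms.\<close>

lemma lefschetz_class:
  "lefschetz I c \<omega> m (cohomology_class I c m x) = cohomology_class I c (m + 2) (L x)"
proof -
  have "cohomology_class I c (m + 2) (L y) = cohomology_class I c (m + 2) (L x)"
    if "y \<in> cohomology_class I c m x" for y
  proof -
    have "L (y - x) \<in> exact_forms I c (m + 2)" using that L_exact by (simp add: mem_cohomology_class)
    then show ?thesis by (simp add: cohomology_class_eq_iff orb.L_simps)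
  qed
  moreover have "x \<in> cohomology_class I c m x"
    using subspace_0[OF subspace_exact] by (simp add: mem_cohomology_class)
  ultimately show ?thesis unfolding lefschetz_def by blast
qed

lemma lefschetz_power_class:
  "lefschetz_power I c \<omega> m j (cohomology_class I c m x) = cohomology_class I c (m + 2 * j) ((L ^^ j) x)"
  by (induction j) (simp_all add: lefschetz_class)

lemma harmonic_representatives_iff:
  "(\<forall>k. \<forall>a \<in> cohomology I c k. \<exists>\<xi> \<in> a. harmonic I c \<omega> n k \<xi>) \<longleftrightarrow>
    (\<forall>k. \<forall>x \<in> A k. d x = 0 \<longrightarrow> (\<exists>z \<in> A (k - 1). x + d z \<in> orb.Harm k))"
proof -
  have "(\<forall>a \<in> cohomology I c k. \<exists>\<xi> \<in> a. harmonic I c \<omega> n k \<xi>) \<longleftrightarrow>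
      (\<forall>x \<in> A (int k). d x = 0 \<longrightarrow> (\<exists>z \<in> A (int k - 1). x + d z \<in> orb.Harm (int k)))" for k
    unfolding cohomology_def harmonic_iff cohomology_class_eq exact_forms_eq ball_simps bex_simps closed_forms_iff
    by (auto simp: closed_forms_iff)
  moreover have "(\<exists>z \<in> A (k - 1). x + d z \<in> orb.Harm k)" if "k < 0" "x \<in> A k" for k x
    using orb.eq_zero[OF that(2)] that(1) orb.zero_mem[of "k - 1"]
    by (intro bexI[of _ 0]) (auto simp: orb.Harm_def orb.zero_mem d_zero P_zero)
  ultimately show ?thesis by (metis nonneg_cases)
qed

lemma image_eq_iff_covered:
  "f ` S \<subseteq> g ` T \<Longrightarrow> f ` S = g ` T \<longleftrightarrow> (\<forall>x\<in>T. \<exists>y\<in>S. g x = f y)"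
  by blast

lemma lefschetz_surjective_iff:
  "(\<forall>k \<in> {0..n}. lefschetz_power I c \<omega> (n - k) k ` cohomology I c (n - k) = cohomology I c (n + k)) \<longleftrightarrow>
    orb.Lefschetz_property"
proof -
  have *: "lefschetz_power I c \<omega> (n - k) k ` cohomology I c (n - k) = cohomology I c (n + k) \<longleftrightarrow>
      (\<forall>x \<in> A (int n + int k). d x = 0 \<longrightarrow>
        (\<exists>y \<in> A (int n - int k). d y = 0 \<and> (\<exists>z \<in> A (int n + int k - 1). x = (L ^^ k) y + d z)))"
    (is "?im = _ \<longleftrightarrow> ?R") if k: "k \<le> n" for k
  proof -
    let ?cl = "cohomology_class I c (n + k)"
    have e: "int (n - k) = int n - int k" "int (n + k) = int n + int k" "n - k + 2 * k = n + k" using k by simp_all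
    have im: "?im = (\<lambda>y. ?cl ((L ^^ k) y)) ` closed_forms I c (n - k)"
      unfolding cohomology_def image_image lefschetz_power_class e ..
    have sub: "(\<lambda>y. ?cl ((L ^^ k) y)) ` closed_forms I c (n - k) \<subseteq> ?cl ` closed_forms I c (n + k)"
    proof -
      have "(L ^^ k) y \<in> closed_forms I c (n + k)" if "y \<in> closed_forms I c (n - k)" for y
      proof -
        have y: "y \<in> A (int n - int k)" "d y = 0" using that by (simp_all only: closed_forms_iff e)
        have "(L ^^ k) y \<in> A (int n + int k)" using orb.L_pow_mem[OF y(1), of k] by (simp add: add.commute)
        moreover have "d ((L ^^ k) y) = 0" using orb.d_L_pow[OF y(1), of k] y(2) orb.L_pow_simps(4) by simp
        ultimately show ?thesis by (simp only: closed_forms_iff e)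
      qed
      then show ?thesis by blast
    qed
    have "?im = cohomology I c (n + k) \<longleftrightarrow> (\<forall>x \<in> closed_forms I c (n + k). \<exists>y \<in> closed_forms I c (n - k). ?cl x = ?cl ((L ^^ k) y))"
      unfolding im unfolding cohomology_def by (rule image_eq_iff_covered[OF sub])
    also have "\<dots> \<longleftrightarrow> (\<forall>x \<in> closed_forms I c (n + k). \<exists>y \<in> closed_forms I c (n - k). \<exists>z \<in> A (int n + int k - 1). x = (L ^^ k) y + d z)"
    proof -
      have "?cl x = ?cl y \<longleftrightarrow> (\<exists>z \<in> A (int n + int k - 1). x = y + d z)" for x y
        unfolding cohomology_class_eq_iff exact_forms_eq e(2) by (auto simp: image_iff diff_eq_eq add.commute)
      then show ?thesis by simp
    qed
    also have "\<dots> \<longleftrightarrow> ?R"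
      by (simp only: Ball_def Bex_def closed_forms_iff e conj_assoc imp_conjL)
    finally show ?thesis .
  qed
  have big: "\<exists>y \<in> A (int n - int k). d y = 0 \<and> (\<exists>z \<in> A (int n + int k - 1). x = (L ^^ k) y + d z)"
    if "n < k" "x \<in> A (int n + int k)" for k x
    using orb.eq_zero[OF that(2)] that(1) orb.zero_mem orb.L_pow_simps(4)
    by (intro bexI[of _ 0] conjI) (auto simp: d_zero)
  show ?thesis
    unfolding orb.Lefschetz_property_def
  proof (intro iffI allI ballI)
    fix k assume "\<forall>k. \<forall>x \<in> A (int n + int k). d x = 0 \<longrightarrow>
        (\<exists>y \<in> A (int n - int k). d y = 0 \<and> (\<exists>z \<in> A (int n + int k - 1). x = (L ^^ k) y + d z))" "k \<in> {0..n}"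
    then show "lefschetz_power I c \<omega> (n - k) k ` cohomology I c (n - k) = cohomology I c (n + k)"
      using *[of k] by simp
  next
    fix k x assume all: "\<forall>k \<in> {0..n}. lefschetz_power I c \<omega> (n - k) k ` cohomology I c (n - k) = cohomology I c (n + k)"
      and x: "x \<in> A (int n + int k)"
    show "d x = 0 \<longrightarrow> (\<exists>y \<in> A (int n - int k). d y = 0 \<and> (\<exists>z \<in> A (int n + int k - 1). x = (L ^^ k) y + d z))"
    proof (cases "k \<le> n")
      case True
      then show ?thesis using all *[of k] x by simp
    next
      case False
      then show ?thesis using big x by simp
    qed
  qed
qed

end

lemma symplectic_orbifoldI:
  fixes c :: "'i \<Rightarrow> ('a::euclidean_space, 'g, 'x) chart"
  assumes "DIM('a) = 2 * n" and orb: "orbifold X I U c" and "symplectic_form I c \<omega>"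
  shows "symplectic_orbifold I c \<omega> n"
proof
  have u: "uniformizing_system X (U i) (c i)" if "i \<in> I" for i
    using orb that by (simp add: orbifold_def)
  show "open (chart_dom (c i))" if "i \<in> I" for i
    using u[OF that] by (simp add: uniformizing_system_def)
  show "smooth_on (chart_dom (c i)) f" if "transition I c i j f" for i j f
    using that u[of i] by (auto simp: transition_def uniformizing_system_def chart_injection_def smooth_open_embedding_def)
  show "f ` chart_dom (c i) \<subseteq> chart_dom (c j)" if t: "transition I c i j f" for i j f
  proof (cases "chart_injection (c i) (c j) f")
    case True
    then show ?thesis by (simp add: chart_injection_def smooth_open_embedding_def)
  next
    case False
    then obtain g where g: "i = j" "i \<in> I" "g \<in> carrier (chart_group (c i))" "f = chart_act (c i) g"
      using t by (auto simp: transition_def)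
    have "faithful_action (chart_group (c i)) (chart_dom (c i)) (chart_act (c i))"
      using u[OF g(2)] by (simp add: uniformizing_system_def)
    then have "group_action (chart_group (c i)) (chart_dom (c i)) (chart_act (c i))"
      by (rule faithful_action.axioms)
    from group_action.element_image[OF this g(3)] show ?thesis using g by auto
  qed
qed (use assms in auto)

theorem theorem14:
  fixes X :: "'x topology" and I :: "'i set" and U :: "'i \<Rightarrow> 'x set"
    and c :: "'i \<Rightarrow> ('a::euclidean_space, 'g, 'x) chart"
    and \<omega> :: "'i \<Rightarrow> 'a \<Rightarrow> 'a list \<Rightarrow> real" and n :: nat
  assumes "DIM('a) = 2 * n"
    and "orbifold X I U c"
    and "symplectic_form I c \<omega>"
  shows "(\<forall>k. \<forall>a \<in> cohomology I c k. \<exists>\<xi> \<in> a. harmonic I c \<omega> n k \<xi>) \<longleftrightarrow>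
    (\<forall>k \<in> {0..n}.
       lefschetz_power I c \<omega> (n - k) k ` cohomology I c (n - k) = cohomology I c (n + k))"
proof -
  interpret symplectic_orbifold I c \<omega> n
    by (rule symplectic_orbifoldI[OF assms])
  show ?thesis
    unfolding harmonic_representatives_iff lefschetz_surjective_iff
    by (rule orb.harmonic_representatives_iff_Lefschetz_property)
qed

end
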